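(* For $n\in\mathbb{N}$ let $(U_j^{(n)})_{j\in\mathbb{N}}$ be independent random variables, each uniformly distributed on $[n]=\{1,\dots,n\}$, and put $Y_n(m):=\log{\rm lcm}(U_1^{(n)},\dots,U_m^{(n)})$ (with $Y_n(0)=0$). For $y\ge0$ put $$c_n(y):=\sum_{p\le n,\ p \text{ prime}}\log p\,\bigl(1-(1-n^{-1}\lfloor n/p\rfloor)^y\bigr).$$ Let $(m_n)$ be a sequence of positive integers and $(B(t))_{t\ge0}$ a standard Brownian motion. (i) If $m_n\le n^{1/2}$ for all sufficiently large $n$ and $m_n\to\infty$, then $$\left(\frac{Y_n(\lfloor m_n t\rfloor)-c_n(\lfloor m_n t\rfloor)}{\sqrt{2^{-1}m_n}\,\log m_n}\right)_{t\ge0}\to (B(t))_{t\ge0}$$ in the sense of finite-dimensional distributions as $n\to\infty$. (ii) If $m_n>n^{1/2}$ for all sufficiently large $n$ and $m_n=o(n)$, then $$\left(\frac{Y_n(\lfloor m_n t\rfloor)-c_n(\lfloor m_n t\rfloor)}{\sqrt{2^{-1}m_n(\log n-\log m_n)(3\log m_n-\log n)}}\right)_{t\ge0}\to (B(t))_{t\ge0}$$ in the sense of finite-dimensional distributions as $n\to\infty$.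
   Context: ${\rm lcm}$ denotes least common multiple. Convergence of finite-dimensional distributions means that for every $k$ and $0\le t_1<\dots<t_k$ the vector of values at $t_1,\dots,t_k$ converges in distribution. *)

theory Defs
  imports "HOL-Probability.Probability" "HOL-Computational_Algebra.Primes"
begin

text \<open>Y_n(m) = log lcm(U_1,...,U_m), with Lcm of the empty set = 1, so Y_n(0) = 0.\<close>
definition Ylcm :: "(nat \<Rightarrow> 'a \<Rightarrow> nat) \<Rightarrow> nat \<Rightarrow> 'a \<Rightarrow> real" where
  "Ylcm U m \<omega> = ln (real (Lcm ((\<lambda>j. U j \<omega>) ` {1..m})))"

definition cn :: "nat \<Rightarrow> real \<Rightarrow> real" where
  "cn n y = (\<Sum>p\<in>{p. prime p \<and> p \<le> n}.
      ln (real p) * (1 - (1 - real (n div p) / real n) powr y))"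

definition standard_BM :: "'b measure \<Rightarrow> (real \<Rightarrow> 'b \<Rightarrow> real) \<Rightarrow> bool" where
  "standard_BM N B \<longleftrightarrow> prob_space N
     \<and> (\<forall>t. B t \<in> borel_measurable N)
     \<and> (\<forall>\<omega>\<in>space N. B 0 \<omega> = 0)
     \<and> (\<forall>\<omega>\<in>space N. continuous_on {0..} (\<lambda>t. B t \<omega>))
     \<and> (\<forall>s t. 0 \<le> s \<and> s < t \<longrightarrow>
           distributed N lborel (\<lambda>\<omega>. B t \<omega> - B s \<omega>) (normal_density 0 (sqrt (t - s))))
     \<and> (\<forall>(ts :: nat \<Rightarrow> real) k. 0 \<le> ts 0 \<and> (\<forall>i<k. ts i < ts (Suc i)) \<longrightarrow>
           prob_space.indep_vars N (\<lambda>_. borel) (\<lambda>i \<omega>. B (ts (Suc i)) \<omega> - B (ts i) \<omega>) {..<k})"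

definition conv_distr_vec ::
  "(nat \<Rightarrow> 'a measure) \<Rightarrow> (nat \<Rightarrow> 'a \<Rightarrow> real^'k::finite) \<Rightarrow> 'b measure \<Rightarrow> ('b \<Rightarrow> real^'k) \<Rightarrow> bool" where
  "conv_distr_vec M X N Z \<longleftrightarrow>
     (\<forall>f :: real^'k \<Rightarrow> real. continuous_on UNIV f \<and> bounded (range f) \<longrightarrow>
        (\<lambda>n. integral\<^sup>L (M n) (\<lambda>\<omega>. f (X n \<omega>))) \<longlonglongrightarrow> integral\<^sup>L N (\<lambda>\<omega>. f (Z \<omega>)))"

definition fdd_conv ::
  "(nat \<Rightarrow> 'a measure) \<Rightarrow> (nat \<Rightarrow> real \<Rightarrow> 'a \<Rightarrow> real) \<Rightarrow> 'b measure \<Rightarrow> (real \<Rightarrow> 'b \<Rightarrow> real)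
    \<Rightarrow> ('k::finite \<Rightarrow> real) \<Rightarrow> bool" where
  "fdd_conv M X N B t \<longleftrightarrow>
     conv_distr_vec M (\<lambda>n \<omega>. \<chi> i. X n (t i) \<omega>) N (\<lambda>\<omega>. \<chi> i. B (t i) \<omega>)"

end

(*
  Write L(u) for the sum of ln p over the primes p dividing u, and let f(u), g(u) be the parts of
  L(u) coming from the primes p <= z and p > z, where z = m_n.  Higher prime powers contribute only
  O(sqrt z) to Y_n(k) for k = O(z), and c_n(k) is exactly the mean of the sum of ln p over the primes
  that divide some U_j.  For p <= z the events that p divides some U_j are almost uncorrelated, and
  their weighted sum has variance O(z (1 + ln z)).  For p > z the same holds for the excess
  max 0 (N_p - 1), where N_p is the number of j with p | U_j; again the weighted sum of these
  excesses has variance O(z (1 + ln z)).  Hence, up to an L1-error O(sqrt (z (1 + ln z))), the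
  centred Y_n(k) is the centred sum of g(U_1), ..., g(U_k), i.e. a row sum of a triangular array
  of i.i.d. variables.

  If z > sqrt n, at most one prime p > z divides u, and Mertens' theorem gives the variance of g.
  If z <= sqrt n, one passes from g to -f, because ln n - L(U) has bounded second moment, and
  Var f = (ln z)^2 / 2 + O(ln z).  A Lyapunov central limit theorem for the increments, combined with
  their independence and Slutsky's theorem, yields the finite-dimensional limits.
*)
theory Submission
  imports Defs "HOL-Number_Theory.Prime_Powers" "HOL-Real_Asymp.Real_Asymp"
begin

section \<open>Chebyshev's bound and partial summation\<close>

text \<open>For p > z a single covariance of hit counts is only known to be at most k / (p q), and
  against the weights ln p ln q this can add up to order z (ln n)^2, too much to neglect. The way
  out is 1[N_p \<ge> 1] = N_p - max 0 (N_p - 1): the linear part is kept exactly, as a sum of i.i.d.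
  terms, and in the covariance of two excesses the first-order terms cancel down to order k^3 / (p
  q)^2, which sums to O(z) over p, q > z. For p \<le> z only an upper bound of order k (1/p + 1/q) /
  n is used, which stems from the rounding in the floor of n / p. The threshold z = m_n balances the
  two ranges. The error z (1 + ln z) is smaller than the squared norming by a factor of order ln z
  in case (i) and ln n - ln m_n in case (ii); this is where m_n tending to infinity and m_n = o(n)
  enter. For z \<le> sqrt n several primes of g may divide u at once, with pairwise products on both
  sides of n, whereas the product of two primes of f never exceeds n; hence the passage to
  -f.\<close>

definition primes_in :: "nat \<Rightarrow> nat \<Rightarrow> nat set" where
  "primes_in z n = {p. prime p \<and> z < p \<and> p \<le> n}"

lemma finite_primes_in [simp, intro]: "finite (primes_in z n)"
  by (rule finite_subset[of _ "{..n}"]) (auto simp: primes_in_def)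

lemma primes_in_pos: "p \<in> primes_in z n \<Longrightarrow> 0 < p"
  by (auto simp: primes_in_def prime_gt_0_nat)

lemma ln_ge_0_of_nat [simp]: "0 \<le> ln (real n)"
  by (cases "n = 0") auto

definition theta :: "nat \<Rightarrow> real" where
  "theta n = (\<Sum>p\<in>primes_in 0 n. ln (real p))"

lemma theta_nonneg: "0 \<le> theta n"
  unfolding theta_def by (intro sum_nonneg) auto

lemma primes_in_Un: "a \<le> b \<Longrightarrow> b \<le> c \<Longrightarrow> primes_in a c = primes_in a b \<union> primes_in b c"
  by (auto simp: primes_in_def)

lemma primes_in_Int: "primes_in a b \<inter> primes_in b c = {}"
  by (auto simp: primes_in_def)

lemma sum_primes_in_split:
  "a \<le> b \<Longrightarrow> b \<le> c \<Longrightarrow> (\<Sum>p\<in>primes_in a c. f p) = (\<Sum>p\<in>primes_in a b. f p) + (\<Sum>p\<in>primes_in b c. f p)"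
  by (subst primes_in_Un[of a b c]) (auto simp: sum.union_disjoint primes_in_Int)

lemma prod_primes_dvd:
  assumes "finite P" "\<And>p. p \<in> P \<Longrightarrow> prime p \<and> p dvd (N::nat)"
  shows "\<Prod>P dvd N"
  using assms
proof (induction P)
  case (insert p P)
  have "coprime p (\<Prod>P)"
    by (rule prod_coprime_right) (use insert in \<open>auto intro!: primes_coprime\<close>)
  with insert show ?case by (auto intro!: divides_mult)
qed simp

text \<open>The two middle entries of row 2m+1 of Pascal's triangle are equal, so each is at most
  half of the row sum 2 ^ (2m+1).\<close>

lemma binomial_middle_odd: "(2*m+1) choose m \<le> 4 ^ m"
proof -
  have "2 * ((2*m+1) choose m) = ((2*m+1) choose m) + ((2*m+1) choose (m+1))"
    by (subst binomial_symmetric[of "m+1"]) auto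
  also have "\<dots> = (\<Sum>k\<in>{m,m+1}. (2*m+1) choose k)" by simp
  also have "\<dots> \<le> (\<Sum>k\<le>2*m+1. (2*m+1) choose k)"
    by (rule sum_mono2) auto
  also have "\<dots> = 2 ^ (2*m+1)" by (rule choose_row_sum)
  also have "\<dots> = 2 * 4 ^ m" by (simp add: power_mult)
  finally show ?thesis by simp
qed

text \<open>A prime p with m + 1 < p \<le> 2m + 1 divides (2m+1)! but neither m! nor (m+1)!, so it
  survives in the binomial coefficient. The product of all these primes then divides the coefficient
  and is at most 4 ^ m.\<close>

lemma theta_binomial: "theta (2*m+1) - theta (m+1) \<le> m * ln 4"
proof -
  let ?P = "primes_in (m+1) (2*m+1)" and ?C = "(2*m+1) choose m"
  have dvd: "p dvd ?C" if "p \<in> ?P" for p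
  proof -
    have p: "prime p" "m + 1 < p" "p \<le> 2*m+1" using that by (auto simp: primes_in_def)
    have "fact m * fact (m+1) * ?C = fact (2*m+1)"
      using binomial_fact_lemma[of m "2*m+1"] by (simp add: mult_2)
    moreover have "p dvd fact (2*m+1)" using p by (simp add: prime_dvd_fact_iff del: fact_Suc)
    ultimately have "p dvd fact m * fact (m+1) * ?C" by simp
    then show ?thesis using p by (auto simp: prime_dvd_mult_iff prime_dvd_fact_iff simp del: fact_Suc)
  qed
  have "\<Prod>?P dvd ?C" by (rule prod_primes_dvd) (use dvd in \<open>auto simp: primes_in_def\<close>)
  then have "\<Prod>?P \<le> ?C" by (rule dvd_imp_le) simp
  with binomial_middle_odd[of m] have le: "real (\<Prod>?P) \<le> 4 ^ m"
    by (metis (mono_tags) le_trans of_nat_le_iff of_nat_numeral of_nat_power)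
  have "theta (2*m+1) = theta (m+1) + (\<Sum>p\<in>?P. ln (real p))"
    unfolding theta_def by (rule sum_primes_in_split) auto
  also have "(\<Sum>p\<in>?P. ln (real p)) = ln (real (\<Prod>?P))"
    by (subst of_nat_prod, subst ln_prod) (auto dest: primes_in_pos)
  also have "\<dots> \<le> ln (4 ^ m)"
    by (rule ln_mono) (use le in \<open>auto intro!: prod_pos dest: primes_in_pos simp del: of_nat_prod simp: of_nat_prod[symmetric]\<close>)
  finally show ?thesis by (simp add: ln_realpow)
qed

text \<open>Erdos' induction: an even n > 2 is not prime and can be lowered by one, while n = 2m+1
  is reduced to m+1 < n, the binomial step paying the remaining m ln 4.\<close>

lemma theta_le: "theta n \<le> n * ln 4"
proof (induction n rule: less_induct)
  case (less n)
  consider "n \<le> 1" | "n = 2" | "n > 2" "even n" | "n > 2" "odd n"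
  proof -
    have "n \<le> 1 \<or> n = 2 \<or> n > 2" by linarith
    then show ?thesis using that by blast
  qed
  then show ?case
  proof cases
    case 1
    have "\<not> p \<le> n" if "prime p" for p using prime_gt_1_nat[OF that] 1 by linarith
    then have "primes_in 0 n = {}" unfolding primes_in_def by blast
    then show ?thesis by (simp add: theta_def)
  next
    case 2
    have "p = 2" if "prime p" "p \<le> 2" for p :: nat using prime_ge_2_nat[OF that(1)] that by simp
    then have "primes_in 0 n = {2}" using 2 by (auto simp: primes_in_def)
    moreover have "ln 2 \<le> 2 * ln (4::real)"
      using ln_ge_zero[of "4::real"] ln_mono[of "2::real" 4] by linarith
    ultimately show ?thesis using 2 by (simp add: theta_def)
  next
    case 3
    have "\<not> prime n" using 3 by (auto dest: prime_odd_nat)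
    then have "p \<le> n - 1" if "prime p" "p \<le> n" for p
      using that by (cases "p = n") auto
    then have "primes_in 0 n = primes_in 0 (n - 1)" by (auto simp: primes_in_def)
    then have "theta n = theta (n - 1)" by (simp add: theta_def)
    also have "\<dots> \<le> (n - 1) * ln 4" using less.IH[of "n-1"] 3 by auto
    also have "\<dots> \<le> n * ln 4" by (simp add: mult_right_mono)
    finally show ?thesis .
  next
    case 4
    then obtain m where m: "n = 2*m+1" by (auto elim: oddE)
    have "theta n \<le> theta (m+1) + m * ln 4" using theta_binomial[of m] m by simp
    also have "\<dots> \<le> (m+1) * ln 4 + m * ln 4" using less.IH[of "m+1"] 4 m by simp
    also have "\<dots> = n * ln 4" using m by (simp add: algebra_simps)
    finally show ?thesis .
  qed
qed

text \<open>Weighted AM-GM, in the form \<open>r powr s \<le> 1 - s + s * r\<close>, takes the place of the usual comparison with an integral.\<close>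
lemma powr_diff_le:
  assumes "0 < \<alpha>" "\<alpha> < \<beta>" "0 < (x::real)" "x < y"
  shows "x powr \<alpha> * (x powr -\<beta> - y powr -\<beta>) \<le> \<beta> / (\<beta> - \<alpha>) * (x powr (\<alpha> - \<beta>) - y powr (\<alpha> - \<beta>))"
proof -
  define r where "r = x / y"
  have r: "0 < r" "r < 1" using assms by (auto simp: r_def)
  have "(r powr \<beta>) powr ((\<beta> - \<alpha>)/\<beta>) * 1 powr (\<alpha>/\<beta>) \<le> (\<beta> - \<alpha>)/\<beta> * r powr \<beta> + \<alpha>/\<beta> * 1"
    by (rule Youngs_inequality_0) (use assms r in \<open>auto simp: field_simps\<close>)
  then have *: "r powr (\<beta> - \<alpha>) \<le> (\<beta> - \<alpha>)/\<beta> * r powr \<beta> + \<alpha>/\<beta>"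
    using assms by (simp add: powr_powr)
  have "1 - r powr \<beta> \<le> \<beta> / (\<beta> - \<alpha>) * (1 - r powr (\<beta> - \<alpha>))"
    using assms * by (simp add: field_simps)
  then have "x powr (\<alpha> - \<beta>) * (1 - r powr \<beta>) \<le> x powr (\<alpha> - \<beta>) * (\<beta> / (\<beta> - \<alpha>) * (1 - r powr (\<beta> - \<alpha>)))"
    by (rule mult_left_mono) auto
  moreover have "x powr (\<alpha> - \<beta>) * (1 - r powr \<beta>) = x powr \<alpha> * (x powr -\<beta> - y powr -\<beta>)"
    using assms by (simp add: r_def powr_divide powr_diff powr_minus field_simps)
  moreover have "x powr (\<alpha> - \<beta>) * (1 - r powr (\<beta> - \<alpha>)) = x powr (\<alpha> - \<beta>) - y powr (\<alpha> - \<beta>)"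
    using assms by (simp add: r_def powr_divide powr_diff powr_minus field_simps)
  ultimately show ?thesis by (simp add: algebra_simps)
qed

text \<open>Abel summation as an induction on n. Once the boundary term
  \<open>S n * n powr -\<beta>\<close> is moved to the left, a step adds only S n times a difference
  of powers, which \<open>powr_diff_le\<close> turns into a telescoping bound. The boundary term is
  absorbed at the end, as \<beta> / (\<beta> - \<alpha>) \<ge> 1.\<close>

lemma partial_summation_tail:
  fixes a :: "nat \<Rightarrow> real"
  assumes nonneg: "\<And>d. 0 \<le> a d" and A: "\<And>x. (\<Sum>d\<in>{1..x}. a d) \<le> C * real x powr \<alpha>"
    and \<alpha>\<beta>: "0 < \<alpha>" "\<alpha> < \<beta>" and z: "1 \<le> z"
  shows "(\<Sum>d\<in>{z<..n}. a d * real d powr -\<beta>) \<le> C * \<beta> / (\<beta> - \<alpha>) * real z powr (\<alpha> - \<beta>)"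
proof -
  \<comment> \<open>At x = 1 the hypothesis reads \<open>a 1 \<le> C\<close>.\<close>
  have C: "0 \<le> C" using A[of 1] sum_nonneg[of "{1..1::nat}" a] nonneg by simp (metis order_trans)
  define S where "S n = (\<Sum>d\<in>{1..n}. a d)" for n
  have main: "(\<Sum>d\<in>{z<..n}. a d * real d powr -\<beta>) - S n * real n powr -\<beta>
         \<le> C * \<beta> / (\<beta> - \<alpha>) * (real z powr (\<alpha> - \<beta>) - real n powr (\<alpha> - \<beta>))" if "z \<le> n" for n
    using that
  proof (induction n rule: dec_induct)
    case base
    show ?case using sum_nonneg[of "{1..z}" a] nonneg by (simp add: S_def)
  next
    case (step n)
    have n: "0 < n" using step z by auto
    have "{z<..Suc n} = insert (Suc n) {z<..n}" using step by auto
    then have 1: "(\<Sum>d\<in>{z<..Suc n}. a d * real d powr -\<beta>) - S (Suc n) * real (Suc n) powr -\<beta>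
       = ((\<Sum>d\<in>{z<..n}. a d * real d powr -\<beta>) - S n * real n powr -\<beta>)
         + S n * (real n powr -\<beta> - real (Suc n) powr -\<beta>)"
      by (simp add: S_def algebra_simps)
    have "real (Suc n) powr -\<beta> \<le> real n powr -\<beta>"
      using n \<alpha>\<beta> by (intro powr_mono2') auto
    then have "S n * (real n powr -\<beta> - real (Suc n) powr -\<beta>) \<le>
        (C * real n powr \<alpha>) * (real n powr -\<beta> - real (Suc n) powr -\<beta>)"
      using A[of n] unfolding S_def by (intro mult_right_mono) auto
    also have "\<dots> \<le> C * (\<beta> / (\<beta> - \<alpha>) * (real n powr (\<alpha> - \<beta>) - real (Suc n) powr (\<alpha> - \<beta>)))"
      unfolding mult.assoc using C n \<alpha>\<beta> by (intro mult_left_mono powr_diff_le) auto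
    finally show ?case using step.IH unfolding 1 by (simp add: algebra_simps)
  qed
  show ?thesis
  proof (cases "z \<le> n")
    case True
    then have n: "0 < n" using z by auto
    have "S n * real n powr -\<beta> \<le> C * real n powr \<alpha> * real n powr -\<beta>"
      using A[of n] unfolding S_def by (intro mult_right_mono) auto
    also have "\<dots> = C * real n powr (\<alpha> - \<beta>)" using n by (simp add: powr_diff powr_minus field_simps)
    also have "\<dots> \<le> C * \<beta> / (\<beta> - \<alpha>) * real n powr (\<alpha> - \<beta>)"
    proof -
      have "1 \<le> \<beta> / (\<beta> - \<alpha>)" using \<alpha>\<beta> by (simp add: field_simps)
      then have "C * 1 \<le> C * (\<beta> / (\<beta> - \<alpha>))" using C by (intro mult_left_mono)
      then show ?thesis by (intro mult_right_mono) auto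
    qed
    finally show ?thesis using main[OF True] by (simp add: algebra_simps)
  qed (use C \<alpha>\<beta> in auto)
qed

text \<open>Only d = 1 lies outside the tail with z = 1, and its term is at most C by the hypothesis
  at x = 1.\<close>

lemma partial_summation_total:
  fixes a :: "nat \<Rightarrow> real"
  assumes nonneg: "\<And>d. 0 \<le> a d" and A: "\<And>x. (\<Sum>d\<in>{1..x}. a d) \<le> C * real x powr \<alpha>"
    and \<alpha>\<beta>: "0 < \<alpha>" "\<alpha> < \<beta>"
  shows "(\<Sum>d\<in>{1..n}. a d * real d powr -\<beta>) \<le> C * \<beta> / (\<beta> - \<alpha>) + C"
proof (cases "n = 0")
  case True
  have C: "0 \<le> C" using A[of 1] sum_nonneg[of "{1..1::nat}" a] nonneg by simp (metis order_trans)
  with True \<alpha>\<beta> show ?thesis by simp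
next
  case False
  then have "{1..n} = insert 1 {1<..n}" by auto
  then show ?thesis
    using partial_summation_tail[OF nonneg A \<alpha>\<beta>, of 1 n] A[of 1] by simp
qed

section \<open>Prime powers and Mertens' theorems\<close>

lemma sum_dvd_reindex:
  fixes d n :: nat and \<phi> :: "nat \<Rightarrow> real"
  assumes "0 < d"
  shows "(\<Sum>u\<in>{1..n}. of_bool (d dvd u) * \<phi> u) = (\<Sum>v\<in>{1..n div d}. \<phi> (d * v))"
proof -
  have "(\<Sum>u\<in>{1..n}. of_bool (d dvd u) * \<phi> u) = (\<Sum>u\<in>{u\<in>{1..n}. d dvd u}. \<phi> u)"
    by (subst sum.inter_filter, simp, intro sum.cong) auto
  also have "{u\<in>{1..n}. d dvd u} = (\<lambda>v. d * v) ` {1..n div d}"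
  proof (intro equalityI subsetI)
    fix u assume "u \<in> {u \<in> {1..n}. d dvd u}"
    then obtain v where v: "u = d * v" "1 \<le> u" "u \<le> n" by auto
    then have "v \<le> n div d" using assms by (simp add: less_eq_div_iff_mult_less_eq mult.commute)
    moreover have "1 \<le> v" using v by (cases v) auto
    ultimately show "u \<in> (\<lambda>v. d * v) ` {1..n div d}" using v by auto
  qed (use assms in \<open>auto simp: less_eq_div_iff_mult_less_eq mult.commute Suc_le_eq\<close>)
  also have "(\<Sum>u\<in>\<dots>. \<phi> u) = (\<Sum>v\<in>{1..n div d}. \<phi> (d * v))"
    using assms by (subst sum.reindex) (auto intro!: inj_onI)
  finally show ?thesis .
qed

lemma sum_of_bool_dvd: "0 < (d::nat) \<Longrightarrow> (\<Sum>u\<in>{1..n}. of_bool (d dvd u)) = real (n div d)"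
  using sum_dvd_reindex[of d "\<lambda>_. 1" n] by simp

lemma div_le_real: "real (n div d) \<le> real n / real d"
  by (rule of_nat_div_le_of_nat)

lemma div_gt_real: "0 < d \<Longrightarrow> real n / real d - 1 < real (n div d)"
  by (metis (no_types) floor_divide_of_nat_eq of_int_of_nat_eq real_of_int_floor_gt_diff_one)

lemma ln_le_powr: "0 < x \<Longrightarrow> 0 < e \<Longrightarrow> ln x \<le> x powr e / e" for x e :: real
  using ln_le_minus_one[of "x powr e"] by (simp add: ln_powr field_simps)

text \<open>\<open>lprimes 0 z\<close> and \<open>lprimes z n\<close> are the functions f and g of
  the overview; \<open>lprimes 0 n\<close> is L on [n].\<close>

definition lprimes :: "nat \<Rightarrow> nat \<Rightarrow> nat \<Rightarrow> real" where
  "lprimes z n u = (\<Sum>p\<in>primes_in z n. ln (real p) * of_bool (p dvd u))"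

definition mangoldt' :: "nat \<Rightarrow> real" where
  "mangoldt' d = (if prime d then 0 else mangoldt d)"

definition lpowers :: "nat \<Rightarrow> nat \<Rightarrow> real" where
  "lpowers n u = (\<Sum>d\<in>{1..n}. mangoldt' d * of_bool (d dvd u))"

lemma mangoldt'_nonneg: "0 \<le> mangoldt' d"
  by (simp add: mangoldt'_def mangoldt_nonneg)

lemma lprimes_nonneg: "0 \<le> lprimes z n u"
  unfolding lprimes_def by (intro sum_nonneg) auto

lemma lpowers_nonneg: "0 \<le> lpowers n u"
  unfolding lpowers_def by (intro sum_nonneg mult_nonneg_nonneg mangoldt'_nonneg) auto

lemma sum_mangoldt_split:
  "(\<Sum>d\<in>{1..n}. mangoldt d * h d) =
     (\<Sum>p\<in>primes_in 0 n. ln (real p) * h p) + (\<Sum>d\<in>{1..n}. mangoldt' d * (h d :: real))"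
proof -
  have P: "primes_in 0 n = {d\<in>{1..n}. prime d}" by (auto simp: primes_in_def)
  have "(\<Sum>p\<in>primes_in 0 n. ln (real p) * h p) = (\<Sum>d\<in>{1..n}. if prime d then mangoldt d * h d else 0)"
    unfolding P by (subst sum.inter_filter) (auto intro!: sum.cong)
  then show ?thesis
    by (simp add: sum.distrib[symmetric]) (intro sum.cong, auto simp: mangoldt'_def)
qed

text \<open>The divisor sum of the von Mangoldt function is ln; the primes among the divisors give
  the first summand and the proper prime powers the second.\<close>

lemma ln_eq_lprimes_lpowers:
  assumes "u \<in> {1..n}"
  shows "ln (real u) = lprimes 0 n u + lpowers n u"
proof -
  have "ln (real u) = (\<Sum>d | d dvd u. mangoldt d)"
    using mangoldt_sum[of u, where ?'a = real] assms by auto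
  also have "{d. d dvd u} = {d\<in>{1..n}. d dvd u}"
    using assms by (auto dest: dvd_imp_le simp: Suc_le_eq intro!: Nat.gr0I)
  also have "(\<Sum>d\<in>\<dots>. mangoldt d) = (\<Sum>d\<in>{1..n}. mangoldt d * of_bool (d dvd u) :: real)"
    by (subst sum.inter_filter, simp, intro sum.cong) auto
  finally show ?thesis unfolding lprimes_def lpowers_def by (simp only: sum_mangoldt_split)
qed

text \<open>A proper prime power up to x has a base p \<le> sqrt x, and all exponents allowed for p
  together contribute at most ln x. For p > x^(1/4) this is at most 4 ln p, so that Chebyshev's
  bound for \<open>theta\<close> applies; the at most x^(1/4) smaller primes cost ln x \<le> 4
  x^(1/4) each.\<close>

lemma sum_mangoldt'_le: "(\<Sum>d\<in>{1..x}. mangoldt' d) \<le> (4 + 4 * ln 4) * real x powr (1/2)"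
proof (cases "x = 0")
  case False
  then have x: "0 < real x" by simp
  define s where "s = nat \<lfloor>sqrt x\<rfloor>"
  define S where "S = (SIGMA p:primes_in 0 s. {k\<in>{2..x}. p ^ k \<le> x})"
  have finS: "finite S" unfolding S_def by (intro finite_SigmaI) auto
  have s: "real s \<le> sqrt x" by (simp add: s_def)
  have sub: "{d\<in>{1..x}. mangoldt' d \<noteq> 0} \<subseteq> (\<lambda>(p,k). p ^ k) ` S"
  proof
    fix d assume "d \<in> {d\<in>{1..x}. mangoldt' d \<noteq> 0}"
    then have d: "1 \<le> d" "d \<le> x" "\<not> prime d" "primepow d"
      by (auto simp: mangoldt'_def mangoldt_def split: if_splits)
    then obtain p k where pk: "prime p" "0 < k" "d = p ^ k" by (auto simp: primepow_def)
    have "k \<noteq> 1" using pk d by auto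
    then have k: "2 \<le> k" using pk by simp
    have "real p ^ 2 \<le> real p ^ k"
      using k prime_gt_0_nat[OF pk(1)] by (intro power_increasing) auto
    also have "\<dots> \<le> real x" using d pk by (metis of_nat_le_iff of_nat_power)
    finally have "real p \<le> sqrt x" by (simp add: real_le_rsqrt)
    then have "p \<le> s" by (simp add: s_def le_nat_floor)
    \<comment> \<open>This crude bound on the exponent only serves to keep the index set
      \<open>S\<close> finite.\<close>
    moreover have "k \<le> x"
    proof -
      have "k < 2 ^ k" by (rule less_exp)
      also have "\<dots> \<le> p ^ k" using prime_ge_2_nat[OF pk(1)] by (intro power_mono) auto
      finally show ?thesis using d pk by simp
    qed
    ultimately have "(p, k) \<in> S" using pk k d prime_gt_0_nat[OF pk(1)] by (auto simp: S_def primes_in_def)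
    then show "d \<in> (\<lambda>(p,k). p ^ k) ` S" using pk by force
  qed
  have "(\<Sum>d\<in>{1..x}. mangoldt' d) = (\<Sum>d\<in>{d\<in>{1..x}. mangoldt' d \<noteq> 0}. mangoldt' d)"
    by (intro sum.mono_neutral_right) auto
  also have "\<dots> \<le> (\<Sum>d\<in>(\<lambda>(p,k). p ^ k) ` S. mangoldt' d)"
    using finS by (intro sum_mono2 sub) (auto simp: mangoldt'_nonneg)
  also have "\<dots> \<le> sum (mangoldt' \<circ> (\<lambda>(p,k). p ^ k)) S"
    by (rule sum_image_le) (use finS mangoldt'_nonneg in auto)
  also have "\<dots> \<le> (\<Sum>(p,k)\<in>S. ln (real p))"
    by (intro sum_mono) (auto simp: S_def primes_in_def mangoldt'_def mangoldt_nonneg)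
  also have "\<dots> = (\<Sum>p\<in>primes_in 0 s. \<Sum>k\<in>{k\<in>{2..x}. p ^ k \<le> x}. ln (real p))"
    unfolding S_def by (subst sum.Sigma) auto
  also have "\<dots> \<le> (\<Sum>p\<in>primes_in 0 s. ln (real x))"
  proof (rule sum_mono)
    fix p assume "p \<in> primes_in 0 s"
    then have p: "2 \<le> p" using prime_ge_2_nat by (auto simp: primes_in_def)
    then have lp: "0 < ln (real p)" by simp
    define K where "K = nat \<lfloor>ln (real x) / ln (real p)\<rfloor>"
    have "{k\<in>{2..x}. p ^ k \<le> x} \<subseteq> {1..K}"
    proof
      fix k assume k: "k \<in> {k\<in>{2..x}. p ^ k \<le> x}"
      then have "real p ^ k \<le> real x" by (metis (mono_tags, lifting) mem_Collect_eq of_nat_le_iff of_nat_power)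
      then have "ln (real p ^ k) \<le> ln (real x)" using p by (intro ln_mono) auto
      then have "real k \<le> ln (real x) / ln (real p)" using p lp by (simp add: ln_realpow field_simps)
      then show "k \<in> {1..K}" using k by (auto simp: K_def le_nat_floor)
    qed
    then have "card {k\<in>{2..x}. p ^ k \<le> x} \<le> K" using card_mono[of "{1..K}"] by force
    moreover have "real K \<le> ln (real x) / ln (real p)" using lp by (simp add: K_def)
    ultimately have "real (card {k\<in>{2..x}. p ^ k \<le> x}) \<le> ln (real x) / ln (real p)" by linarith
    then show "(\<Sum>k\<in>{k\<in>{2..x}. p ^ k \<le> x}. ln (real p)) \<le> ln (real x)"
      using lp by (simp add: field_simps)
  qed
  also have "\<dots> \<le> (\<Sum>p\<in>primes_in 0 s. 4 * ln (real p) + of_bool (real p \<le> real x powr (1/4)) * ln (real x))"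
  proof (rule sum_mono)
    fix p assume "p \<in> primes_in 0 s"
    then have p: "0 < p" by (rule primes_in_pos)
    show "ln (real x) \<le> 4 * ln (real p) + of_bool (real p \<le> real x powr (1/4)) * ln (real x)"
    proof (cases "real p \<le> real x powr (1/4)")
      case False
      then have "ln (real x powr (1/4)) \<le> ln (real p)" using x by (intro ln_mono) auto
      then show ?thesis using False x by (simp add: ln_powr)
    qed simp
  qed
  also have "\<dots> = 4 * theta s + real (card {p\<in>primes_in 0 s. real p \<le> real x powr (1/4)}) * ln (real x)"
    by (simp add: sum.distrib theta_def sum_distrib_left sum_distrib_right[symmetric] sum_of_bool_eq Int_def)
  also have "\<dots> \<le> 4 * (sqrt x * ln 4) + real x powr (1/4) * (4 * real x powr (1/4))"
  proof (intro add_mono mult_mono mult_left_mono)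
    show "theta s \<le> sqrt x * ln 4"
      by (rule order.trans[OF theta_le mult_right_mono[OF s]]) simp
    have "card {p\<in>primes_in 0 s. real p \<le> real x powr (1/4)} \<le> card {1..nat \<lfloor>real x powr (1/4)\<rfloor>}"
      by (intro card_mono) (auto simp: primes_in_def le_nat_floor)
    then show "real (card {p\<in>primes_in 0 s. real p \<le> real x powr (1/4)}) \<le> real x powr (1/4)"
      by (simp add: le_nat_iff le_floor_iff)
    show "ln (real x) \<le> 4 * real x powr (1/4)" using ln_le_powr[OF x, of "1/4"] by simp
  qed (auto simp: theta_nonneg)
  also have "\<dots> = (4 + 4 * ln 4) * real x powr (1/2)"
    by (simp add: powr_half_sqrt powr_add[symmetric] algebra_simps)
  finally show ?thesis .
qed simp

text \<open>The factor 16 is what the sum with the extra weight ln d requires: partial summation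
  with exponent 3/4 gives 3 + 1, and ln d \<le> 4 d^(1/4) a further 4. The other sums over prime
  powers need less.\<close>

definition C_pow :: real where "C_pow = 16 * (4 + 4 * ln 4)"

lemma C_pow_pos: "0 < C_pow" by (simp add: C_pow_def add_pos_pos)

lemma sum_mangoldt'_div: "(\<Sum>d\<in>{1..n}. mangoldt' d / real d) \<le> C_pow"
proof -
  have "(\<Sum>d\<in>{1..n}. mangoldt' d / real d) = (\<Sum>d\<in>{1..n}. mangoldt' d * real d powr -1)"
    by (intro sum.cong) (auto simp: powr_minus_divide)
  also have "\<dots> \<le> (4 + 4 * ln 4) * 1 / (1 - 1/2) + (4 + 4 * ln 4)"
    by (rule partial_summation_total[OF mangoldt'_nonneg sum_mangoldt'_le]) auto
  also have "\<dots> \<le> C_pow" by (simp add: C_pow_def)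
  finally show ?thesis .
qed

text \<open>Trading ln d for d^(1/4) leaves the exponent 3/4, still above the exponent 1/2 of the
  counting bound, so the sum stays bounded.\<close>

lemma sum_mangoldt'_ln_div: "(\<Sum>d\<in>{1..n}. mangoldt' d * ln (real d) / real d) \<le> C_pow"
proof -
  have "(\<Sum>d\<in>{1..n}. mangoldt' d * ln (real d) / real d) \<le> (\<Sum>d\<in>{1..n}. 4 * (mangoldt' d * real d powr -(3/4)))"
  proof (rule sum_mono)
    fix d assume d: "d \<in> {1..n}"
    have "mangoldt' d * ln (real d) / real d \<le> mangoldt' d * (4 * real d powr (1/4)) / real d"
      using d ln_le_powr[of "real d" "1/4"] by (intro divide_right_mono mult_left_mono mangoldt'_nonneg) auto
    also have "real d powr (1/4) / real d = real d powr -(3/4)"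
      using d powr_diff[of "real d" "1/4" 1] by simp
    then have "mangoldt' d * (4 * real d powr (1/4)) / real d = 4 * (mangoldt' d * real d powr -(3/4))"
      by (metis (no_types) mult.left_commute times_divide_eq_right)
    finally show "mangoldt' d * ln (real d) / real d \<le> 4 * (mangoldt' d * real d powr -(3/4))" .
  qed
  also have "\<dots> \<le> 4 * ((4 + 4 * ln 4) * (3/4) / (3/4 - 1/2) + (4 + 4 * ln 4))"
    unfolding sum_distrib_left[symmetric]
    by (intro mult_left_mono partial_summation_total[OF mangoldt'_nonneg sum_mangoldt'_le]) auto
  also have "\<dots> = C_pow" by (simp add: C_pow_def)
  finally show ?thesis .
qed

text \<open>The weight majorises the probability that d divides one of k uniform samples. Up to z
  the weight 1 costs order sqrt z by the counting bound; beyond z the tail of k / d costs order k /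
  sqrt z, which is again order sqrt z as k \<le> T z.\<close>

lemma sum_mangoldt'_min:
  assumes "1 \<le> z" "0 \<le> T" "real k \<le> T * real z"
  shows "(\<Sum>d\<in>{1..n}. mangoldt' d * min 1 (real k / real d)) \<le> (1 + T) * C_pow * sqrt z"
proof -
  let ?C = "4 + 4 * ln 4 :: real"
  have "(\<Sum>d\<in>{1..n}. mangoldt' d * min 1 (real k / real d)) \<le>
     (\<Sum>d\<in>{1..z} \<union> {z<..n}. mangoldt' d * min 1 (real k / real d))"
    by (intro sum_mono2) (auto intro!: mult_nonneg_nonneg mangoldt'_nonneg)
  also have "\<dots> = (\<Sum>d\<in>{1..z}. mangoldt' d * min 1 (real k / real d)) + (\<Sum>d\<in>{z<..n}. mangoldt' d * min 1 (real k / real d))"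
    by (intro sum.union_disjoint) auto
  also have "\<dots> \<le> (\<Sum>d\<in>{1..z}. mangoldt' d) + (\<Sum>d\<in>{z<..n}. real k * (mangoldt' d * real d powr -1))"
  proof (intro add_mono sum_mono)
    fix d show "mangoldt' d * min 1 (real k / real d) \<le> mangoldt' d"
      using mult_left_mono[of "min 1 (real k / real d)" 1 "mangoldt' d"] by (simp add: mangoldt'_nonneg)
  next
    fix d assume "d \<in> {z<..n}"
    then show "mangoldt' d * min 1 (real k / real d) \<le> real k * (mangoldt' d * real d powr -1)"
      using mult_left_mono[of "min 1 (real k / real d)" "real k / real d" "mangoldt' d"]
      by (simp add: mangoldt'_nonneg powr_minus_divide mult.commute)
  qed
  also have "\<dots> \<le> ?C * real z powr (1/2) + real k * (?C * 1 / (1 - 1/2) * real z powr (1/2 - 1))"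
    unfolding sum_distrib_left[symmetric]
    by (intro add_mono mult_left_mono partial_summation_tail[OF mangoldt'_nonneg sum_mangoldt'_le] sum_mangoldt'_le)
       (use assms in auto)
  also have "\<dots> \<le> ?C * real z powr (1/2) + (T * real z) * (?C * 1 / (1 - 1/2) * real z powr (1/2 - 1))"
    using assms by (intro add_mono mult_right_mono) auto
  also have "\<dots> = (1 + 2 * T) * ?C * sqrt z"
  proof -
    have "real z * real z powr (1/2 - 1) = sqrt z"
      using assms powr_mult_base[of "real z" "1/2 - 1"] by (simp add: powr_half_sqrt)
    then have "T * real z * (?C * 1 / (1 - 1/2) * real z powr (1/2 - 1)) = 2 * T * ?C * sqrt z"
      by (simp add: mult.assoc mult.left_commute)
    then show ?thesis by (simp add: powr_half_sqrt algebra_simps)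
  qed
  finally have le: "(\<Sum>d\<in>{1..n}. mangoldt' d * min 1 (real k / real d)) \<le> (1 + 2 * T) * (?C * sqrt z)"
    by (simp only: mult.assoc)
  have "1 + 2 * T \<le> (1 + T) * 16" using assms by simp
  moreover have "0 \<le> ?C * sqrt z" by simp
  ultimately have "(1 + 2 * T) * (?C * sqrt z) \<le> (1 + T) * 16 * (?C * sqrt z)" by (rule mult_right_mono)
  also have "\<dots> = (1 + T) * C_pow * sqrt z" unfolding C_pow_def by (simp only: mult.assoc)
  finally show ?thesis by (rule order.trans[OF le])
qed

text \<open>\<open>lpowers\<close> is ln minus the prime part, and passing from v to d v can only
  enlarge the prime part while ln grows by ln d.\<close>

lemma lpowers_mult_le:
  assumes "d * v \<in> {1..n}"
  shows "lpowers n (d * v) \<le> ln (real d) + lpowers n v"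
proof -
  have d: "0 < d" "0 < v" using assms by (auto intro!: Nat.gr0I)
  then have "1 * v \<le> d * v" by (intro mult_le_mono1) simp
  also have "d * v \<le> n" using assms by simp
  finally have v: "v \<in> {1..n}" "0 < d" using d by simp_all
  have "lprimes 0 n v \<le> lprimes 0 n (d * v)"
    unfolding lprimes_def by (intro sum_mono mult_left_mono) auto
  moreover have "ln (real (d * v)) = ln (real d) + ln (real v)" using v by (simp add: ln_mult)
  ultimately show ?thesis using ln_eq_lprimes_lpowers[OF v(1)] ln_eq_lprimes_lpowers[OF assms] by linarith
qed

lemma sum_lpowers_le: "N \<le> n \<Longrightarrow> (\<Sum>u\<in>{1..N}. lpowers n u) \<le> C_pow * N"
proof -
  have "(\<Sum>u\<in>{1..N}. lpowers n u) = (\<Sum>d\<in>{1..n}. mangoldt' d * (\<Sum>u\<in>{1..N}. of_bool (d dvd u)))"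
    unfolding lpowers_def by (subst sum.swap) (simp only: sum_distrib_left)
  also have "\<dots> = (\<Sum>d\<in>{1..n}. mangoldt' d * real (N div d))"
    by (intro sum.cong refl) (subst sum_of_bool_dvd, auto)
  also have "\<dots> \<le> (\<Sum>d\<in>{1..n}. mangoldt' d * (real N / real d))"
    by (intro sum_mono mult_left_mono mangoldt'_nonneg div_le_real)
  also have "\<dots> = (\<Sum>d\<in>{1..n}. mangoldt' d / real d) * N"
    by (simp add: sum_distrib_right)
  also have "\<dots> \<le> C_pow * N" by (intro mult_right_mono sum_mangoldt'_div) auto
  finally show ?thesis .
qed

text \<open>Only one of the two factors is expanded over prime powers d. Substituting u = d v and
  applying \<open>lpowers_mult_le\<close> to the other factor avoids a double sum over pairs of
  prime powers.\<close>

lemma sum_lpowers_sq_le: "(\<Sum>u\<in>{1..n}. (lpowers n u)\<^sup>2) \<le> (C_pow + C_pow\<^sup>2) * n"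
proof -
  have "(\<Sum>u\<in>{1..n}. (lpowers n u)\<^sup>2) = (\<Sum>u\<in>{1..n}. \<Sum>d\<in>{1..n}. mangoldt' d * (of_bool (d dvd u) * lpowers n u))"
    unfolding power2_eq_square
    by (intro sum.cong refl) (subst (1) lpowers_def, simp only: sum_distrib_right mult.assoc)
  also have "\<dots> = (\<Sum>d\<in>{1..n}. mangoldt' d * (\<Sum>u\<in>{1..n}. of_bool (d dvd u) * lpowers n u))"
    by (subst sum.swap) (simp only: sum_distrib_left)
  also have "\<dots> \<le> (\<Sum>d\<in>{1..n}. mangoldt' d * ((ln (real d) + C_pow) * (real n / real d)))"
  proof (intro sum_mono mult_left_mono mangoldt'_nonneg)
    fix d assume d: "d \<in> {1..n}"
    have "(\<Sum>u\<in>{1..n}. of_bool (d dvd u) * lpowers n u) = (\<Sum>v\<in>{1..n div d}. lpowers n (d * v))"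
      using d by (intro sum_dvd_reindex) auto
    also have "\<dots> \<le> (\<Sum>v\<in>{1..n div d}. ln (real d) + lpowers n v)"
      using d by (intro sum_mono lpowers_mult_le)
        (auto simp: less_eq_div_iff_mult_less_eq mult.commute Suc_le_eq)
    also have "\<dots> \<le> real (n div d) * ln (real d) + C_pow * real (n div d)"
      using sum_lpowers_le[of "n div d" n] by (simp add: sum.distrib)
    also have "\<dots> = (ln (real d) + C_pow) * real (n div d)" by (simp add: algebra_simps)
    also have "\<dots> \<le> (ln (real d) + C_pow) * (real n / real d)"
      using C_pow_pos by (intro mult_left_mono div_le_real) auto
    finally show "(\<Sum>u\<in>{1..n}. of_bool (d dvd u) * lpowers n u) \<le> (ln (real d) + C_pow) * (real n / real d)" .
  qed
  also have "\<dots> = ((\<Sum>d\<in>{1..n}. mangoldt' d * ln (real d) / real d) + C_pow * (\<Sum>d\<in>{1..n}. mangoldt' d / real d)) * n"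
    by (simp add: sum_distrib_right sum_distrib_left sum.distrib[symmetric] field_simps)
  also have "\<dots> \<le> (C_pow + C_pow * C_pow) * n"
    using C_pow_pos by (intro mult_right_mono add_mono mult_left_mono sum_mangoldt'_div sum_mangoldt'_ln_div) auto
  finally show ?thesis by (simp add: power2_eq_square)
qed


lemma sum_inverse_sqrt_le: "(\<Sum>u\<in>{1..n}. 1 / sqrt (real u)) \<le> 2 * sqrt n"
proof (induction n)
  case (Suc n)
  have "1 / sqrt (real (Suc n)) \<le> 2 * (sqrt (Suc n) - sqrt n)"
  proof -
    have 1: "(sqrt (Suc n) - sqrt n) * (sqrt (Suc n) + sqrt n) = 1"
      by (simp add: algebra_simps)
    have "(sqrt (Suc n) - sqrt n) * (sqrt (Suc n) + sqrt n) \<le> (sqrt (Suc n) - sqrt n) * (2 * sqrt (Suc n))"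
      by (intro mult_left_mono) auto
    then have "1 \<le> 2 * (sqrt (Suc n) - sqrt n) * sqrt (Suc n)" using 1 by linarith
    then show ?thesis by (simp add: pos_divide_le_eq del: of_nat_Suc)
  qed
  with Suc show ?case by simp
qed simp

lemma sum_inverse_sqrt_ratio: "(\<Sum>u\<in>{1..n}. sqrt (real n / real u)) \<le> 2 * n"
proof -
  have "(\<Sum>u\<in>{1..n}. sqrt (real n / real u)) = sqrt n * (\<Sum>u\<in>{1..n}. 1 / sqrt (real u))"
    by (simp add: sum_distrib_left real_sqrt_divide)
  also have "\<dots> \<le> sqrt n * (2 * sqrt n)" by (intro mult_left_mono sum_inverse_sqrt_le) auto
  also have "\<dots> = 2 * n" by simp
  finally show ?thesis .
qed

text \<open>A mean-square substitute for Stirling's formula: ln (n / u) \<le> 4 (n / u)^(1/4), so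
  the square is at most 16 sqrt (n / u), and sqrt (n / u) averages to at most 2.\<close>

lemma sum_ln_ratio_sq_le: "(\<Sum>u\<in>{1..n}. (ln (real n / real u))\<^sup>2) \<le> 32 * n"
proof -
  have "(\<Sum>u\<in>{1..n}. (ln (real n / real u))\<^sup>2) \<le> (\<Sum>u\<in>{1..n}. 16 * sqrt (real n / real u))"
  proof (rule sum_mono)
    fix u assume u: "u \<in> {1..n}"
    then have "1 \<le> real n / real u" by simp
    then have "ln (real n / real u) \<le> 4 * (real n / real u) powr (1/4)" "0 \<le> ln (real n / real u)"
      using ln_le_powr[of "real n / real u" "1/4"] by auto
    then have "(ln (real n / real u))\<^sup>2 \<le> (4 * (real n / real u) powr (1/4))\<^sup>2" by (intro power_mono)
    also have "\<dots> = 16 * ((real n / real u) powr (1/4 + 1/4))"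
      unfolding powr_add by (simp add: power2_eq_square)
    also have "\<dots> = 16 * sqrt (real n / real u)" by (simp add: powr_half_sqrt)
    finally show "(ln (real n / real u))\<^sup>2 \<le> 16 * sqrt (real n / real u)" .
  qed
  also have "\<dots> \<le> 16 * (2 * real n)"
    unfolding sum_distrib_left[symmetric] by (rule mult_left_mono[OF sum_inverse_sqrt_ratio, THEN order.trans]) auto
  finally show ?thesis by simp
qed

lemma sum_ln_ratio_le: "(\<Sum>u\<in>{1..n}. ln (real n / real u)) \<le> 4 * n"
proof -
  have "(\<Sum>u\<in>{1..n}. ln (real n / real u)) \<le> (\<Sum>u\<in>{1..n}. 2 * sqrt (real n / real u))"
  proof (rule sum_mono)
    fix u assume u: "u \<in> {1..n}"
    then show "ln (real n / real u) \<le> 2 * sqrt (real n / real u)"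
      using ln_le_powr[of "real n / real u" "1/2"] by (auto simp: powr_half_sqrt)
  qed
  also have "\<dots> \<le> 2 * (2 * real n)"
    unfolding sum_distrib_left[symmetric] by (rule mult_left_mono[OF sum_inverse_sqrt_ratio, THEN order.trans]) auto
  finally show ?thesis by simp
qed

section \<open>Mertens' estimates with bounded error\<close>

definition mertens :: "nat \<Rightarrow> real" where
  "mertens x = (\<Sum>p\<in>primes_in 0 x. ln (real p) / real p)"

lemma sum_lprimes: "(\<Sum>u\<in>{1..N}. lprimes z n u) = (\<Sum>p\<in>primes_in z n. ln (real p) * real (N div p))"
proof -
  have "(\<Sum>u\<in>{1..N}. lprimes z n u) = (\<Sum>p\<in>primes_in z n. ln (real p) * (\<Sum>u\<in>{1..N}. of_bool (p dvd u)))"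
    unfolding lprimes_def by (subst sum.swap) (simp only: sum_distrib_left)
  also have "\<dots> = (\<Sum>p\<in>primes_in z n. ln (real p) * real (N div p))"
    by (intro sum.cong refl) (subst sum_of_bool_dvd, auto dest: primes_in_pos)
  finally show ?thesis .
qed

text \<open>Rounding x / p down costs at most \<open>theta x\<close> in total, and the rounded sum
  is the sum of the prime parts of 1, ..., x, hence at most x ln x.\<close>

lemma mertens_upper: "1 \<le> x \<Longrightarrow> mertens x \<le> ln x + ln 4"
proof -
  assume x: "1 \<le> x"
  have "x * mertens x = (\<Sum>p\<in>primes_in 0 x. ln (real p) * (real x / real p))"
    unfolding mertens_def sum_distrib_left by (intro sum.cong) auto
  also have "\<dots> \<le> (\<Sum>p\<in>primes_in 0 x. ln (real p) * (real (x div p) + 1))"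
    by (intro sum_mono mult_left_mono) (use div_gt_real primes_in_pos in \<open>force simp: algebra_simps less_imp_le\<close>)+
  also have "\<dots> = (\<Sum>u\<in>{1..x}. lprimes 0 x u) + theta x"
    unfolding sum_lprimes theta_def by (simp add: sum.distrib algebra_simps)
  also have "\<dots> \<le> (\<Sum>u\<in>{1..x}. ln (real x)) + x * ln 4"
  proof (intro add_mono sum_mono theta_le)
    fix u assume u: "u \<in> {1..x}"
    then have "lprimes 0 x u \<le> ln (real u)" using ln_eq_lprimes_lpowers[OF u] lpowers_nonneg[of x u] by linarith
    also have "\<dots> \<le> ln (real x)" using u by (intro ln_mono) auto
    finally show "lprimes 0 x u \<le> ln (real x)" .
  qed
  also have "\<dots> = x * (ln x + ln 4)" by (simp add: algebra_simps)
  finally show ?thesis using x by simp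
qed

text \<open>Here rounding goes in the right direction. The prime parts of 1, ..., x fall short of x
  ln x only by the sum of ln (x / u), at most 4 x, and by the higher prime powers, at most
  \<open>C_pow\<close> times x.\<close>

lemma mertens_lower: "1 \<le> x \<Longrightarrow> ln x - (4 + C_pow) \<le> mertens x"
proof -
  assume x: "1 \<le> x"
  have "x * (ln x - (4 + C_pow)) = (\<Sum>u\<in>{1..x}. ln (real x)) - 4 * x - C_pow * x"
    by (simp add: algebra_simps)
  also have "\<dots> \<le> (\<Sum>u\<in>{1..x}. ln (real x)) - (\<Sum>u\<in>{1..x}. ln (real x / real u)) - (\<Sum>u\<in>{1..x}. lpowers x u)"
    using sum_ln_ratio_le[of x] sum_lpowers_le[of x x] by linarith
  also have "\<dots> = (\<Sum>u\<in>{1..x}. lprimes 0 x u)"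
    unfolding sum_subtractf[symmetric]
    by (intro sum.cong refl) (use x in \<open>auto simp: ln_div ln_eq_lprimes_lpowers\<close>)
  also have "\<dots> \<le> (\<Sum>p\<in>primes_in 0 x. ln (real p) * (real x / real p))"
    unfolding sum_lprimes by (intro sum_mono mult_left_mono div_le_real) auto
  also have "\<dots> = x * mertens x"
    unfolding mertens_def sum_distrib_left by (intro sum.cong) auto
  finally show ?thesis using x by simp
qed

definition C_mer :: real where "C_mer = 4 + C_pow + ln 4"

lemma C_mer_pos: "0 < C_mer" unfolding C_mer_def using C_pow_pos by (simp add: add_pos_pos)

lemma mertens_bound: "1 \<le> x \<Longrightarrow> \<bar>mertens x - ln x\<bar> \<le> C_mer"
  using mertens_upper[of x] mertens_lower[of x] C_pow_pos ln_ge_zero[of "4::real"] unfolding C_mer_def by linarith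

definition mertens2 :: "nat \<Rightarrow> real" where
  "mertens2 x = (\<Sum>p\<in>primes_in 0 x. (ln (real p))\<^sup>2 / real p)"

lemma primes_in_Suc:
  "primes_in 0 (Suc x) = (if prime (Suc x) then insert (Suc x) (primes_in 0 x) else primes_in 0 x)"
  by (auto simp: primes_in_def le_Suc_eq)

lemma Suc_notin_primes_in [simp]: "Suc x \<notin> primes_in z x"
  by (auto simp: primes_in_def)

text \<open>Abel summation in reverse: \<open>mertens x * ln x - mertens2 x\<close> is the integral
  of Mertens' sum against d ln, and replacing that sum by ln up to \<open>C_mer\<close> gives (ln
  x)^2 / 2. The extra 1 in the constant absorbs the quadratic terms
  \<open>\<delta>\<^sup>2 / 2 \<le> \<delta>\<close> of the steps.\<close>

lemma mertens2_aux:
  "1 \<le> x \<Longrightarrow> \<bar>mertens x * ln x - mertens2 x - (ln x)\<^sup>2 / 2\<bar> \<le> (C_mer + 1) * ln x"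
proof (induction x rule: nat_induct_at_least)
  case base
  have "primes_in 0 1 = {}" by (auto simp: primes_in_def le_Suc_eq prime_gt_0_nat)
  then show ?case by (simp add: mertens_def mertens2_def)
next
  case (Suc x)
  define \<delta> where "\<delta> = ln (real (Suc x)) - ln (real x)"
  have \<delta>: "0 \<le> \<delta>" using Suc.hyps by (simp add: \<delta>_def)
  have "\<delta> = ln (real (Suc x) / real x)" using Suc.hyps by (simp add: \<delta>_def ln_div)
  also have "\<dots> \<le> real (Suc x) / real x - 1" using Suc.hyps by (intro ln_le_minus_one) auto
  also have "\<dots> \<le> 1" using Suc.hyps by (simp add: field_simps)
  finally have \<delta>1: "\<delta> \<le> 1" .
  have l: "ln (real (Suc x)) = ln (real x) + \<delta>" by (simp add: \<delta>_def)
  \<comment> \<open>At a prime x + 1 the new term of \<open>mertens\<close>, multiplied by the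
    logarithm, cancels the new term of \<open>mertens2\<close>; only the growth of the logarithm is
    left.\<close>
  have rec: "mertens (Suc x) * ln (real (Suc x)) - mertens2 (Suc x) = mertens x * ln (real x) - mertens2 x + mertens x * \<delta>"
  proof -
    have "mertens (Suc x) * ln (real (Suc x)) - mertens2 (Suc x) = mertens x * ln (real (Suc x)) - mertens2 x"
    proof (cases "prime (Suc x)")
      case True
      then have "mertens (Suc x) = mertens x + ln (real (Suc x)) / real (Suc x)"
        "mertens2 (Suc x) = mertens2 x + ln (real (Suc x)) / real (Suc x) * ln (real (Suc x))"
        by (simp_all add: mertens_def mertens2_def primes_in_Suc power2_eq_square)
      then show ?thesis by (simp only: distrib_right)
    next
      case False
      then have "mertens (Suc x) = mertens x" "mertens2 (Suc x) = mertens2 x"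
        by (simp_all add: mertens_def mertens2_def primes_in_Suc)
      then show ?thesis by (simp only:)
    qed
    also have "\<dots> = mertens x * ln (real x) - mertens2 x + mertens x * \<delta>"
      unfolding l distrib_left by linarith
    finally show ?thesis .
  qed
  have sq: "(ln (real (Suc x)))\<^sup>2 / 2 = (ln (real x))\<^sup>2 / 2 + ln (real x) * \<delta> + \<delta>\<^sup>2 / 2"
    unfolding l by (simp add: power2_eq_square algebra_simps add_divide_distrib)
  have "\<bar>(mertens x - ln x) * \<delta>\<bar> \<le> C_mer * \<delta>"
    unfolding abs_mult using mertens_bound[of x] Suc.hyps \<delta> by (simp add: mult_right_mono)
  then have b1: "\<bar>mertens x * \<delta> - ln x * \<delta>\<bar> \<le> C_mer * \<delta>" by (simp add: left_diff_distrib)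
  have b2: "0 \<le> \<delta>\<^sup>2 / 2" "\<delta>\<^sup>2 / 2 \<le> \<delta>"
    using \<delta> \<delta>1 mult_left_mono[of \<delta> 1 \<delta>] by (auto simp: power2_eq_square)
  have "(C_mer + 1) * ln (real (Suc x)) = (C_mer + 1) * ln (real x) + C_mer * \<delta> + \<delta>"
    unfolding l by (simp add: algebra_simps)
  then show ?case using Suc.IH rec sq b1 b2 by linarith
qed

lemma mertens2_bound:
  assumes "1 \<le> x"
  shows "\<bar>mertens2 x - (ln x)\<^sup>2 / 2\<bar> \<le> (2 * C_mer + 1) * ln x"
proof -
  have "\<bar>(mertens x - ln x) * ln x\<bar> \<le> C_mer * ln x"
    unfolding abs_mult using mertens_bound[of x] assms by (simp add: mult_right_mono)
  then have "\<bar>mertens x * ln x - (ln x)\<^sup>2\<bar> \<le> C_mer * ln x" by (simp add: left_diff_distrib power2_eq_square)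
  with mertens2_aux[OF assms] show ?thesis by (simp add: algebra_simps)
qed

section \<open>Tails of sums over large primes\<close>

lemma sum_primes_as_nat:
  "0 < z \<Longrightarrow> (\<Sum>p\<in>primes_in z n. ln (real p) * h p) = (\<Sum>d\<in>{z<..n}. (if prime d then ln (real d) else 0) * (h d :: real))"
proof -
  have P: "primes_in z n = {d\<in>{z<..n}. prime d}" by (auto simp: primes_in_def)
  show ?thesis unfolding P by (subst sum.inter_filter) (simp, auto intro!: sum.cong)
qed

lemma theta_as_nat: "(\<Sum>d\<in>{1..x}. if prime d then ln (real d) else 0) \<le> ln 4 * real x powr 1"
proof -
  have P: "primes_in 0 x = {d\<in>{1..x}. prime d}" by (auto simp: primes_in_def)
  have "(\<Sum>d\<in>{1..x}. if prime d then ln (real d) else 0) = theta x"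
    unfolding P theta_def by (subst sum.inter_filter) auto
  then show ?thesis using theta_le[of x] by (simp add: mult.commute)
qed

lemma sum_primes_tail:
  assumes "1 \<le> z" "1 < \<beta>"
  shows "(\<Sum>p\<in>primes_in z n. ln (real p) * real p powr -\<beta>) \<le> ln 4 * \<beta> / (\<beta> - 1) * real z powr (1 - \<beta>)"
  by (subst sum_primes_as_nat; (rule partial_summation_tail[OF _ theta_as_nat])?) (use assms in auto)

lemma sum_ln_div_sq:
  assumes "1 \<le> z"
  shows "(\<Sum>p\<in>primes_in z n. ln (real p) / (real p)\<^sup>2) \<le> 2 * ln 4 / z"
proof -
  have "(\<Sum>p\<in>primes_in z n. ln (real p) / (real p)\<^sup>2) = (\<Sum>p\<in>primes_in z n. ln (real p) * real p powr -2)"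
    by (intro sum.cong) (auto simp: powr_minus_divide dest: primes_in_pos)
  also have "\<dots> \<le> ln 4 * 2 / (2 - 1) * real z powr (1 - 2)" by (rule sum_primes_tail) (use assms in auto)
  also have "\<dots> = 2 * ln 4 / z" using assms by (simp add: powr_minus_divide)
  finally show ?thesis .
qed

text \<open>One factor ln p is replaced by ln z + 2 sqrt (p / z), which leaves tails with the
  exponents 2 and 3/2; the second has the constant 2 * 3 ln 4 = 6 ln 4.\<close>

lemma sum_ln_sq_div_sq:
  assumes "1 \<le> z"
  shows "(\<Sum>p\<in>primes_in z n. (ln (real p))\<^sup>2 / (real p)\<^sup>2) \<le> 6 * ln 4 * (1 + ln z) / z"
proof -
  have "(\<Sum>p\<in>primes_in z n. (ln (real p))\<^sup>2 / (real p)\<^sup>2) \<le>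
     (\<Sum>p\<in>primes_in z n. ln z * (ln (real p) / (real p)\<^sup>2) + 2 * real z powr -(1/2) * (ln (real p) * real p powr -(3/2)))"
  proof (rule sum_mono)
    fix p assume "p \<in> primes_in z n"
    then have p: "0 < p" by (rule primes_in_pos)
    have "ln (real p / real z) \<le> 2 * (real p / real z) powr (1/2)"
      using p assms ln_le_powr[of "real p / real z" "1/2"] by simp
    then have "ln (real p) \<le> ln z + 2 * (real p powr (1/2) * real z powr -(1/2))"
      using p assms by (simp add: ln_div powr_divide powr_minus_divide)
    then have "ln (real p) * (ln (real p) / (real p)\<^sup>2) \<le> (ln z + 2 * (real p powr (1/2) * real z powr -(1/2))) * (ln (real p) / (real p)\<^sup>2)"
      by (intro mult_right_mono) auto
    moreover have "real p powr (1/2) / (real p)\<^sup>2 = real p powr -(3/2)"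
      using p powr_diff[of "real p" "1/2" 2] by simp
    moreover have "2 * (a * w) * (l / b) = 2 * w * (l * (a / b))" for a w l b :: real by simp
    ultimately have "ln (real p) * (ln (real p) / (real p)\<^sup>2) \<le> ln z * (ln (real p) / (real p)\<^sup>2) + 2 * real z powr -(1/2) * (ln (real p) * real p powr -(3/2))"
      by (simp only: distrib_right)
    then show "(ln (real p))\<^sup>2 / (real p)\<^sup>2 \<le> ln z * (ln (real p) / (real p)\<^sup>2) + 2 * real z powr -(1/2) * (ln (real p) * real p powr -(3/2))"
      by (simp add: power2_eq_square)
  qed
  also have "\<dots> \<le> ln z * (2 * ln 4 / z) + 2 * real z powr -(1/2) * (ln 4 * (3/2) / (3/2 - 1) * real z powr (1 - 3/2))"
    unfolding sum.distrib sum_distrib_left[symmetric]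
    by (intro add_mono mult_left_mono sum_ln_div_sq sum_primes_tail) (use assms in auto)
  also have "2 * real z powr -(1/2) * (ln 4 * (3/2) / (3/2 - 1) * real z powr (1 - 3/2)) = 6 * ln 4 / z"
  proof -
    have "real z powr -(1/2) * real z powr (1 - 3/2) = 1 / z"
      using assms by (simp add: powr_add[symmetric] powr_minus_divide)
    then show ?thesis by (simp add: field_simps)
  qed
  also have "ln z * (2 * ln 4 / z) + 6 * ln 4 / z \<le> 6 * ln 4 * (1 + ln z) / z"
    using assms by (simp add: field_simps)
  finally show ?thesis .
qed

section \<open>Covariances of divisibility events\<close>

text \<open>Divisibility by p ^ k is a threshold for the multiplicity of p, and the multiplicity in
  an lcm is the maximum. For general d the equivalence fails, as 6 divides the lcm of 2 and
  3.\<close>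

lemma primepow_dvd_lcm_nat:
  assumes "primepow (d::nat)" "a \<noteq> 0" "b \<noteq> 0"
  shows "d dvd lcm a b \<longleftrightarrow> d dvd a \<or> d dvd b"
proof -
  obtain p k where pk: "prime p" "0 < k" "d = p ^ k" using assms(1) by (auto simp: primepow_def)
  have *: "p ^ k dvd x \<longleftrightarrow> k \<le> multiplicity p x" if "x \<noteq> 0" for x
    using that pk(1) by (subst power_dvd_iff_le_multiplicity) (auto simp: not_prime_unit)
  have "lcm a b \<noteq> 0" using assms by (simp add: lcm_eq_0_iff)
  then show ?thesis using assms pk(1,3) by (simp add: * multiplicity_lcm prime_imp_prime_elem le_max_iff_disj)
qed

lemma primepow_dvd_Lcm_nat:
  assumes "primepow (d::nat)" "finite A" "0 \<notin> A"
  shows "d dvd Lcm A \<longleftrightarrow> (\<exists>a\<in>A. d dvd a)"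
  using assms(2,3)
proof (induction A)
  case (insert a A)
  then have "Lcm A \<noteq> 0" by (simp add: Lcm_0_iff_nat)
  with insert show ?case by (simp add: primepow_dvd_lcm_nat[OF assms(1)])
qed (use primepow_gt_Suc_0[OF assms(1)] in auto)

text \<open>Only prime powers contribute to the von Mangoldt sum over the divisors of the lcm, and
  each of those divides some element of A, in particular it is at most n.\<close>

lemma ln_Lcm:
  assumes "finite A" "A \<subseteq> {1..n}"
  shows "ln (real (Lcm A)) = (\<Sum>d\<in>{1..n}. mangoldt d * of_bool (\<exists>a\<in>A. d dvd a))"
proof -
  have A0: "0 \<notin> A" using assms by auto
  then have L0: "Lcm A \<noteq> 0" using assms by (simp add: Lcm_0_iff_nat)
  have "ln (real (Lcm A)) = (\<Sum>d | d dvd Lcm A. mangoldt d)"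
    using mangoldt_sum[of "Lcm A", where ?'a = real] L0 by auto
  also have "\<dots> = (\<Sum>d | d \<in> {1..n} \<and> (\<exists>a\<in>A. d dvd a). mangoldt d)"
  proof (rule sum.mono_neutral_right)
    show "finite {d. d dvd Lcm A}" using L0 by simp
    show "{d \<in> {1..n}. \<exists>a\<in>A. d dvd a} \<subseteq> {d. d dvd Lcm A}" by (auto intro: dvd_trans)
    show "\<forall>i\<in>{d. d dvd Lcm A} - {d \<in> {1..n}. \<exists>a\<in>A. d dvd a}. mangoldt i = (0::real)"
    proof
      fix d assume d: "d \<in> {d. d dvd Lcm A} - {d \<in> {1..n}. \<exists>a\<in>A. d dvd a}"
      show "mangoldt d = (0::real)"
      proof (rule ccontr)
        assume "mangoldt d \<noteq> (0::real)"
        then have pp: "primepow d" by (auto simp: mangoldt_def split: if_splits)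
        then obtain a where a: "a \<in> A" "d dvd a"
          using d primepow_dvd_Lcm_nat[OF pp assms(1) A0] by auto
        then have "d \<in> {1..n}" using assms(2) primepow_gt_0_nat[OF pp]
          by (auto dest!: dvd_imp_le[of d a] subsetD[of A "{1..n}" a])
        then show False using d a by auto
      qed
    qed
  qed
  also have "\<dots> = (\<Sum>d\<in>{1..n}. mangoldt d * of_bool (\<exists>a\<in>A. d dvd a) :: real)"
    by (subst sum.inter_filter, simp, intro sum.cong) auto
  finally show ?thesis .
qed

section \<open>Averages over [n], divisibility probabilities and second moments\<close>

definition avg :: "nat \<Rightarrow> (nat \<Rightarrow> real) \<Rightarrow> real" where
  "avg n \<phi> = (\<Sum>u\<in>{1..n}. \<phi> u) / real n"

lemma avg_add: "avg n (\<lambda>u. f u + g u) = avg n f + avg n g"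
  and avg_diff: "avg n (\<lambda>u. f u - g u) = avg n f - avg n g"
  and avg_cmult: "avg n (\<lambda>u. c * f u) = c * avg n f"
  and avg_sum: "avg n (\<lambda>u. \<Sum>i\<in>I. h i u) = (\<Sum>i\<in>I. avg n (h i))"
  by (simp_all add: avg_def sum.distrib sum_subtractf sum_distrib_left add_divide_distrib diff_divide_distrib
      sum.swap[of _ I] sum_divide_distrib)

lemma avg_const: "1 \<le> n \<Longrightarrow> avg n (\<lambda>u. c) = c"
  by (simp add: avg_def)

lemma avg_mono: "(\<And>u. u \<in> {1..n} \<Longrightarrow> f u \<le> g u) \<Longrightarrow> avg n f \<le> avg n g"
  unfolding avg_def by (intro divide_right_mono sum_mono) auto

lemma avg_nonneg: "(\<And>u. u \<in> {1..n} \<Longrightarrow> 0 \<le> f u) \<Longrightarrow> 0 \<le> avg n f"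
  unfolding avg_def by (intro divide_nonneg_nonneg sum_nonneg) auto

definition divprob :: "nat \<Rightarrow> nat \<Rightarrow> real" where
  "divprob n d = real (n div d) / real n"

lemma avg_of_bool_dvd: "0 < d \<Longrightarrow> avg n (\<lambda>u. of_bool (d dvd u)) = divprob n d"
  unfolding avg_def divprob_def by (simp only: sum_of_bool_dvd)

lemma divprob_nonneg: "0 \<le> divprob n d" by (simp add: divprob_def)

lemma divprob_le: "1 \<le> n \<Longrightarrow> divprob n d \<le> 1 / real d"
  using div_le_real[of n d] by (simp add: divprob_def field_simps)

lemma divprob_le_1: "1 \<le> n \<Longrightarrow> divprob n d \<le> 1"
  by (simp add: divprob_def field_simps)

lemma divprob_ge: "1 \<le> n \<Longrightarrow> 0 < d \<Longrightarrow> 1 / real d - 1 / real n \<le> divprob n d"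
proof -
  assume "1 \<le> n" "0 < d"
  then have "1 / real d - 1 / real n = (real n / real d - 1) / real n" by (simp add: diff_divide_distrib)
  then show ?thesis
    unfolding divprob_def using div_gt_real[OF \<open>0 < d\<close>, of n] by (simp only:) (intro divide_right_mono, auto)
qed

text \<open>Two estimates for two ranges. Rounding moves each probability by at most 1 / n, which
  gives an upper bound with a factor 1 / n, of use for small primes; p, q \<le> n keeps 1 / p - 1 /
  n and 1 / q - 1 / n nonnegative. For large primes rounding may swallow the whole joint
  probability, and only the two-sided bound 1 / (p q) is kept.\<close>

lemma divprob_cov:
  assumes "1 \<le> n" "0 < p" "p \<le> n" "0 < q" "q \<le> n"
  shows "divprob n (p * q) - divprob n p * divprob n q \<le> (1 / real p + 1 / real q) / real n"
    and "\<bar>divprob n (p * q) - divprob n p * divprob n q\<bar> \<le> 1 / (real p * real q)"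
proof -
  have p: "0 \<le> 1 / real p - 1 / real n" "0 \<le> 1 / real q - 1 / real n" using assms by (auto simp: field_simps)
  have "(1 / real p - 1 / real n) * (1 / real q - 1 / real n) \<le> divprob n p * divprob n q"
    using assms p by (intro mult_mono divprob_ge divprob_nonneg) auto
  moreover have "(1 / real p - 1 / real n) * (1 / real q - 1 / real n) = 1 / (real p * real q) - (1 / real p + 1 / real q) / real n + (1 / real n) * (1 / real n)"
    using assms by (simp add: field_simps)
  moreover have "0 \<le> (1 / real n) * (1 / real n)" by simp
  moreover have le: "divprob n (p * q) \<le> 1 / (real p * real q)" using divprob_le[of n "p * q"] assms by simp
  ultimately show "divprob n (p * q) - divprob n p * divprob n q \<le> (1 / real p + 1 / real q) / real n" by linarith
  have "divprob n p * divprob n q \<le> 1 / real p * (1 / real q)"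
    using assms by (intro mult_mono divprob_le divprob_nonneg) auto
  moreover have "0 \<le> divprob n p * divprob n q" "0 \<le> divprob n (p * q)" by (auto simp: divprob_nonneg)
  ultimately show "\<bar>divprob n (p * q) - divprob n p * divprob n q\<bar> \<le> 1 / (real p * real q)" using le by simp
qed

text \<open>First-order Taylor expansion of the k-th power around B. One more factor e turns the
  remainder R into e R + k (e - B)^2 B^(k-1), so the remainder grows by at most k (e - B)^2 per
  step.\<close>

lemma power_diff_second_order:
  fixes e B :: real
  assumes "\<bar>e\<bar> \<le> 1" "\<bar>B\<bar> \<le> 1"
  shows "\<bar>e ^ k - B ^ k - real k * (e - B) * B ^ (k - 1)\<bar> \<le> (real k)\<^sup>2 * (e - B)\<^sup>2"
proof (induction k)
  case (Suc k)
  define R where "R = e ^ k - B ^ k - real k * (e - B) * B ^ (k - 1)"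
  \<comment> \<open>For k = 0 the exponent k - 1 is truncated to 0, but then the coefficient k
    removes the term.\<close>
  have Bk: "B ^ k = B * B ^ (k - 1) \<or> k = 0" by (cases k) auto
  have eq: "e ^ Suc k - B ^ Suc k - real (Suc k) * (e - B) * B ^ (Suc k - 1) = e * R + real k * (e - B)\<^sup>2 * B ^ (k - 1)"
    using Bk by (auto simp: R_def algebra_simps power2_eq_square)
  have "\<bar>e * R\<bar> \<le> 1 * ((real k)\<^sup>2 * (e - B)\<^sup>2)"
    unfolding abs_mult using Suc.IH assms by (intro mult_mono) (auto simp: R_def)
  moreover have "\<bar>real k * (e - B)\<^sup>2 * B ^ (k - 1)\<bar> \<le> real k * (e - B)\<^sup>2 * 1"
    unfolding abs_mult using assms by (intro mult_mono) (auto simp: power_abs power_le_one)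
  ultimately have "\<bar>e * R + real k * (e - B)\<^sup>2 * B ^ (k - 1)\<bar> \<le> ((real k)\<^sup>2 + real k) * (e - B)\<^sup>2"
    by (simp add: algebra_simps)
  also have "\<dots> \<le> (real (Suc k))\<^sup>2 * (e - B)\<^sup>2"
  proof (rule mult_right_mono)
    show "(real k)\<^sup>2 + real k \<le> (real (Suc k))\<^sup>2" by (simp add: power2_eq_square algebra_simps)
  qed simp
  finally show ?case unfolding eq .
qed simp

text \<open>Jensen's inequality, read off from the nonnegative variance of |X|.\<close>

lemma (in prob_space) expectation_abs_le:
  fixes X :: "'a \<Rightarrow> real"
  assumes [measurable]: "random_variable borel X" and int: "integrable M (\<lambda>\<omega>. (X \<omega>)\<^sup>2)"
    and V: "expectation (\<lambda>\<omega>. (X \<omega>)\<^sup>2) \<le> V"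
  shows "expectation (\<lambda>\<omega>. \<bar>X \<omega>\<bar>) \<le> sqrt V"
proof -
  have iX: "integrable M X" by (rule square_integrable_imp_integrable[OF _ int]) simp
  have "variance (\<lambda>\<omega>. \<bar>X \<omega>\<bar>) = expectation (\<lambda>\<omega>. \<bar>X \<omega>\<bar>\<^sup>2) - (expectation (\<lambda>\<omega>. \<bar>X \<omega>\<bar>))\<^sup>2"
    by (rule variance_eq) (use iX int in auto)
  then have "(expectation (\<lambda>\<omega>. \<bar>X \<omega>\<bar>))\<^sup>2 \<le> V" using variance_positive[of "\<lambda>\<omega>. \<bar>X \<omega>\<bar>"] V by simp
  then show ?thesis by (rule real_le_rsqrt)
qed

text \<open>The nonnegative bound b is added on the diagonal as well, so that the double sum runs
  over all pairs and factors whenever b does.\<close>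

lemma (in prob_space) second_moment_weighted_sum:
  fixes R :: "'i \<Rightarrow> 'a \<Rightarrow> real"
  assumes P: "finite P" and int: "\<And>p q. p \<in> P \<Longrightarrow> q \<in> P \<Longrightarrow> integrable M (\<lambda>\<omega>. R p \<omega> * R q \<omega>)"
    and c: "\<And>p. p \<in> P \<Longrightarrow> 0 \<le> c p"
    and diag: "\<And>p. p \<in> P \<Longrightarrow> expectation (\<lambda>\<omega>. (R p \<omega>)\<^sup>2) \<le> v p"
    and off: "\<And>p q. p \<in> P \<Longrightarrow> q \<in> P \<Longrightarrow> p \<noteq> q \<Longrightarrow> expectation (\<lambda>\<omega>. R p \<omega> * R q \<omega>) \<le> b p q"
    and b: "\<And>p q. p \<in> P \<Longrightarrow> q \<in> P \<Longrightarrow> 0 \<le> b p q"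
  shows "expectation (\<lambda>\<omega>. (\<Sum>p\<in>P. c p * R p \<omega>)\<^sup>2) \<le> (\<Sum>p\<in>P. (c p)\<^sup>2 * v p) + (\<Sum>p\<in>P. \<Sum>q\<in>P. c p * c q * b p q)"
    and "integrable M (\<lambda>\<omega>. (\<Sum>p\<in>P. c p * R p \<omega>)\<^sup>2)"
proof -
  have eq: "(\<Sum>p\<in>P. c p * R p \<omega>)\<^sup>2 = (\<Sum>p\<in>P. \<Sum>q\<in>P. c p * c q * (R p \<omega> * R q \<omega>))" for \<omega>
    unfolding power2_eq_square sum_product by (simp add: ac_simps)
  show "integrable M (\<lambda>\<omega>. (\<Sum>p\<in>P. c p * R p \<omega>)\<^sup>2)" unfolding eq using int by auto
  have "expectation (\<lambda>\<omega>. (\<Sum>p\<in>P. c p * R p \<omega>)\<^sup>2) = (\<Sum>p\<in>P. \<Sum>q\<in>P. c p * c q * expectation (\<lambda>\<omega>. R p \<omega> * R q \<omega>))"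
    unfolding eq using int by (simp add: Bochner_Integration.integral_sum)
  also have "\<dots> \<le> (\<Sum>p\<in>P. \<Sum>q\<in>P. (if p = q then (c p)\<^sup>2 * v p else 0) + c p * c q * b p q)"
  proof (intro sum_mono)
    fix p q assume pq: "p \<in> P" "q \<in> P"
    show "c p * c q * expectation (\<lambda>\<omega>. R p \<omega> * R q \<omega>) \<le> (if p = q then (c p)\<^sup>2 * v p else 0) + c p * c q * b p q"
    proof (cases "p = q")
      case True
      have "c p * c p * expectation (\<lambda>\<omega>. R p \<omega> * R p \<omega>) \<le> c p * c p * v p"
        using diag[OF pq(1)] c[OF pq(1)] by (intro mult_left_mono) (auto simp: power2_eq_square)
      moreover have "0 \<le> c p * c p * b p p" using b[OF pq(1) pq(1)] by simp
      ultimately show ?thesis using True by (simp add: power2_eq_square)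
    next
      case False
      then show ?thesis using off[OF pq False] c[OF pq(1)] c[OF pq(2)] by (auto intro!: mult_left_mono)
    qed
  qed
  also have "\<dots> = (\<Sum>p\<in>P. (c p)\<^sup>2 * v p) + (\<Sum>p\<in>P. \<Sum>q\<in>P. c p * c q * b p q)"
    using P by (simp add: sum.distrib sum.delta')
  finally show "expectation (\<lambda>\<omega>. (\<Sum>p\<in>P. c p * R p \<omega>)\<^sup>2) \<le> (\<Sum>p\<in>P. (c p)\<^sup>2 * v p) + (\<Sum>p\<in>P. \<Sum>q\<in>P. c p * c q * b p q)" .
qed

lemma of_bool_dvd_mult:
  assumes "prime p" "prime q" "p \<noteq> (q::nat)"
  shows "of_bool (p dvd u) * of_bool (q dvd u) = (of_bool (p * q dvd u) :: real)"
  using divides_mult[of p u q] primes_coprime[OF assms] dvd_mult_left[of p q u] dvd_mult_right[of p q u]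
  by (auto simp: of_bool_def)

section \<open>One row of the array: moments of functions of an i.i.d. uniform sample\<close>

locale uniform_sample = prob_space M for M :: "'a measure" +
  fixes n :: nat and U :: "nat \<Rightarrow> 'a \<Rightarrow> nat"
  assumes n: "1 \<le> n"
    and indep: "indep_vars (\<lambda>_. count_space UNIV) U UNIV"
    and unif: "\<And>j. distr M (count_space UNIV) (U j) = measure_pmf (pmf_of_set {1..n})"
begin

lemma measurable_U [measurable]: "U j \<in> measurable M (count_space UNIV)"
  using indep by (auto simp: indep_vars_def)

lemma borel_U: "(\<lambda>\<omega>. \<phi> (U j \<omega>)) \<in> borel_measurable M"
  by (rule measurable_compose[OF measurable_U]) simp

lemma integrable_U: "integrable M (\<lambda>\<omega>. \<phi> (U j \<omega>) :: real)"
proof -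
  have "integrable (distr M (count_space UNIV) (U j)) \<phi>"
    unfolding unif using n by (intro integrable_measure_pmf_finite) auto
  then show ?thesis by (subst (asm) integrable_distr_eq) auto
qed

lemma expectation_U: "expectation (\<lambda>\<omega>. \<phi> (U j \<omega>)) = avg n \<phi>"
proof -
  have "expectation (\<lambda>\<omega>. \<phi> (U j \<omega>)) = integral\<^sup>L (distr M (count_space UNIV) (U j)) \<phi>"
    by (subst integral_distr) auto
  also have "\<dots> = avg n \<phi>"
    unfolding unif using n by (subst integral_pmf_of_set) (auto simp: avg_def)
  finally show ?thesis .
qed

lemma AE_U: "AE \<omega> in M. U j \<omega> \<in> {1..n}"
proof -
  have "AE u in distr M (count_space UNIV) (U j). u \<in> {1..n}"
    unfolding unif using n by (auto simp: AE_measure_pmf_iff)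
  then show ?thesis by (subst (asm) AE_distr_iff) auto
qed

lemma
  assumes "finite J"
  shows expectation_prod_U: "expectation (\<lambda>\<omega>. \<Prod>j\<in>J. \<phi> j (U j \<omega>)) = (\<Prod>j\<in>J. avg n (\<phi> j))"
    and integrable_prod_U: "integrable M (\<lambda>\<omega>. \<Prod>j\<in>J. \<phi> j (U j \<omega>))"
proof -
  have ind: "indep_vars (\<lambda>_. borel) (\<lambda>j \<omega>. \<phi> j (U j \<omega>)) J"
    by (rule indep_vars_compose2[OF indep_vars_subset[OF indep]]) auto
  show "integrable M (\<lambda>\<omega>. \<Prod>j\<in>J. \<phi> j (U j \<omega>))"
    by (rule indep_vars_integrable[OF assms ind integrable_U])
  show "expectation (\<lambda>\<omega>. \<Prod>j\<in>J. \<phi> j (U j \<omega>)) = (\<Prod>j\<in>J. avg n (\<phi> j))"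
    by (subst indep_vars_lebesgue_integral[OF assms ind integrable_U]) (simp add: expectation_U)
qed

lemma expectation_prod: "expectation (\<lambda>\<omega>. \<Prod>j\<in>{1..k}. \<xi> (U j \<omega>)) = avg n \<xi> ^ k"
  using expectation_prod_U[of "{1..k}" "\<lambda>_. \<xi>"] by simp

lemma
  assumes "finite J"
  shows expectation_sum_sum: "expectation (\<lambda>\<omega>. (\<Sum>i\<in>J. \<psi> (U i \<omega>)) * (\<Sum>j\<in>J. \<xi> (U j \<omega>))) =
      card J * avg n (\<lambda>u. \<psi> u * \<xi> u) + card J * (real (card J) - 1) * (avg n \<psi> * avg n \<xi>)" (is ?E)
    and integrable_sum_sum: "integrable M (\<lambda>\<omega>. (\<Sum>i\<in>J. \<psi> (U i \<omega>)) * (\<Sum>j\<in>J. \<xi> (U j \<omega>)))" (is ?I)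
proof -
  \<comment> \<open>A product over the set {i, j} lets a single independence formula cover both i
    \<noteq> j and i = j, where the set has one element.\<close>
  have eq: "\<psi> (U i \<omega>) * \<xi> (U j \<omega>) = (\<Prod>l\<in>{i,j}. (if l = i then if i = j then \<lambda>u. \<psi> u * \<xi> u else \<psi> else \<xi>) (U l \<omega>))" for i j \<omega>
    by (cases "i = j") auto
  have int: "integrable M (\<lambda>\<omega>. \<psi> (U i \<omega>) * \<xi> (U j \<omega>))" for i j
    unfolding eq by (rule integrable_prod_U) auto
  have E: "expectation (\<lambda>\<omega>. \<psi> (U i \<omega>) * \<xi> (U j \<omega>)) = avg n \<psi> * avg n \<xi> + (if i = j then avg n (\<lambda>u. \<psi> u * \<xi> u) - avg n \<psi> * avg n \<xi> else 0)" for i j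
    unfolding eq by (subst expectation_prod_U) auto
  show ?I unfolding sum_product using int by auto
  have "expectation (\<lambda>\<omega>. (\<Sum>i\<in>J. \<psi> (U i \<omega>)) * (\<Sum>j\<in>J. \<xi> (U j \<omega>))) =
    (\<Sum>i\<in>J. \<Sum>j\<in>J. expectation (\<lambda>\<omega>. \<psi> (U i \<omega>) * \<xi> (U j \<omega>)))"
    unfolding sum_product using int by (simp add: Bochner_Integration.integral_sum)
  also have "\<dots> = (\<Sum>i\<in>J. card J * (avg n \<psi> * avg n \<xi>) + (avg n (\<lambda>u. \<psi> u * \<xi> u) - avg n \<psi> * avg n \<xi>))"
    unfolding E using assms by (intro sum.cong refl) (simp add: sum.distrib)
  also have "\<dots> = card J * avg n (\<lambda>u. \<psi> u * \<xi> u) + card J * (real (card J) - 1) * (avg n \<psi> * avg n \<xi>)"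
    by (simp add: algebra_simps)
  finally show ?E .
qed

lemma expectation_sum_prod:
  "expectation (\<lambda>\<omega>. (\<Sum>i\<in>{1..k}. \<psi> (U i \<omega>)) * (\<Prod>j\<in>{1..k}. \<xi> (U j \<omega>))) =
      k * avg n (\<lambda>u. \<psi> u * \<xi> u) * avg n \<xi> ^ (k - 1)"
proof -
  have eq: "\<psi> (U i \<omega>) * (\<Prod>j\<in>{1..k}. \<xi> (U j \<omega>)) = (\<Prod>j\<in>{1..k}. (if j = i then \<lambda>u. \<psi> u * \<xi> u else \<xi>) (U j \<omega>))"
    if "i \<in> {1..k}" for i \<omega>
    using that by (subst (1 2) prod.remove[of _ i]) (auto intro!: prod.cong)
  have int: "integrable M (\<lambda>\<omega>. \<psi> (U i \<omega>) * (\<Prod>j\<in>{1..k}. \<xi> (U j \<omega>)))" if "i \<in> {1..k}" for i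
    unfolding eq[OF that] by (rule integrable_prod_U) auto
  have E: "expectation (\<lambda>\<omega>. \<psi> (U i \<omega>) * (\<Prod>j\<in>{1..k}. \<xi> (U j \<omega>))) = avg n (\<lambda>u. \<psi> u * \<xi> u) * avg n \<xi> ^ (k - 1)"
    if "i \<in> {1..k}" for i
  proof -
    have "(\<Prod>j\<in>{1..k}. avg n (if j = i then \<lambda>u. \<psi> u * \<xi> u else \<xi>)) = avg n (\<lambda>u. \<psi> u * \<xi> u) * (\<Prod>j\<in>{1..k} - {i}. avg n \<xi>)"
      using that by (subst prod.remove[of _ i]) (auto intro!: prod.cong)
    then show ?thesis unfolding eq[OF that] using that by (subst expectation_prod_U) auto
  qed
  have "expectation (\<lambda>\<omega>. (\<Sum>i\<in>{1..k}. \<psi> (U i \<omega>)) * (\<Prod>j\<in>{1..k}. \<xi> (U j \<omega>))) =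
    (\<Sum>i\<in>{1..k}. expectation (\<lambda>\<omega>. \<psi> (U i \<omega>) * (\<Prod>j\<in>{1..k}. \<xi> (U j \<omega>))))"
    unfolding sum_distrib_right using int by (intro Bochner_Integration.integral_sum) auto
  also have "\<dots> = (\<Sum>i\<in>{1..k}. avg n (\<lambda>u. \<psi> u * \<xi> u) * avg n \<xi> ^ (k - 1))"
    by (intro sum.cong refl E)
  finally show ?thesis by simp
qed

text \<open>The indicator that none of the k samples is divisible by d, written as a product so that
  its mean factors over the independent samples. \<open>hits\<close> below is the count N_d of the
  overview.\<close>

definition miss :: "nat \<Rightarrow> nat \<Rightarrow> 'a \<Rightarrow> real" where
  "miss k d \<omega> = (\<Prod>j\<in>{1..k}. 1 - of_bool (d dvd U j \<omega>))"

definition hits :: "nat \<Rightarrow> nat \<Rightarrow> 'a \<Rightarrow> real" where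
  "hits k d \<omega> = (\<Sum>j\<in>{1..k}. of_bool (d dvd U j \<omega>))"

definition cmiss :: "nat \<Rightarrow> nat \<Rightarrow> 'a \<Rightarrow> real" where
  "cmiss k d \<omega> = miss k d \<omega> - (1 - divprob n d) ^ k"

definition chits :: "nat \<Rightarrow> nat \<Rightarrow> 'a \<Rightarrow> real" where
  "chits k d \<omega> = hits k d \<omega> - k * divprob n d"

text \<open>As \<open>miss\<close> indicates \<open>hits = 0\<close>, this is \<open>max 0 (hits - 1)\<close> minus its mean.\<close>

abbreviation excess :: "nat \<Rightarrow> nat \<Rightarrow> 'a \<Rightarrow> real" where
  "excess k d \<omega> \<equiv> chits k d \<omega> + cmiss k d \<omega>"

lemma borel_measurable_miss [measurable]: "miss k d \<in> borel_measurable M"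
  unfolding miss_def using borel_U[of "\<lambda>u. 1 - of_bool (d dvd u)"] by (intro borel_measurable_prod) auto

lemma borel_measurable_hits [measurable]: "hits k d \<in> borel_measurable M"
  unfolding hits_def using borel_U[of "\<lambda>u. of_bool (d dvd u)"] by (intro borel_measurable_sum) auto

lemma borel_measurable_cmiss [measurable]: "cmiss k d \<in> borel_measurable M"
  unfolding cmiss_def by measurable

lemma borel_measurable_chits [measurable]: "chits k d \<in> borel_measurable M"
  unfolding chits_def by measurable

lemma miss_eq: "miss k d \<omega> = of_bool (\<forall>j\<in>{1..k}. \<not> d dvd U j \<omega>)"
proof (cases "\<forall>j\<in>{1..k}. \<not> d dvd U j \<omega>")
  case False
  then have "\<exists>j\<in>{1..k}. 1 - of_bool (d dvd U j \<omega>) = (0::real)" by auto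
  then have "miss k d \<omega> = 0" unfolding miss_def by (intro prod_zero) auto
  then show ?thesis using False by auto
qed (simp add: miss_def)

lemma hits_bounds: "0 \<le> hits k d \<omega>" "hits k d \<omega> \<le> k"
proof -
  show "0 \<le> hits k d \<omega>" unfolding hits_def by (intro sum_nonneg) auto
  have "hits k d \<omega> \<le> (\<Sum>j\<in>{1..k}. 1)" unfolding hits_def by (intro sum_mono) auto
  then show "hits k d \<omega> \<le> k" by simp
qed

lemma miss_bounds: "0 \<le> miss k d \<omega>" "miss k d \<omega> \<le> 1"
  by (auto simp: miss_eq)

lemma divprob_power_bounds: "0 \<le> (1 - divprob n d) ^ k" "(1 - divprob n d) ^ k \<le> 1"
  using divprob_le_1[OF n, of d] divprob_nonneg[of n d] by (auto intro: power_le_one)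

lemma abs_cmiss_le: "\<bar>cmiss k d \<omega>\<bar> \<le> 1"
  using miss_bounds[of k d \<omega>] divprob_power_bounds[of d k] by (auto simp: cmiss_def abs_le_iff)

lemma abs_chits_le: "\<bar>chits k d \<omega>\<bar> \<le> k"
proof -
  have "0 \<le> k * divprob n d" "k * divprob n d \<le> k"
    using divprob_le_1[OF n, of d] divprob_nonneg[of n d] by (auto intro: mult_left_le)
  then show ?thesis using hits_bounds[of k d \<omega>] by (auto simp: chits_def abs_le_iff)
qed

lemma integrable_mult_bounded:
  assumes [measurable]: "X \<in> borel_measurable M" "Y \<in> borel_measurable M"
    and "\<And>\<omega>. \<bar>X \<omega>\<bar> \<le> a" "\<And>\<omega>. \<bar>Y \<omega>\<bar> \<le> (b::real)"
  shows "integrable M (\<lambda>\<omega>. X \<omega> * Y \<omega>)"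
proof (rule integrable_const_bound[where B = "a * b"])
  have "0 \<le> a" using assms(3) by (rule order_trans[OF abs_ge_zero])
  then show "AE \<omega> in M. norm (X \<omega> * Y \<omega>) \<le> a * b"
    using assms(3,4) by (intro AE_I2) (auto simp: abs_mult intro!: mult_mono)
qed simp

lemma integrable_cc:
  "integrable M (\<lambda>\<omega>. cmiss k p \<omega> * cmiss k q \<omega>)" "integrable M (\<lambda>\<omega>. chits k p \<omega> * cmiss k q \<omega>)"
  "integrable M (\<lambda>\<omega>. cmiss k p \<omega> * chits k q \<omega>)" "integrable M (\<lambda>\<omega>. chits k p \<omega> * chits k q \<omega>)"
  by (rule integrable_mult_bounded[OF _ _ abs_cmiss_le abs_cmiss_le]
        integrable_mult_bounded[OF _ _ abs_chits_le abs_cmiss_le]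
        integrable_mult_bounded[OF _ _ abs_cmiss_le abs_chits_le]
        integrable_mult_bounded[OF _ _ abs_chits_le abs_chits_le]; simp)+

lemma integrable_miss: "integrable M (miss k d)"
  by (rule integrable_const_bound[where B = 1]) (auto simp: miss_bounds)

lemma integrable_hits: "integrable M (hits k d)"
  by (rule integrable_const_bound[where B = k]) (auto simp: hits_bounds)

lemma avg_miss: "0 < d \<Longrightarrow> avg n (\<lambda>u. 1 - of_bool (d dvd u)) = 1 - divprob n d"
  unfolding avg_diff avg_of_bool_dvd by (simp add: avg_const[OF n])

lemma expectation_miss:
  assumes "0 < d"
  shows "expectation (miss k d) = (1 - divprob n d) ^ k"
  using expectation_prod[of "\<lambda>u. 1 - of_bool (d dvd u)" k] unfolding miss_def avg_miss[OF assms] .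

lemma expectation_hits: "0 < d \<Longrightarrow> expectation (hits k d) = k * divprob n d"
  unfolding hits_def
  by (subst Bochner_Integration.integral_sum) (auto simp: integrable_U[of "\<lambda>u. of_bool (d dvd u)"]
      expectation_U[of "\<lambda>u. of_bool (d dvd u)"] avg_of_bool_dvd)

lemma expectation_chits: "0 < d \<Longrightarrow> expectation (chits k d) = 0"
  unfolding chits_def using integrable_hits[of k d] by (simp add: expectation_hits prob_space)

context
  fixes p q k :: nat
  assumes pq: "prime p" "prime q" "p \<noteq> q" "p \<le> n" "q \<le> n"
begin

text \<open>Covariance of the events p | u and q | u for one uniform u; for distinct primes their
  intersection is the event p q | u.\<close>

abbreviation (input) "\<delta> \<equiv> divprob n (p * q) - divprob n p * divprob n q"

lemma avg_miss_miss:
  "avg n (\<lambda>u. (1 - of_bool (p dvd u)) * (1 - of_bool (q dvd u))) = (1 - divprob n p) * (1 - divprob n q) + \<delta>"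
proof -
  have pos: "0 < p" "0 < q" "0 < p * q" using pq by (auto simp: prime_gt_0_nat)
  have "avg n (\<lambda>u. (1 - of_bool (p dvd u)) * (1 - of_bool (q dvd u))) =
        avg n (\<lambda>u. 1 - of_bool (p dvd u) - of_bool (q dvd u) + of_bool (p * q dvd u))"
    unfolding of_bool_dvd_mult[OF pq(1-3), symmetric] by (simp only: algebra_simps mult_1_left mult_1_right)
  also have "\<dots> = 1 - divprob n p - divprob n q + divprob n (p * q)"
    unfolding avg_add avg_diff avg_of_bool_dvd[OF pos(1)] avg_of_bool_dvd[OF pos(2)] avg_of_bool_dvd[OF pos(3)]
    by (simp add: avg_const[OF n])
  also have "\<dots> = (1 - divprob n p) * (1 - divprob n q) + \<delta>" by (simp add: algebra_simps)
  finally show ?thesis .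
qed

lemma joint_miss_bounds:
  "0 \<le> (1 - divprob n p) * (1 - divprob n q) + \<delta>" "(1 - divprob n p) * (1 - divprob n q) + \<delta> \<le> 1"
proof -
  show "0 \<le> (1 - divprob n p) * (1 - divprob n q) + \<delta>"
    unfolding avg_miss_miss[symmetric] by (intro avg_nonneg) auto
  have "avg n (\<lambda>u. (1 - of_bool (p dvd u)) * (1 - of_bool (q dvd u))) \<le> avg n (\<lambda>u. 1)" by (intro avg_mono) auto
  then show "(1 - divprob n p) * (1 - divprob n q) + \<delta> \<le> 1"
    unfolding avg_miss_miss[symmetric] by (simp add: avg_const[OF n])
qed

lemma expectation_cmiss_cmiss:
  "expectation (\<lambda>\<omega>. cmiss k p \<omega> * cmiss k q \<omega>) =
     ((1 - divprob n p) * (1 - divprob n q) + \<delta>) ^ k - ((1 - divprob n p) * (1 - divprob n q)) ^ k"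
proof -
  have pos: "0 < p" "0 < q" "0 < p * q" using pq by (auto simp: prime_gt_0_nat)
  have E: "expectation (\<lambda>\<omega>. miss k p \<omega> * miss k q \<omega>) = ((1 - divprob n p) * (1 - divprob n q) + \<delta>) ^ k"
    using expectation_prod[of "\<lambda>u. (1 - of_bool (p dvd u)) * (1 - of_bool (q dvd u))" k]
    unfolding miss_def prod.distrib[symmetric] avg_miss_miss .
  have I: "integrable M (\<lambda>\<omega>. miss k p \<omega> * miss k q \<omega>)"
    by (rule integrable_mult_bounded[where a = 1 and b = 1]) (auto simp: miss_bounds)
  have "expectation (\<lambda>\<omega>. cmiss k p \<omega> * cmiss k q \<omega>) =
    expectation (\<lambda>\<omega>. miss k p \<omega> * miss k q \<omega> - (1 - divprob n q) ^ k * miss k p \<omega> - (1 - divprob n p) ^ k * miss k q \<omega>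
      + (1 - divprob n p) ^ k * (1 - divprob n q) ^ k)"
    by (intro Bochner_Integration.integral_cong) (auto simp: cmiss_def algebra_simps)
  also have "\<dots> = expectation (\<lambda>\<omega>. miss k p \<omega> * miss k q \<omega>) - (1 - divprob n p) ^ k * (1 - divprob n q) ^ k"
    using I integrable_miss[of k p] integrable_miss[of k q]
    by (simp add: expectation_miss pos prob_space)
  finally show ?thesis unfolding E by (simp add: power_mult_distrib)
qed

lemma expectation_chits_chits: "expectation (\<lambda>\<omega>. chits k p \<omega> * chits k q \<omega>) = k * \<delta>"
proof -
  have pos: "0 < p" "0 < q" "0 < p * q" using pq by (auto simp: prime_gt_0_nat)
  have c: "chits k d \<omega> = (\<Sum>j\<in>{1..k}. of_bool (d dvd U j \<omega>) - divprob n d)" for d \<omega>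
    unfolding chits_def hits_def by (simp only: sum_subtractf) simp
  have z: "avg n (\<lambda>u. of_bool (d dvd u) - divprob n d) = 0" if "0 < d" for d
    unfolding avg_diff avg_of_bool_dvd[OF that] by (simp add: avg_const[OF n])
  have "avg n (\<lambda>u. (of_bool (p dvd u) - divprob n p) * (of_bool (q dvd u) - divprob n q)) =
    avg n (\<lambda>u. of_bool (p * q dvd u) - divprob n q * of_bool (p dvd u) - divprob n p * of_bool (q dvd u) + divprob n p * divprob n q)"
    unfolding of_bool_dvd_mult[OF pq(1-3), symmetric] by (simp only: algebra_simps mult_1_left mult_1_right)
  also have "\<dots> = \<delta>"
    unfolding avg_add avg_diff avg_cmult avg_of_bool_dvd[OF pos(1)] avg_of_bool_dvd[OF pos(2)] avg_of_bool_dvd[OF pos(3)]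
    by (simp add: avg_const[OF n])
  finally have a: "avg n (\<lambda>u. (of_bool (p dvd u) - divprob n p) * (of_bool (q dvd u) - divprob n q)) = \<delta>" .
  show ?thesis
    unfolding c using expectation_sum_sum[of "{1..k}" "\<lambda>u. of_bool (p dvd u) - divprob n p" "\<lambda>u. of_bool (q dvd u) - divprob n q"]
    unfolding a z[OF pos(1)] by simp
qed

text \<open>Only the sample in the chosen summand of \<open>chits\<close> feels the correlation,
  with mean -\<delta>; each of the other k - 1 samples contributes its probability of not being
  divisible by q.\<close>

lemma expectation_chits_cmiss:
  "expectation (\<lambda>\<omega>. chits k p \<omega> * cmiss k q \<omega>) = - (k * \<delta> * (1 - divprob n q) ^ (k - 1))"
proof -
  have pos: "0 < p" "0 < q" "0 < p * q" using pq by (auto simp: prime_gt_0_nat)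
  have c: "chits k p \<omega> = (\<Sum>j\<in>{1..k}. of_bool (p dvd U j \<omega>) - divprob n p)" for \<omega>
    unfolding chits_def hits_def by (simp only: sum_subtractf) simp
  have "avg n (\<lambda>u. (of_bool (p dvd u) - divprob n p) * (1 - of_bool (q dvd u))) =
    avg n (\<lambda>u. of_bool (p dvd u) - of_bool (p * q dvd u) + divprob n p * of_bool (q dvd u) - divprob n p)"
    unfolding of_bool_dvd_mult[OF pq(1-3), symmetric] by (simp only: algebra_simps mult_1_left mult_1_right)
  also have "\<dots> = - \<delta>"
    unfolding avg_add avg_diff avg_cmult avg_of_bool_dvd[OF pos(1)] avg_of_bool_dvd[OF pos(2)] avg_of_bool_dvd[OF pos(3)]
    by (simp add: avg_const[OF n])
  finally have a: "avg n (\<lambda>u. (of_bool (p dvd u) - divprob n p) * (1 - of_bool (q dvd u))) = - \<delta>" .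
  have E: "expectation (\<lambda>\<omega>. chits k p \<omega> * miss k q \<omega>) = k * - \<delta> * (1 - divprob n q) ^ (k - 1)"
    using expectation_sum_prod[of "\<lambda>u. of_bool (p dvd u) - divprob n p" k "\<lambda>u. 1 - of_bool (q dvd u)"]
    unfolding a avg_miss[OF pos(2)] c miss_def .
  have I: "integrable M (\<lambda>\<omega>. chits k p \<omega> * miss k q \<omega>)"
    by (rule integrable_mult_bounded[OF _ _ abs_chits_le, where b = 1]) (auto simp: miss_bounds)
  have I2: "integrable M (chits k p)" unfolding chits_def using integrable_hits[of k p] by simp
  have "expectation (\<lambda>\<omega>. chits k p \<omega> * cmiss k q \<omega>) =
    expectation (\<lambda>\<omega>. chits k p \<omega> * miss k q \<omega> - (1 - divprob n q) ^ k * chits k p \<omega>)"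
    by (intro Bochner_Integration.integral_cong) (auto simp: cmiss_def algebra_simps)
  also have "\<dots> = expectation (\<lambda>\<omega>. chits k p \<omega> * miss k q \<omega>)"
    using I I2 by (simp add: expectation_chits pos)
  finally show ?thesis unfolding E by (simp only: mult_minus_left mult_minus_right)
qed

end

section \<open>Covariance bounds for misses and excesses\<close>

lemma one_minus_power_le: "0 \<le> x \<Longrightarrow> x \<le> 1 \<Longrightarrow> 1 - (1 - x) ^ j \<le> real j * x" for x :: real
  using Bernoulli_inequality[of "- x" j] by simp

text \<open>A negative \<delta> makes the covariance nonpositive, so only \<delta> \<ge> 0 matters.
  Then the k-th powers of two numbers in [0, 1] differ by at most k \<delta>, and \<delta> is
  bounded by the rounding error of the floor functions.\<close>

lemma covariance_miss_le:
  assumes "prime p" "prime q" "p \<noteq> q" "p \<le> n" "q \<le> n"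
  shows "expectation (\<lambda>\<omega>. cmiss k p \<omega> * cmiss k q \<omega>) \<le> k * ((1 / real p + 1 / real q) / real n)"
proof -
  have pos: "0 < p" "0 < q" using assms by (auto simp: prime_gt_0_nat)
  define B where "B = (1 - divprob n p) * (1 - divprob n q)"
  define \<delta> where "\<delta> = divprob n (p * q) - divprob n p * divprob n q"
  have eq: "expectation (\<lambda>\<omega>. cmiss k p \<omega> * cmiss k q \<omega>) = (B + \<delta>) ^ k - B ^ k"
    unfolding B_def \<delta>_def using assms by (rule expectation_cmiss_cmiss)
  have B: "0 \<le> B" "B \<le> 1" unfolding B_def using divprob_nonneg divprob_le_1[OF n]
    by (auto intro!: mult_nonneg_nonneg mult_le_one)
  have e: "0 \<le> B + \<delta>" "B + \<delta> \<le> 1"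
    unfolding B_def \<delta>_def using joint_miss_bounds[OF assms] by auto
  show ?thesis
  proof (cases "0 \<le> \<delta>")
    case True
    have "(B + \<delta>) ^ k - B ^ k \<le> norm ((B + \<delta>) ^ k - B ^ k)" by simp
    also have "\<dots> \<le> k * norm (B + \<delta> - B)" using e B by (intro norm_power_diff) auto
    also have "\<dots> \<le> k * ((1 / real p + 1 / real q) / real n)"
      using True divprob_cov(1)[OF n pos(1) assms(4) pos(2) assms(5)] by (intro mult_left_mono) (auto simp: \<delta>_def)
    finally show ?thesis unfolding eq .
  next
    case False
    then have "(B + \<delta>) ^ k \<le> B ^ k" using e by (intro power_mono) auto
    moreover have "0 \<le> k * ((1 / real p + 1 / real q) / real n)" by simp
    ultimately show ?thesis unfolding eq by linarith
  qed
qed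

text \<open>The parts of first order in \<delta> combine to k \<delta> (1 - (1 - x)^(k-1)) (1 - (1 -
  y)^(k-1)), where by Bernoulli's inequality the last two factors are at most k / p and k / q. What
  is left is a Taylor remainder of at most k^2 \<delta>^2, and |\<delta>| \<le> 1 / (p q) finishes
  both parts.\<close>

lemma covariance_excess_le:
  assumes "prime p" "prime q" "p \<noteq> q" "p \<le> n" "q \<le> n"
  shows "expectation (\<lambda>\<omega>. excess k p \<omega> * excess k q \<omega>)
      \<le> (real k ^ 3 + real k ^ 2) * (1 / (real p)\<^sup>2 * (1 / (real q)\<^sup>2))"
proof -
  have pos: "0 < p" "0 < q" using assms by (auto simp: prime_gt_0_nat)
  define x where "x = divprob n p"
  define y where "y = divprob n q"
  define B where "B = (1 - x) * (1 - y)"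
  define \<delta> where "\<delta> = divprob n (p * q) - x * y"
  have xy: "0 \<le> x" "x \<le> 1" "0 \<le> y" "y \<le> 1" "x \<le> 1 / real p" "y \<le> 1 / real q"
    unfolding x_def y_def using divprob_nonneg divprob_le_1[OF n] divprob_le[OF n] by auto
  have B: "0 \<le> B" "B \<le> 1" unfolding B_def using xy by (auto intro!: mult_nonneg_nonneg mult_le_one)
  have e: "0 \<le> B + \<delta>" "B + \<delta> \<le> 1"
    unfolding B_def \<delta>_def x_def y_def using joint_miss_bounds[OF assms] by auto
  have \<delta>: "\<bar>\<delta>\<bar> \<le> 1 / (real p * real q)"
    unfolding \<delta>_def x_def y_def using divprob_cov(2)[OF n pos(1) assms(4) pos(2) assms(5)] .
  define X where "X = 1 - (1 - x) ^ (k - 1)"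
  define Y where "Y = 1 - (1 - y) ^ (k - 1)"
  have "X \<le> real (k - 1) * x" "Y \<le> real (k - 1) * y"
    unfolding X_def Y_def using xy by (auto intro!: one_minus_power_le)
  moreover have "real (k - 1) * x \<le> real k * (1 / real p)" "real (k - 1) * y \<le> real k * (1 / real q)"
    using xy by (intro mult_mono; simp)+
  ultimately have XY: "X \<le> real k * (1 / real p)" "Y \<le> real k * (1 / real q)" by linarith+
  have XY0: "0 \<le> X" "0 \<le> Y" unfolding X_def Y_def using xy by (auto intro: power_le_one)
  have "expectation (\<lambda>\<omega>. excess k p \<omega> * excess k q \<omega>) =
    expectation (\<lambda>\<omega>. chits k p \<omega> * chits k q \<omega> + chits k p \<omega> * cmiss k q \<omega> + chits k q \<omega> * cmiss k p \<omega> + cmiss k p \<omega> * cmiss k q \<omega>)"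
    by (intro Bochner_Integration.integral_cong) (auto simp: algebra_simps)
  also have "\<dots> = expectation (\<lambda>\<omega>. chits k p \<omega> * chits k q \<omega>) + expectation (\<lambda>\<omega>. chits k p \<omega> * cmiss k q \<omega>)
      + expectation (\<lambda>\<omega>. chits k q \<omega> * cmiss k p \<omega>) + expectation (\<lambda>\<omega>. cmiss k p \<omega> * cmiss k q \<omega>)"
    using integrable_cc by simp
  also have "\<dots> = k * \<delta> - k * \<delta> * (1 - y) ^ (k - 1) - k * \<delta> * (1 - x) ^ (k - 1) + ((B + \<delta>) ^ k - B ^ k)"
    unfolding expectation_chits_chits[OF assms] expectation_chits_cmiss[OF assms] expectation_cmiss_cmiss[OF assms]
      expectation_chits_cmiss[OF assms(2,1) assms(3)[symmetric] assms(5,4)]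
    by (simp add: B_def \<delta>_def x_def y_def mult.commute[of q p] mult.commute[of "divprob n q" "divprob n p"])
  also have "\<dots> = k * \<delta> * (X * Y) + ((B + \<delta>) ^ k - B ^ k - k * (B + \<delta> - B) * B ^ (k - 1))"
  proof -
    have Bk: "B ^ (k - 1) = (1 - x) ^ (k - 1) * (1 - y) ^ (k - 1)" by (simp add: B_def power_mult_distrib)
    show ?thesis unfolding Bk X_def Y_def by (simp add: algebra_simps)
  qed
  also have "\<dots> \<le> k * (1 / (real p * real q)) * ((real k * (1 / real p)) * (real k * (1 / real q))) + (real k)\<^sup>2 * (1 / (real p * real q))\<^sup>2"
  proof (rule add_mono)
    have "k * \<delta> * (X * Y) \<le> k * \<bar>\<delta>\<bar> * (X * Y)" using XY0 by (intro mult_right_mono mult_left_mono) auto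
    also have "\<dots> \<le> k * (1 / (real p * real q)) * ((real k * (1 / real p)) * (real k * (1 / real q)))"
      using XY XY0 \<delta> by (intro mult_mono) auto
    finally show "k * \<delta> * (X * Y) \<le> k * (1 / (real p * real q)) * ((real k * (1 / real p)) * (real k * (1 / real q)))" .
    have "(B + \<delta>) ^ k - B ^ k - k * (B + \<delta> - B) * B ^ (k - 1) \<le> (real k)\<^sup>2 * (B + \<delta> - B)\<^sup>2"
      using power_diff_second_order[of "B + \<delta>" B k] e B by (simp add: abs_le_iff)
    also have "\<dots> = (real k)\<^sup>2 * \<bar>\<delta>\<bar>\<^sup>2" by simp
    also have "\<dots> \<le> (real k)\<^sup>2 * (1 / (real p * real q))\<^sup>2"
      using \<delta> by (intro mult_left_mono power_mono) auto
    finally show "(B + \<delta>) ^ k - B ^ k - k * (B + \<delta> - B) * B ^ (k - 1) \<le> (real k)\<^sup>2 * (1 / (real p * real q))\<^sup>2" .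
  qed
  also have "\<dots> = (real k ^ 3 + real k ^ 2) * (1 / (real p)\<^sup>2 * (1 / (real q)\<^sup>2))"
    using pos by (simp add: field_simps power2_eq_square power3_eq_cube)
  finally show ?thesis .
qed

text \<open>The excess is h = max 0 (N - 1) minus its mean, and the square of h is at most N (N -
  1). The mean of N (N - 1) is k (k - 1) times the squared divisibility probability, with no term
  linear in k / p.\<close>

lemma second_moment_excess_le:
  assumes "prime p"
  shows "expectation (\<lambda>\<omega>. (excess k p \<omega>)\<^sup>2) \<le> (real k)\<^sup>2 / (real p)\<^sup>2"
proof -
  have pos: "0 < p" using assms by (simp add: prime_gt_0_nat)
  let ?a = "divprob n p"
  define h where "h \<omega> = hits k p \<omega> + miss k p \<omega> - 1" for \<omega>
  have Eh: "expectation h = k * ?a + (1 - ?a) ^ k - 1"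
    unfolding h_def using integrable_hits[of k p] integrable_miss[of k p]
    by (simp add: expectation_hits expectation_miss pos prob_space)
  have ih: "integrable M h" unfolding h_def using integrable_hits[of k p] integrable_miss[of k p] by simp
  have ihh: "integrable M (\<lambda>\<omega>. hits k p \<omega> * hits k p \<omega>)"
    by (rule integrable_mult_bounded[where a = k and b = k]) (auto simp: hits_bounds)
  have ih2: "integrable M (\<lambda>\<omega>. (h \<omega>)\<^sup>2)"
  proof -
    have hb: "\<bar>h \<omega>\<bar> \<le> real k + 1" for \<omega>
      using hits_bounds[of k p \<omega>] miss_bounds[of k p \<omega>] unfolding h_def by linarith
    have [measurable]: "h \<in> borel_measurable M" using ih by simp
    show ?thesis unfolding power2_eq_square by (rule integrable_mult_bounded[OF _ _ hb hb]) simp_all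
  qed
  have "expectation (\<lambda>\<omega>. (excess k p \<omega>)\<^sup>2) = variance h"
    unfolding Eh by (intro Bochner_Integration.integral_cong) (auto simp: chits_def cmiss_def h_def algebra_simps)
  also have "\<dots> \<le> expectation (\<lambda>\<omega>. (h \<omega>)\<^sup>2)" using variance_eq[OF ih ih2] by simp
  also have "\<dots> \<le> expectation (\<lambda>\<omega>. hits k p \<omega> * hits k p \<omega> - hits k p \<omega>)"
  proof (rule integral_mono[OF ih2])
    show "integrable M (\<lambda>\<omega>. hits k p \<omega> * hits k p \<omega> - hits k p \<omega>)" using ihh integrable_hits by simp
    fix \<omega>
    show "(h \<omega>)\<^sup>2 \<le> hits k p \<omega> * hits k p \<omega> - hits k p \<omega>"
    proof (cases "\<forall>j\<in>{1..k}. \<not> p dvd U j \<omega>")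
      case True
      then have "hits k p \<omega> = 0" "miss k p \<omega> = 1" by (auto simp: hits_def miss_eq)
      then show ?thesis by (simp add: h_def)
    next
      case False
      then obtain i where i: "i \<in> {1..k}" "p dvd U i \<omega>" by auto
      have "(\<Sum>j\<in>{i}. of_bool (p dvd U j \<omega>)) \<le> hits k p \<omega>"
        unfolding hits_def by (rule sum_mono2) (use i in auto)
      then have 1: "1 \<le> hits k p \<omega>" using i by simp
      have "miss k p \<omega> = 0" using False by (simp add: miss_eq)
      then show ?thesis using 1 by (simp add: h_def power2_eq_square algebra_simps)
    qed
  qed
  also have "\<dots> = expectation (\<lambda>\<omega>. hits k p \<omega> * hits k p \<omega>) - k * ?a"
    using ihh integrable_hits[of k p] by (simp add: expectation_hits pos)
  also have "expectation (\<lambda>\<omega>. hits k p \<omega> * hits k p \<omega>) = k * ?a + k * (real k - 1) * (?a * ?a)"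
    using expectation_sum_sum[of "{1..k}" "\<lambda>u. of_bool (p dvd u)" "\<lambda>u. of_bool (p dvd u)"]
    unfolding hits_def avg_of_bool_dvd[OF pos] of_bool_conj[symmetric] conj_absorb by (simp add: avg_of_bool_dvd[OF pos] del: of_bool_conj)
  also have "k * ?a + k * (real k - 1) * (?a * ?a) - k * ?a \<le> (real k)\<^sup>2 * ?a\<^sup>2"
  proof -
    have "0 \<le> real k * (?a * ?a)" using divprob_nonneg by auto
    then show ?thesis by (simp add: power2_eq_square algebra_simps)
  qed
  also have "\<dots> \<le> (real k)\<^sup>2 * (1 / real p)\<^sup>2"
    using divprob_le[OF n, of p] divprob_nonneg by (intro mult_left_mono power_mono) auto
  finally show ?thesis by (simp add: power_divide)
qed

end

section \<open>Moments of the additive functions\<close>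

lemma ln_4_bounds: "1 \<le> ln (4::real)" "ln (4::real) \<le> 3"
proof -
  show "ln (4::real) \<le> 3" using ln_le_minus_one[of "4::real"] by simp
  have "exp 1 \<le> (4::real)" using exp_le by linarith
  then show "1 \<le> ln (4::real)" by (subst ln_ge_iff) auto
qed

lemma mertens_nonneg: "0 \<le> mertens z" unfolding mertens_def by (intro sum_nonneg) auto

lemma mertens_le: "1 \<le> z \<Longrightarrow> mertens z \<le> 3 * (1 + ln z)"
proof -
  assume "1 \<le> z"
  then have "mertens z \<le> ln z + ln 4" by (rule mertens_upper)
  then have "mertens z \<le> 3 + 3 * ln z" using ln_4_bounds(2) ln_ge_0_of_nat[of z] by linarith
  then show ?thesis by simp
qed

lemma sum_lprimes_mult:
  "(\<Sum>u\<in>{1..N}. lprimes z n u * \<phi> u) = (\<Sum>p\<in>primes_in z n. ln (real p) * (\<Sum>v\<in>{1..N div p}. \<phi> (p * v)))"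
proof -
  have "(\<Sum>u\<in>{1..N}. lprimes z n u * \<phi> u) = (\<Sum>p\<in>primes_in z n. ln (real p) * (\<Sum>u\<in>{1..N}. of_bool (p dvd u) * \<phi> u))"
    unfolding lprimes_def sum_distrib_right by (subst sum.swap) (simp only: sum_distrib_left mult.assoc)
  also have "\<dots> = (\<Sum>p\<in>primes_in z n. ln (real p) * (\<Sum>v\<in>{1..N div p}. \<phi> (p * v)))"
    by (intro sum.cong refl) (subst sum_dvd_reindex, auto dest: primes_in_pos)
  finally show ?thesis .
qed

text \<open>A prime dividing p v is p itself or divides v, and the possible new summand ln p is at
  most ln z.\<close>

lemma lprimes_mult_le:
  assumes "p \<in> primes_in 0 z"
  shows "lprimes 0 z (p * v) \<le> ln z + lprimes 0 z v"
proof -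
  have p: "0 < p" "p \<le> z" "prime p" using assms by (auto simp: primes_in_def)
  have "lprimes 0 z (p * v) \<le> (\<Sum>q\<in>primes_in 0 z. (if p = q then ln (real q) else 0) + ln (real q) * of_bool (q dvd v))"
    unfolding lprimes_def
  proof (rule sum_mono)
    fix q assume "q \<in> primes_in 0 z"
    then have "prime q" by (simp add: primes_in_def)
    then have "q dvd p * v \<longrightarrow> q = p \<or> q dvd v" using p by (auto simp: prime_dvd_mult_iff primes_dvd_imp_eq)
    then show "ln (real q) * of_bool (q dvd p * v) \<le> (if p = q then ln (real q) else 0) + ln (real q) * of_bool (q dvd v)"
      by auto
  qed
  also have "\<dots> = ln (real p) + lprimes 0 z v"
    using assms by (simp add: sum.distrib lprimes_def)
  also have "\<dots> \<le> ln z + lprimes 0 z v" using p by simp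
  finally show ?thesis .
qed

text \<open>Expanding one factor over the primes p dividing u and substituting u = p v lowers the
  degree by one: the remaining function at p v is majorised by \<psi> v, and the primes contribute
  the factor \<open>mertens z\<close>.\<close>

lemma sum_lprimes_moment_step:
  assumes "0 \<le> G" and \<psi>: "\<And>N. (\<Sum>v\<in>{1..N}. \<psi> v) \<le> real N * G"
    and \<phi>: "\<And>p v. p \<in> primes_in 0 z \<Longrightarrow> \<phi> (p * v) \<le> \<psi> v"
  shows "(\<Sum>u\<in>{1..N}. lprimes 0 z u * \<phi> u) \<le> real N * (mertens z * G)"
proof -
  have "(\<Sum>u\<in>{1..N}. lprimes 0 z u * \<phi> u) \<le> (\<Sum>p\<in>primes_in 0 z. ln (real p) * (real N / real p * G))"
    unfolding sum_lprimes_mult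
  proof (intro sum_mono mult_left_mono)
    fix p assume p: "p \<in> primes_in 0 z"
    have "(\<Sum>v\<in>{1..N div p}. \<phi> (p * v)) \<le> (\<Sum>v\<in>{1..N div p}. \<psi> v)" by (intro sum_mono \<phi> p)
    also have "\<dots> \<le> real (N div p) * G" by (rule \<psi>)
    also have "\<dots> \<le> real N / real p * G" using assms(1) by (intro mult_right_mono div_le_real)
    finally show "(\<Sum>v\<in>{1..N div p}. \<phi> (p * v)) \<le> real N / real p * G" .
  qed auto
  also have "\<dots> = real N * (mertens z * G)"
    unfolding mertens_def sum_distrib_left sum_distrib_right by (intro sum.cong refl) simp
  finally show ?thesis .
qed

text \<open>Three rounds of the moment step, each raising the order by one. The intermediate bounds
  are stated for every N because the next round uses them at \<open>N div p\<close>.\<close>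

lemma sum_lprimes_cubed_le:
  assumes "1 \<le> z"
  shows "(\<Sum>u\<in>{1..N}. lprimes 0 z u ^ 3) \<le> real N * (78 * (1 + ln z) ^ 3)"
proof -
  let ?f = "lprimes 0 z" and ?A = "mertens z" and ?l = "ln (real z)"
  have s1: "(\<Sum>u\<in>{1..N}. ?f u) \<le> real N * ?A" for N
    using sum_lprimes_moment_step[of 1 "\<lambda>_. 1" z "\<lambda>_. 1" N] by simp
  have s2: "(\<Sum>u\<in>{1..N}. (?f u)\<^sup>2) \<le> real N * (?A * (?l + ?A))" for N
    unfolding power2_eq_square
  proof (rule sum_lprimes_moment_step)
    show "(\<Sum>v\<in>{1..N}. ?l + ?f v) \<le> real N * (?l + ?A)" for N
      using s1[of N] by (simp add: sum.distrib algebra_simps)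
  qed (auto simp: mertens_nonneg lprimes_mult_le)
  have s3: "(\<Sum>u\<in>{1..N}. ?f u * (?f u)\<^sup>2) \<le> real N * (?A * (2 * ?l\<^sup>2 + 2 * (?A * (?l + ?A))))"
  proof (rule sum_lprimes_moment_step)
    show "(\<Sum>v\<in>{1..N}. 2 * ?l\<^sup>2 + 2 * (?f v)\<^sup>2) \<le> real N * (2 * ?l\<^sup>2 + 2 * (?A * (?l + ?A)))" for N
      using s2[of N] by (simp add: sum.distrib sum_distrib_left[symmetric] algebra_simps)
    fix p v assume "p \<in> primes_in 0 z"
    then have "(?f (p * v))\<^sup>2 \<le> (?l + ?f v)\<^sup>2" by (intro power_mono lprimes_mult_le lprimes_nonneg)
    also have "\<dots> \<le> 2 * ?l\<^sup>2 + 2 * (?f v)\<^sup>2"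
      using zero_le_power2[of "?l - ?f v"] by (simp add: power2_sum power2_diff)
    finally show "(?f (p * v))\<^sup>2 \<le> 2 * ?l\<^sup>2 + 2 * (?f v)\<^sup>2" .
  qed (auto intro!: add_nonneg_nonneg mult_nonneg_nonneg simp: mertens_nonneg)
  define L where "L = 1 + ?l"
  have L: "?l \<le> L" "?A \<le> 3 * L" "0 \<le> L" "0 \<le> ?l" "0 \<le> ?A"
    using mertens_le[OF assms] mertens_nonneg[of z] by (auto simp: L_def)
  \<comment> \<open>With L = 1 + ln z every factor is at most a multiple of L, and 3 (2 + 2 * 3 * 4)
    = 78.\<close>
  have "?A * (2 * ?l\<^sup>2 + 2 * (?A * (?l + ?A))) \<le> (3 * L) * (2 * L\<^sup>2 + 2 * ((3 * L) * (L + 3 * L)))"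
    using L by (intro mult_mono add_mono power_mono mult_left_mono) (auto intro!: add_nonneg_nonneg mult_nonneg_nonneg)
  also have "\<dots> = 78 * L ^ 3" by (simp add: power2_eq_square power3_eq_cube algebra_simps)
  finally have "real N * (?A * (2 * ?l\<^sup>2 + 2 * (?A * (?l + ?A)))) \<le> real N * (78 * L ^ 3)" by (rule mult_left_mono) simp
  moreover have "(\<Sum>u\<in>{1..N}. ?f u ^ 3) = (\<Sum>u\<in>{1..N}. ?f u * (?f u)\<^sup>2)"
    by (intro sum.cong refl) (simp add: power3_eq_cube power2_eq_square)
  ultimately show ?thesis using s3 unfolding L_def by linarith
qed

lemma avg_lprimes: "avg n (lprimes z y) = (\<Sum>p\<in>primes_in z y. ln (real p) * divprob n p)"
  unfolding avg_def sum_lprimes divprob_def by (simp add: sum_divide_distrib)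

lemma avg_lprimes_le: "1 \<le> n \<Longrightarrow> avg n (lprimes 0 z) \<le> mertens z"
  unfolding avg_lprimes mertens_def using mult_left_mono[OF divprob_le] by (intro sum_mono) fastforce

text \<open>For nonnegative numbers the cube of the distance is at most the sum of the cubes. The
  constant is 105 = 78 + 27, the 27 coming from the mean, which is at most 3 (1 + ln z).\<close>

lemma third_moment_small:
  assumes "1 \<le> z" "1 \<le> n"
  shows "avg n (\<lambda>u. \<bar>lprimes 0 z u - avg n (lprimes 0 z)\<bar> ^ 3) \<le> 105 * (1 + ln z) ^ 3"
proof -
  define \<mu> where "\<mu> = avg n (lprimes 0 z)"
  have \<mu>0: "0 \<le> \<mu>" unfolding \<mu>_def by (intro avg_nonneg lprimes_nonneg)
  have "\<mu> \<le> 3 * (1 + ln z)"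
    using avg_lprimes_le[OF assms(2), of z] mertens_le[OF assms(1)] unfolding \<mu>_def by (rule order.trans)
  then have "\<mu> ^ 3 \<le> (3 * (1 + ln z)) ^ 3" using \<mu>0 by (intro power_mono)
  then have \<mu>3: "\<mu> ^ 3 \<le> 27 * (1 + ln z) ^ 3" unfolding power_mult_distrib by simp
  have "avg n (\<lambda>u. \<bar>lprimes 0 z u - \<mu>\<bar> ^ 3) \<le> avg n (\<lambda>u. lprimes 0 z u ^ 3 + \<mu> ^ 3)"
  proof (rule avg_mono)
    fix u
    have "\<bar>lprimes 0 z u - \<mu>\<bar> \<le> max (lprimes 0 z u) \<mu>" using lprimes_nonneg[of 0 z u] \<mu>0 by auto
    then have "\<bar>lprimes 0 z u - \<mu>\<bar> ^ 3 \<le> (max (lprimes 0 z u) \<mu>) ^ 3" by (intro power_mono) auto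
    also have "\<dots> \<le> lprimes 0 z u ^ 3 + \<mu> ^ 3" using lprimes_nonneg[of 0 z u] \<mu>0 by (auto simp: max_def)
    finally show "\<bar>lprimes 0 z u - \<mu>\<bar> ^ 3 \<le> lprimes 0 z u ^ 3 + \<mu> ^ 3" .
  qed
  also have "\<dots> = avg n (\<lambda>u. lprimes 0 z u ^ 3) + \<mu> ^ 3" using assms by (simp add: avg_add avg_const)
  also have "avg n (\<lambda>u. lprimes 0 z u ^ 3) \<le> 78 * (1 + ln z) ^ 3"
    using sum_lprimes_cubed_le[OF assms(1), of n] assms(2) by (simp add: avg_def divide_le_eq mult.commute)
  finally show ?thesis using \<mu>3 unfolding \<mu>_def by simp
qed

lemma avg_lprimes_sq:
  "avg n (\<lambda>u. (lprimes z y u)\<^sup>2) = (\<Sum>p\<in>primes_in z y. (ln (real p))\<^sup>2 * divprob n p)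
     + (\<Sum>p\<in>primes_in z y. \<Sum>q\<in>primes_in z y - {p}. ln (real p) * ln (real q) * divprob n (p * q))"
proof -
  let ?P = "primes_in z y"
  have "avg n (\<lambda>u. (lprimes z y u)\<^sup>2) = avg n (\<lambda>u. \<Sum>p\<in>?P. \<Sum>q\<in>?P. ln (real p) * ln (real q) * (of_bool (p dvd u) * of_bool (q dvd u)))"
    unfolding power2_eq_square lprimes_def sum_product by (simp only: ac_simps)
  also have "\<dots> = (\<Sum>p\<in>?P. \<Sum>q\<in>?P. ln (real p) * ln (real q) * avg n (\<lambda>u. of_bool (p dvd u) * of_bool (q dvd u)))"
    by (simp only: avg_sum avg_cmult)
  also have "\<dots> = (\<Sum>p\<in>?P. (ln (real p))\<^sup>2 * divprob n p + (\<Sum>q\<in>?P - {p}. ln (real p) * ln (real q) * divprob n (p * q)))"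
  proof (intro sum.cong refl)
    fix p assume p: "p \<in> ?P"
    have d: "avg n (\<lambda>u. of_bool (p dvd u) * of_bool (p dvd u)) = divprob n p"
      using avg_of_bool_dvd[OF primes_in_pos[OF p], of n] by (simp only: of_bool_conj[symmetric] conj_absorb)
    have o: "avg n (\<lambda>u. of_bool (p dvd u) * of_bool (q dvd u)) = divprob n (p * q)" if "q \<in> ?P - {p}" for q
    proof -
      have pq: "prime p" "prime q" "p \<noteq> q" using p that by (auto simp: primes_in_def)
      show ?thesis using pq by (simp only: of_bool_dvd_mult[OF pq] avg_of_bool_dvd mult_pos_pos prime_gt_0_nat)
    qed
    show "(\<Sum>q\<in>?P. ln (real p) * ln (real q) * avg n (\<lambda>u. of_bool (p dvd u) * of_bool (q dvd u))) =
       (ln (real p))\<^sup>2 * divprob n p + (\<Sum>q\<in>?P - {p}. ln (real p) * ln (real q) * divprob n (p * q))"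
      using p by (subst sum.remove[of _ p]) (auto simp: d o power2_eq_square simp del: of_bool_conj intro!: sum.cong)
  qed
  finally show ?thesis by (simp only: sum.distrib)
qed

lemma sum_ln_sq_le: "1 \<le> z \<Longrightarrow> (\<Sum>p\<in>primes_in y z. (ln (real p))\<^sup>2) \<le> ln z * (z * ln 4)"
proof -
  assume z: "1 \<le> z"
  have "(\<Sum>p\<in>primes_in y z. (ln (real p))\<^sup>2) \<le> (\<Sum>p\<in>primes_in 0 z. ln z * ln (real p))"
  proof (rule sum_le_included[where i = id])
    show "\<forall>p\<in>primes_in y z. \<exists>q\<in>primes_in 0 z. id q = p \<and> (ln (real p))\<^sup>2 \<le> ln z * ln (real q)"
    proof
      fix p assume "p \<in> primes_in y z"
      then have p: "p \<in> primes_in 0 z" "0 < p" "p \<le> z" by (auto simp: primes_in_def)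
      then have "(ln (real p))\<^sup>2 \<le> ln z * ln (real p)"
        unfolding power2_eq_square by (intro mult_right_mono ln_mono) auto
      then show "\<exists>q\<in>primes_in 0 z. id q = p \<and> (ln (real p))\<^sup>2 \<le> ln z * ln (real q)" using p by auto
    qed
  qed auto
  also have "\<dots> = ln z * theta z" by (simp add: theta_def sum_distrib_left)
  also have "\<dots> \<le> ln z * (z * ln 4)" by (intro mult_left_mono theta_le) auto
  finally show ?thesis .
qed

lemma divprob_diff: "1 \<le> n \<Longrightarrow> 0 < d \<Longrightarrow> \<bar>divprob n d - 1 / real d\<bar> \<le> 1 / real n"
  using divprob_ge[of n d] divprob_le[of n d] by auto

lemma sum_divprob_diff:
  assumes n: "1 \<le> n" and c: "\<And>p. 0 \<le> c p"
  shows "\<bar>\<Sum>p\<in>primes_in z y. c p * (divprob n p - 1 / real p)\<bar> \<le> (\<Sum>p\<in>primes_in z y. c p) * (1 / real n)"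
proof -
  have "\<bar>\<Sum>p\<in>primes_in z y. c p * (divprob n p - 1 / real p)\<bar> \<le> (\<Sum>p\<in>primes_in z y. \<bar>c p * (divprob n p - 1 / real p)\<bar>)"
    by (rule sum_abs)
  also have "\<dots> \<le> (\<Sum>p\<in>primes_in z y. c p * (1 / real n))"
  proof (rule sum_mono)
    fix p assume "p \<in> primes_in z y"
    then show "\<bar>c p * (divprob n p - 1 / real p)\<bar> \<le> c p * (1 / real n)"
      unfolding abs_mult abs_of_nonneg[OF c] using primes_in_pos c by (intro mult_left_mono divprob_diff n) auto
  qed
  finally show ?thesis unfolding sum_distrib_right .
qed

text \<open>The variance is a diagonal part, essentially \<open>mertens2 z\<close> and hence (ln
  z)^2 / 2, plus covariances of distinct primes. Each of these is at most 1 / n in absolute value,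
  and with the weights ln p ln q they total at most (theta z)^2 / n \<le> 9; here z \<le> sqrt n
  enters.\<close>

lemma variance_small:
  assumes z: "1 \<le> z" "real z \<le> sqrt n"
  shows "\<bar>avg n (\<lambda>u. (lprimes 0 z u)\<^sup>2) - (avg n (lprimes 0 z))\<^sup>2 - (ln z)\<^sup>2 / 2\<bar> \<le> (40 + 2 * C_mer) * (1 + ln z)"
proof -
  let ?P = "primes_in 0 z"
  have zn: "(real z)\<^sup>2 \<le> n" using power_mono[OF z(2), of 2] by simp
  have "z * 1 \<le> z * z" using z by (intro mult_left_mono) auto
  then have "real z \<le> (real z)\<^sup>2" unfolding power2_eq_square by (metis of_nat_le_iff of_nat_mult mult_1_right)
  then have "real z \<le> real n" using zn by linarith
  then have zn': "z \<le> n" by simp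
  then have n: "1 \<le> n" using z by simp
  have "(avg n (lprimes 0 z))\<^sup>2 = (\<Sum>p\<in>?P. \<Sum>q\<in>?P. ln (real p) * ln (real q) * (divprob n p * divprob n q))"
    unfolding power2_eq_square avg_lprimes sum_product by (simp only: ac_simps)
  also have "\<dots> = (\<Sum>p\<in>?P. (ln (real p))\<^sup>2 * (divprob n p)\<^sup>2 + (\<Sum>q\<in>?P - {p}. ln (real p) * ln (real q) * (divprob n p * divprob n q)))"
    by (intro sum.cong refl, subst sum.remove) (auto simp: power2_eq_square)
  finally have sq: "(avg n (lprimes 0 z))\<^sup>2 = (\<Sum>p\<in>?P. (ln (real p))\<^sup>2 * (divprob n p)\<^sup>2) + (\<Sum>p\<in>?P. \<Sum>q\<in>?P - {p}. ln (real p) * ln (real q) * (divprob n p * divprob n q))"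
    by (simp only: sum.distrib)
  have eq: "avg n (\<lambda>u. (lprimes 0 z u)\<^sup>2) - (avg n (lprimes 0 z))\<^sup>2 - mertens2 z =
     (\<Sum>p\<in>?P. (ln (real p))\<^sup>2 * (divprob n p - 1 / real p)) - (\<Sum>p\<in>?P. (ln (real p))\<^sup>2 * (divprob n p)\<^sup>2)
     + (\<Sum>p\<in>?P. \<Sum>q\<in>?P - {p}. ln (real p) * ln (real q) * (divprob n (p * q) - divprob n p * divprob n q))"
    unfolding avg_lprimes_sq sq mertens2_def by (simp add: right_diff_distrib sum_subtractf)
  have b1: "\<bar>\<Sum>p\<in>?P. (ln (real p))\<^sup>2 * (divprob n p - 1 / real p)\<bar> \<le> 3 * ln z"
  proof -
    have "\<bar>\<Sum>p\<in>?P. (ln (real p))\<^sup>2 * (divprob n p - 1 / real p)\<bar> \<le> (\<Sum>p\<in>?P. (ln (real p))\<^sup>2) * (1 / real n)"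
      by (rule sum_divprob_diff[OF n]) simp
    also have "\<dots> \<le> ln z * (z * ln 4) * (1 / real n)"
      by (intro mult_right_mono sum_ln_sq_le z) auto
    also have "\<dots> = ln z * ln 4 * (z / real n)" by simp
    also have "\<dots> \<le> ln z * 3 * 1" using ln_4_bounds zn' n by (intro mult_mono) auto
    finally show ?thesis by simp
  qed
  have b2: "\<bar>\<Sum>p\<in>?P. (ln (real p))\<^sup>2 * (divprob n p)\<^sup>2\<bar> \<le> 18"
  proof -
    have "\<bar>\<Sum>p\<in>?P. (ln (real p))\<^sup>2 * (divprob n p)\<^sup>2\<bar> = (\<Sum>p\<in>?P. (ln (real p))\<^sup>2 * (divprob n p)\<^sup>2)"
      by (intro abs_of_nonneg sum_nonneg) auto
    also have "\<dots> \<le> (\<Sum>p\<in>?P. (ln (real p))\<^sup>2 * (1 / real p)\<^sup>2)"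
      by (intro sum_mono mult_left_mono power_mono divprob_le n divprob_nonneg) auto
    finally have le: "\<bar>\<Sum>p\<in>?P. (ln (real p))\<^sup>2 * (divprob n p)\<^sup>2\<bar> \<le> (\<Sum>p\<in>?P. (ln (real p))\<^sup>2 / (real p)\<^sup>2)"
      by (simp add: power_divide)
    \<comment> \<open>All primes exceed 1, so the tail bound starting at 1 covers the whole range,
      and ln 1 = 0 leaves 6 ln 4 \<le> 18.\<close>
    have "?P = primes_in 1 z"
    proof (intro equalityI subsetI)
      fix p assume p: "p \<in> ?P"
      then have "prime p" by (simp add: primes_in_def)
      then have "1 < p" by (rule prime_gt_1_nat)
      then show "p \<in> primes_in 1 z" using p by (simp add: primes_in_def)
    qed (simp add: primes_in_def)
    then show ?thesis using le sum_ln_sq_div_sq[of 1 z] ln_4_bounds by simp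
  qed
  have b3: "\<bar>\<Sum>p\<in>?P. \<Sum>q\<in>?P - {p}. ln (real p) * ln (real q) * (divprob n (p * q) - divprob n p * divprob n q)\<bar> \<le> 9"
  proof -
    have "\<bar>\<Sum>p\<in>?P. \<Sum>q\<in>?P - {p}. ln (real p) * ln (real q) * (divprob n (p * q) - divprob n p * divprob n q)\<bar>
       \<le> (\<Sum>p\<in>?P. \<Sum>q\<in>?P - {p}. ln (real p) * ln (real q) * (1 / real n))"
    proof (rule order_trans[OF sum_abs sum_mono], rule order_trans[OF sum_abs sum_mono])
      fix p q assume pq: "p \<in> ?P" "q \<in> ?P - {p}"
      then have pos: "0 < p" "0 < q" "2 \<le> p" "2 \<le> q" "p \<le> n" "q \<le> n"
        using zn' prime_ge_2_nat by (auto simp: primes_in_def)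
      have "1 / real p \<le> 1 / 2" "1 / real q \<le> 1 / 2" using pos by (auto simp: field_simps)
      then have "(1 / real p + 1 / real q) / real n \<le> 1 / real n" by (intro divide_right_mono) auto
      moreover have "1 / real (p * q) - 1 / real n \<le> divprob n (p * q)" using pos n by (intro divprob_ge) auto
      moreover have "divprob n p * divprob n q \<le> 1 / real p * (1 / real q)"
        using n by (intro mult_mono divprob_le divprob_nonneg) auto
      ultimately have "\<bar>divprob n (p * q) - divprob n p * divprob n q\<bar> \<le> 1 / real n"
        using divprob_cov(1)[OF n pos(1,5) pos(2,6)] by (simp add: abs_le_iff)
      then show "\<bar>ln (real p) * ln (real q) * (divprob n (p * q) - divprob n p * divprob n q)\<bar> \<le> ln (real p) * ln (real q) * (1 / real n)"
        unfolding abs_mult by (intro mult_mono) auto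
    qed
    also have "\<dots> \<le> (\<Sum>p\<in>?P. \<Sum>q\<in>?P. ln (real p) * ln (real q) * (1 / real n))"
      by (intro sum_mono sum_mono2) auto
    also have "\<dots> = theta z * theta z / n"
      unfolding theta_def sum_product sum_divide_distrib by simp
    also have "\<dots> \<le> (real z * 3) * (real z * 3) / n"
    proof -
      have "theta z \<le> real z * 3" using theta_le[of z] mult_left_mono[OF ln_4_bounds(2), of "real z"] by linarith
      then show ?thesis by (intro divide_right_mono mult_mono) (auto simp: theta_nonneg)
    qed
    also have "\<dots> \<le> 9" using zn n by (simp add: field_simps power2_eq_square)
    finally show ?thesis .
  qed
  have b4: "\<bar>mertens2 z - (ln z)\<^sup>2 / 2\<bar> \<le> (2 * C_mer + 1) * ln z" by (rule mertens2_bound[OF z(1)])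
  define l where "l = ln (real z)"
  define c where "c = C_mer * l"
  have r: "(40 + 2 * C_mer) * (1 + l) = 40 + 40 * l + 2 * C_mer + 2 * c" "(2 * C_mer + 1) * l = 2 * c + l"
    by (simp_all add: c_def algebra_simps)
  have lc: "0 \<le> l" "0 \<le> C_mer" using C_mer_pos by (auto simp: l_def)
  define V where "V = avg n (\<lambda>u. (lprimes 0 z u)\<^sup>2) - (avg n (lprimes 0 z))\<^sup>2"
  have "\<bar>V - mertens2 z\<bar> \<le> 3 * l + 18 + 9"
    unfolding V_def eq using b1 b2 b3 unfolding l_def by linarith
  moreover have "\<bar>mertens2 z - l\<^sup>2 / 2\<bar> \<le> 2 * c + l" using b4 unfolding l_def[symmetric] r .
  ultimately have "\<bar>V - l\<^sup>2 / 2\<bar> \<le> 40 + 40 * l + 2 * C_mer + 2 * c" using lc by linarith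
  then show ?thesis unfolding V_def l_def[symmetric] r .
qed

text \<open>Two primes above z > sqrt n have a product above n, so the second moment is purely
  diagonal, \<open>mertens2 n - mertens2 z\<close> up to O(ln n), while the mean is ln n - ln z up
  to O(1). With L = ln n and l = ln z the main term is (L^2 - l^2) / 2 - (L - l)^2 = (L - l) (3 l -
  L) / 2, the source of the norming in case (ii).\<close>

lemma variance_large:
  assumes z: "1 \<le> z" "z \<le> n" "sqrt n < real z"
  shows "\<bar>avg n (\<lambda>u. (lprimes z n u)\<^sup>2) - (avg n (lprimes z n))\<^sup>2 - (ln n - ln z) * (3 * ln z - ln n) / 2\<bar>
      \<le> (20 + 10 * C_mer + (3 + 2 * C_mer)\<^sup>2) * (1 + ln n)"
proof -
  let ?P = "primes_in z n"
  have n: "1 \<le> n" using z by simp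
  have nz: "n < z * z"
  proof -
    have "(sqrt n)\<^sup>2 < (real z)\<^sup>2" by (intro power_strict_mono z) auto
    then have "real n < real (z * z)" by (simp add: power2_eq_square)
    then show ?thesis by (simp only: of_nat_less_iff)
  qed
  have zl: "ln z \<le> ln n" using z by simp
  have "divprob n (p * q) = 0" if "p \<in> ?P" "q \<in> ?P" for p q
  proof -
    have "z * z \<le> p * q" using that by (intro mult_le_mono) (auto simp: primes_in_def)
    then show ?thesis using nz by (simp add: divprob_def)
  qed
  then have sq: "avg n (\<lambda>u. (lprimes z n u)\<^sup>2) = (\<Sum>p\<in>?P. (ln (real p))\<^sup>2 * divprob n p)"
    unfolding avg_lprimes_sq by simp
  have b1: "\<bar>avg n (\<lambda>u. (lprimes z n u)\<^sup>2) - (mertens2 n - mertens2 z)\<bar> \<le> 3 * ln n"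
  proof -
    have "mertens2 n - mertens2 z = (\<Sum>p\<in>?P. (ln (real p))\<^sup>2 * (1 / real p))"
      unfolding mertens2_def using sum_primes_in_split[of 0 z n "\<lambda>p. (ln (real p))\<^sup>2 / real p"] z by simp
    then have "\<bar>avg n (\<lambda>u. (lprimes z n u)\<^sup>2) - (mertens2 n - mertens2 z)\<bar> = \<bar>\<Sum>p\<in>?P. (ln (real p))\<^sup>2 * (divprob n p - 1 / real p)\<bar>"
      unfolding sq by (simp only: right_diff_distrib sum_subtractf)
    also have "\<dots> \<le> (\<Sum>p\<in>?P. (ln (real p))\<^sup>2) * (1 / real n)"
      by (rule sum_divprob_diff[OF n]) simp
    also have "\<dots> \<le> ln n * (n * ln 4) * (1 / real n)"
      by (intro mult_right_mono sum_ln_sq_le n) auto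
    also have "\<dots> = ln n * ln 4" using n by simp
    also have "\<dots> \<le> ln n * 3" using ln_4_bounds by (intro mult_left_mono) auto
    finally show ?thesis by simp
  qed
  have b2: "\<bar>avg n (lprimes z n) - (mertens n - mertens z)\<bar> \<le> 3"
  proof -
    have "mertens n - mertens z = (\<Sum>p\<in>?P. ln (real p) * (1 / real p))"
      unfolding mertens_def using sum_primes_in_split[of 0 z n "\<lambda>p. ln (real p) / real p"] z by simp
    then have "\<bar>avg n (lprimes z n) - (mertens n - mertens z)\<bar> = \<bar>\<Sum>p\<in>?P. ln (real p) * (divprob n p - 1 / real p)\<bar>"
      unfolding avg_lprimes by (simp only: right_diff_distrib sum_subtractf)
    also have "\<dots> \<le> (\<Sum>p\<in>?P. ln (real p)) * (1 / real n)"
      by (rule sum_divprob_diff[OF n]) simp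
    also have "\<dots> \<le> theta n * (1 / real n)"
      unfolding theta_def by (intro mult_right_mono sum_mono2) (auto simp: primes_in_def)
    also have "\<dots> \<le> (n * ln 4) * (1 / real n)" by (intro mult_right_mono theta_le) auto
    also have "\<dots> \<le> 3" using n ln_4_bounds by simp
    finally show ?thesis .
  qed
  define K where "K = 3 + 2 * C_mer"
  have K: "0 \<le> K" using C_mer_pos by (simp add: K_def)
  define E where "E = avg n (lprimes z n) - (ln n - ln z)"
  have E: "\<bar>E\<bar> \<le> K" using b2 mertens_bound[OF n] mertens_bound[OF z(1)] unfolding E_def K_def by linarith
  have "avg n (lprimes z n) = (ln n - ln z) + E" by (simp add: E_def)
  then have msq: "(avg n (lprimes z n))\<^sup>2 = (ln n - ln z)\<^sup>2 + 2 * (E * (ln n - ln z)) + E\<^sup>2"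
  proof -
    have "(a + E)\<^sup>2 = a\<^sup>2 + 2 * (E * a) + E\<^sup>2" for a by (simp add: power2_eq_square algebra_simps)
    then show ?thesis using \<open>avg n (lprimes z n) = (ln n - ln z) + E\<close> by (simp only:)
  qed
  have e1: "\<bar>E * (ln n - ln z)\<bar> \<le> K * ln n"
    unfolding abs_mult using E zl K by (intro mult_mono) auto
  have e2: "E\<^sup>2 \<le> K\<^sup>2" "0 \<le> E\<^sup>2" using E K by (auto simp: power2_le_iff_abs_le)
  have m2: "\<bar>mertens2 n - (ln n)\<^sup>2 / 2\<bar> \<le> (2 * C_mer + 1) * ln n" by (rule mertens2_bound[OF n])
  have "\<bar>mertens2 z - (ln z)\<^sup>2 / 2\<bar> \<le> (2 * C_mer + 1) * ln z" by (rule mertens2_bound[OF z(1)])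
  also have "\<dots> \<le> (2 * C_mer + 1) * ln n" using zl C_mer_pos by (intro mult_left_mono) auto
  finally have m2': "\<bar>mertens2 z - (ln z)\<^sup>2 / 2\<bar> \<le> (2 * C_mer + 1) * ln n" .
  have id: "(ln n - ln z) * (3 * ln z - ln n) / 2 = (ln n)\<^sup>2 / 2 - (ln z)\<^sup>2 / 2 - (ln n - ln z)\<^sup>2"
    by (simp add: power2_eq_square field_simps)
  have r: "(20 + 10 * C_mer + (3 + 2 * C_mer)\<^sup>2) * (1 + ln n) = 20 + 10 * C_mer + K\<^sup>2 + 20 * ln n + 10 * (C_mer * ln n) + K\<^sup>2 * ln n"
    unfolding K_def by (simp add: algebra_simps)
  have "0 \<le> C_mer * ln n" "0 \<le> K\<^sup>2 * ln n" using C_mer_pos by auto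
  moreover have "(2 * C_mer + 1) * ln n = 2 * (C_mer * ln n) + ln n" "K * ln n = 3 * ln n + 2 * (C_mer * ln n)"
    by (simp_all add: K_def algebra_simps)
  ultimately show ?thesis
    unfolding r id using b1 msq e1 e2 m2 m2' C_mer_pos ln_ge_0_of_nat[of n] by linarith
qed

text \<open>ln n - L(u) is ln (n / u) plus the contribution of the higher prime powers, and both are
  bounded in mean square.\<close>

lemma avg_defect_sq_le:
  assumes "1 \<le> n"
  shows "avg n (\<lambda>u. (ln n - lprimes 0 n u)\<^sup>2) \<le> 64 + 2 * (C_pow + C_pow\<^sup>2)"
proof -
  have "(\<Sum>u\<in>{1..n}. (ln n - lprimes 0 n u)\<^sup>2) \<le> (\<Sum>u\<in>{1..n}. 2 * (ln (real n / real u))\<^sup>2 + 2 * (lpowers n u)\<^sup>2)"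
  proof (rule sum_mono)
    fix u assume u: "u \<in> {1..n}"
    have "ln n - lprimes 0 n u = ln (real n / real u) + lpowers n u"
      using ln_eq_lprimes_lpowers[OF u] u assms by (simp add: ln_div)
    then show "(ln n - lprimes 0 n u)\<^sup>2 \<le> 2 * (ln (real n / real u))\<^sup>2 + 2 * (lpowers n u)\<^sup>2"
      using zero_le_power2[of "ln (real n / real u) - lpowers n u"] by (simp add: power2_sum power2_diff)
  qed
  also have "\<dots> = 2 * (\<Sum>u\<in>{1..n}. (ln (real n / real u))\<^sup>2) + 2 * (\<Sum>u\<in>{1..n}. (lpowers n u)\<^sup>2)"
    by (simp add: sum.distrib sum_distrib_left)
  also have "\<dots> \<le> (64 + 2 * (C_pow + C_pow\<^sup>2)) * n"
    using sum_ln_ratio_sq_le[of n] sum_lpowers_sq_le[of n] by (simp add: algebra_simps)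
  finally show ?thesis using assms by (simp add: avg_def divide_le_eq)
qed

section \<open>Linear approximation of the log-lcm\<close>

text \<open>The three summands belong to the misses of primes up to z, the excesses of primes above
  z, and the higher prime powers.\<close>

definition C_err :: "real \<Rightarrow> real" where
  "C_err T = sqrt (ln 4 + 2 * T * ln 4 * (1 + ln 4)) + sqrt (6 * ln 4 * T\<^sup>2 + 4 * (ln 4)\<^sup>2 * (T ^ 3 + T\<^sup>2)) + (1 + T) * C_pow"

lemma sum_sum_product:
  fixes c :: real
  shows "(\<Sum>p\<in>A. \<Sum>q\<in>B. c * (f p * g q)) = c * (sum f A * sum g B)"
  unfolding sum_product unfolding sum_distrib_left ..

context uniform_sample
begin

text \<open>Almost surely all samples lie in [n], so the formula for the logarithm of an lcm
  applies; \<open>1 - miss k d\<close> indicates that d divides one of the first k samples.\<close>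

lemma AE_Ylcm:
  "AE \<omega> in M. Ylcm U k \<omega> = (\<Sum>p\<in>primes_in 0 n. ln (real p) * (1 - miss k p \<omega>)) + (\<Sum>d\<in>{1..n}. mangoldt' d * (1 - miss k d \<omega>))"
proof -
  have "AE \<omega> in M. \<forall>j. U j \<omega> \<in> {1..n}" using AE_U by (simp only: AE_all_countable) auto
  then show ?thesis
  proof eventually_elim
    case (elim \<omega>)
    have "Ylcm U k \<omega> = (\<Sum>d\<in>{1..n}. mangoldt d * of_bool (\<exists>a\<in>(\<lambda>j. U j \<omega>) ` {1..k}. d dvd a))"
      unfolding Ylcm_def using elim by (intro ln_Lcm) auto
    also have "\<dots> = (\<Sum>d\<in>{1..n}. mangoldt d * (1 - miss k d \<omega>))"
      by (intro sum.cong refl) (auto simp: miss_eq)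
    finally show ?case by (simp only: sum_mangoldt_split)
  qed
qed

text \<open>A prime p \<ge> 2 gives n div p < n, hence a positive base, and for natural k the real
  power in \<open>cn\<close> becomes an ordinary one. By \<open>expectation_miss\<close> this
  identifies \<open>cn\<close> with the mean of the prime part of Y.\<close>

lemma cn_eq: "cn n (real k) = (\<Sum>p\<in>primes_in 0 n. ln (real p) * (1 - (1 - divprob n p) ^ k))"
proof -
  have P: "{p. prime p \<and> p \<le> n} = primes_in 0 n" by (auto simp: primes_in_def prime_gt_0_nat)
  show ?thesis
    unfolding cn_def P
  proof (intro sum.cong refl)
    fix p assume "p \<in> primes_in 0 n"
    then have "prime p" by (simp add: primes_in_def)
    then have "1 < p" by (rule prime_gt_1_nat)
    then have "n div p < n" using n by (intro div_less_dividend) auto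
    then have "0 < 1 - real (n div p) / real n" by simp
    then show "ln (real p) * (1 - (1 - real (n div p) / real n) powr real k) = ln (real p) * (1 - (1 - divprob n p) ^ k)"
      by (simp add: powr_realpow divprob_def)
  qed
qed

lemma sum_lprimes_centered:
  "(\<Sum>j\<in>{1..k}. lprimes z n (U j \<omega>) - avg n (lprimes z n)) = (\<Sum>p\<in>primes_in z n. ln (real p) * chits k p \<omega>)"
proof -
  have a: "avg n (lprimes z n) = (\<Sum>p\<in>primes_in z n. ln (real p) * divprob n p)"
    unfolding avg_def sum_lprimes divprob_def by (simp add: sum_divide_distrib)
  have "(\<Sum>j\<in>{1..k}. lprimes z n (U j \<omega>)) = (\<Sum>p\<in>primes_in z n. ln (real p) * hits k p \<omega>)"
    unfolding lprimes_def hits_def sum_distrib_left by (rule sum.swap)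
  then show ?thesis
    unfolding sum_subtractf a chits_def
    by (simp add: right_diff_distrib sum_subtractf sum_distrib_left mult.left_commute)
qed

lemma expectation_higher_powers_le:
  assumes "1 \<le> z" "0 \<le> T" "real k \<le> T * real z"
  shows "expectation (\<lambda>\<omega>. \<Sum>d\<in>{1..n}. mangoldt' d * (1 - miss k d \<omega>)) \<le> (1 + T) * C_pow * sqrt z"
proof -
  have "expectation (\<lambda>\<omega>. \<Sum>d\<in>{1..n}. mangoldt' d * (1 - miss k d \<omega>)) = (\<Sum>d\<in>{1..n}. mangoldt' d * (1 - expectation (miss k d)))"
    using integrable_miss by (subst Bochner_Integration.integral_sum) (auto simp: prob_space)
  also have "\<dots> \<le> (\<Sum>d\<in>{1..n}. mangoldt' d * min 1 (real k / real d))"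
  proof (intro sum_mono mult_left_mono mangoldt'_nonneg)
    fix d assume d: "d \<in> {1..n}"
    have "1 - (1 - divprob n d) ^ k \<le> real k * divprob n d"
      using divprob_nonneg divprob_le_1[OF n] by (rule one_minus_power_le)
    also have "\<dots> \<le> real k * (1 / real d)" using divprob_le[OF n] by (intro mult_left_mono) auto
    finally show "1 - expectation (miss k d) \<le> min 1 (real k / real d)"
      using d divprob_power_bounds[of d k] by (simp add: expectation_miss)
  qed
  also have "\<dots> \<le> (1 + T) * C_pow * sqrt z" by (rule sum_mangoldt'_min[OF assms])
  finally show ?thesis .
qed

text \<open>The diagonal costs at most \<open>ln z * theta z\<close>. Each half of the covariance
  bound splits into a factor in p and one in q, giving
  \<open>2 * (k / n) * theta z * mertens z\<close> in total, and k / n \<le> T because z \<le>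
  n.\<close>

lemma small_primes_fluctuation:
  assumes z: "1 \<le> z" "z \<le> n" and T: "0 \<le> T" "real k \<le> T * real z"
  shows "expectation (\<lambda>\<omega>. \<bar>\<Sum>p\<in>primes_in 0 z. ln (real p) * cmiss k p \<omega>\<bar>) \<le> sqrt ((ln 4 + 2 * T * ln 4 * (1 + ln 4)) * (z * (1 + ln z)))"
proof (rule expectation_abs_le)
  let ?P = "primes_in 0 z"
  define b where "b p q = real k * ((1 / real p + 1 / real q) / real n)" for p q :: nat
  have 1: "expectation (\<lambda>\<omega>. (\<Sum>p\<in>?P. ln (real p) * cmiss k p \<omega>)\<^sup>2) \<le> (\<Sum>p\<in>?P. (ln (real p))\<^sup>2 * 1) + (\<Sum>p\<in>?P. \<Sum>q\<in>?P. ln (real p) * ln (real q) * b p q)"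
  proof (rule second_moment_weighted_sum)
    fix p q assume pq: "p \<in> ?P" "q \<in> ?P"
    show "integrable M (\<lambda>\<omega>. cmiss k p \<omega> * cmiss k q \<omega>)" by (rule integrable_cc)
    show "0 \<le> b p q" by (simp add: b_def)
    assume "p \<noteq> q"
    then show "expectation (\<lambda>\<omega>. cmiss k p \<omega> * cmiss k q \<omega>) \<le> b p q"
      unfolding b_def using pq z by (intro covariance_miss_le) (auto simp: primes_in_def)
  next
    fix p assume "p \<in> ?P"
    have "(cmiss k p \<omega>)\<^sup>2 \<le> 1" for \<omega> using abs_cmiss_le[of k p \<omega>] by (simp add: abs_square_le_1)
    then have "expectation (\<lambda>\<omega>. (cmiss k p \<omega>)\<^sup>2) \<le> expectation (\<lambda>\<omega>. 1)"
      using integrable_cc(1)[of k p p] by (intro integral_mono) (auto simp: power2_eq_square)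
    then show "expectation (\<lambda>\<omega>. (cmiss k p \<omega>)\<^sup>2) \<le> 1" by (simp add: prob_space)
  qed auto
  also have "(\<Sum>p\<in>?P. (ln (real p))\<^sup>2 * 1) \<le> (\<Sum>p\<in>?P. ln z * ln (real p))"
  proof (rule sum_mono)
    fix p assume "p \<in> ?P"
    then have "0 < p" "p \<le> z" by (auto simp: primes_in_def)
    then show "(ln (real p))\<^sup>2 * 1 \<le> ln z * ln (real p)"
      unfolding power2_eq_square mult_1_right by (intro mult_right_mono ln_mono) auto
  qed
  also have "\<dots> = ln z * theta z" by (simp add: theta_def sum_distrib_left)
  also have "(\<Sum>p\<in>?P. \<Sum>q\<in>?P. ln (real p) * ln (real q) * b p q) = real k / real n * (2 * (theta z * mertens z))"
  proof -
    have "(\<Sum>p\<in>?P. \<Sum>q\<in>?P. ln (real p) * ln (real q) * b p q) =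
       (\<Sum>p\<in>?P. \<Sum>q\<in>?P. real k / real n * (ln (real p) / real p * ln (real q)) + real k / real n * (ln (real p) * (ln (real q) / real q)))"
      by (intro sum.cong refl) (simp add: b_def add_divide_distrib algebra_simps)
    also have "\<dots> = real k / real n * (mertens z * theta z) + real k / real n * (theta z * mertens z)"
      unfolding sum.distrib sum_sum_product mertens_def theta_def ..
    finally show ?thesis by (simp add: algebra_simps)
  qed
  also have "ln z * theta z + real k / real n * (2 * (theta z * mertens z)) \<le> ln z * (z * ln 4) + T * (2 * ((z * ln 4) * (ln z + ln 4)))"
  proof -
    have "real k / real n \<le> T"
    proof -
      have "T * real z \<le> T * real n" using z T by (intro mult_left_mono) auto
      then show ?thesis using T z by (simp add: pos_divide_le_eq)
    qed
    moreover have "0 \<le> mertens z" unfolding mertens_def by (intro sum_nonneg) auto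
    ultimately show ?thesis using z T
      by (intro add_mono mult_mono theta_le mertens_upper mult_left_mono) (auto simp: theta_nonneg)
  qed
  also have "\<dots> \<le> (ln 4 + 2 * T * ln 4 * (1 + ln 4)) * (z * (1 + ln z))"
  proof -
    have a: "ln z + ln 4 \<le> (1 + ln 4) * (1 + ln z)" using ln_ge_0_of_nat[of z] by (simp add: algebra_simps)
    have "T * (2 * ((z * ln 4) * (ln z + ln 4))) \<le> T * (2 * ((z * ln 4) * ((1 + ln 4) * (1 + ln z))))"
      using T by (intro mult_left_mono a) auto
    moreover have "ln z * (z * ln 4) \<le> (1 + ln z) * (z * ln 4)" by (intro mult_right_mono) auto
    ultimately show ?thesis by (simp add: algebra_simps)
  qed
  finally show "expectation (\<lambda>\<omega>. (\<Sum>p\<in>?P. ln (real p) * cmiss k p \<omega>)\<^sup>2) \<le> (ln 4 + 2 * T * ln 4 * (1 + ln 4)) * (z * (1 + ln z))" by simp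
  show "integrable M (\<lambda>\<omega>. (\<Sum>p\<in>?P. ln (real p) * cmiss k p \<omega>)\<^sup>2)"
    \<comment> \<open>Integrability does not depend on the bounds, so the moments themselves are
      inserted for v and b.\<close>
    by (rule second_moment_weighted_sum(2)[where v = "\<lambda>p. expectation (\<lambda>\<omega>. (cmiss k p \<omega>)\<^sup>2)" and b = "\<lambda>p q. \<bar>expectation (\<lambda>\<omega>. cmiss k p \<omega> * cmiss k q \<omega>)\<bar>"])
       (auto intro: integrable_cc)
qed simp

text \<open>The diagonal is k^2 times the sum of (ln p / p)^2, and the rest is of order k^3 times
  the square of the sum of ln p / p^2. Over p > z these sums are O((1 + ln z) / z) and O(1 / z), so
  for k \<le> T z the total is O(z (1 + ln z)).\<close>

lemma large_primes_fluctuation: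
  assumes z: "1 \<le> z" "z \<le> n" and T: "0 \<le> T" "real k \<le> T * real z"
  shows "expectation (\<lambda>\<omega>. \<bar>\<Sum>p\<in>primes_in z n. ln (real p) * excess k p \<omega>\<bar>) \<le> sqrt ((6 * ln 4 * T\<^sup>2 + 4 * (ln 4)\<^sup>2 * (T ^ 3 + T\<^sup>2)) * (z * (1 + ln z)))"
proof (rule expectation_abs_le)
  let ?P = "primes_in z n"
  define b where "b p q = (real k ^ 3 + real k ^ 2) * (1 / (real p)\<^sup>2 * (1 / (real q)\<^sup>2))" for p q :: nat
  have int: "integrable M (\<lambda>\<omega>. excess k p \<omega> * excess k q \<omega>)" for p q
    unfolding distrib_left distrib_right using integrable_cc by auto
  have 1: "expectation (\<lambda>\<omega>. (\<Sum>p\<in>?P. ln (real p) * excess k p \<omega>)\<^sup>2) \<le>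
     (\<Sum>p\<in>?P. (ln (real p))\<^sup>2 * ((real k)\<^sup>2 / (real p)\<^sup>2)) + (\<Sum>p\<in>?P. \<Sum>q\<in>?P. ln (real p) * ln (real q) * b p q)"
  proof (rule second_moment_weighted_sum)
    fix p q assume pq: "p \<in> ?P" "q \<in> ?P"
    show "integrable M (\<lambda>\<omega>. excess k p \<omega> * excess k q \<omega>)" by (rule int)
    show "0 \<le> b p q" by (simp add: b_def)
    assume "p \<noteq> q"
    then show "expectation (\<lambda>\<omega>. excess k p \<omega> * excess k q \<omega>) \<le> b p q"
      unfolding b_def using pq z by (intro covariance_excess_le) (auto simp: primes_in_def)
  next
    fix p assume "p \<in> ?P"
    then show "expectation (\<lambda>\<omega>. (excess k p \<omega>)\<^sup>2) \<le> (real k)\<^sup>2 / (real p)\<^sup>2"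
      by (intro second_moment_excess_le) (auto simp: primes_in_def)
  qed auto
  also have "(\<Sum>p\<in>?P. (ln (real p))\<^sup>2 * ((real k)\<^sup>2 / (real p)\<^sup>2)) = (real k)\<^sup>2 * (\<Sum>p\<in>?P. (ln (real p))\<^sup>2 / (real p)\<^sup>2)"
    by (simp add: sum_distrib_left mult.commute)
  also have "(\<Sum>p\<in>?P. \<Sum>q\<in>?P. ln (real p) * ln (real q) * b p q) = (real k ^ 3 + real k ^ 2) * (\<Sum>p\<in>?P. ln (real p) / (real p)\<^sup>2)\<^sup>2"
  proof -
    have "(\<Sum>p\<in>?P. \<Sum>q\<in>?P. ln (real p) * ln (real q) * b p q) =
        (\<Sum>p\<in>?P. \<Sum>q\<in>?P. (real k ^ 3 + real k ^ 2) * (ln (real p) / (real p)\<^sup>2 * (ln (real q) / (real q)\<^sup>2)))"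
      by (intro sum.cong refl) (simp add: b_def)
    then show ?thesis unfolding sum_sum_product power2_eq_square[of "sum _ _"] .
  qed
  also have "(real k)\<^sup>2 * (\<Sum>p\<in>?P. (ln (real p))\<^sup>2 / (real p)\<^sup>2) + (real k ^ 3 + real k ^ 2) * (\<Sum>p\<in>?P. ln (real p) / (real p)\<^sup>2)\<^sup>2
     \<le> (T * z)\<^sup>2 * (6 * ln 4 * (1 + ln z) / z) + ((T * z) ^ 3 + (T * z)\<^sup>2) * (2 * ln 4 / z)\<^sup>2"
    using T z by (intro add_mono mult_mono power_mono sum_ln_sq_div_sq sum_ln_div_sq) (auto intro!: sum_nonneg divide_nonneg_nonneg add_nonneg_nonneg)
  also have "\<dots> = 6 * ln 4 * T\<^sup>2 * (z * (1 + ln z)) + 4 * (ln 4)\<^sup>2 * (T ^ 3 * z + T\<^sup>2)"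
    using z by (simp add: field_simps power2_eq_square power3_eq_cube)
  also have "\<dots> \<le> 6 * ln 4 * T\<^sup>2 * (z * (1 + ln z)) + 4 * (ln 4)\<^sup>2 * (T ^ 3 * (z * (1 + ln z)) + T\<^sup>2 * (z * (1 + ln z)))"
  proof -
    have a: "z \<le> z * (1 + ln z)" by (simp add: algebra_simps)
    moreover have "1 \<le> real z" using z by simp
    ultimately have b: "1 \<le> z * (1 + ln z)" by linarith
    have "T ^ 3 * z \<le> T ^ 3 * (z * (1 + ln z))" using T by (intro mult_left_mono a) auto
    moreover have "T\<^sup>2 * 1 \<le> T\<^sup>2 * (z * (1 + ln z))" by (intro mult_left_mono b) auto
    ultimately show ?thesis by (intro add_left_mono mult_left_mono) auto
  qed
  also have "\<dots> = (6 * ln 4 * T\<^sup>2 + 4 * (ln 4)\<^sup>2 * (T ^ 3 + T\<^sup>2)) * (z * (1 + ln z))"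
    by (simp add: algebra_simps)
  finally show "expectation (\<lambda>\<omega>. (\<Sum>p\<in>?P. ln (real p) * excess k p \<omega>)\<^sup>2) \<le> (6 * ln 4 * T\<^sup>2 + 4 * (ln 4)\<^sup>2 * (T ^ 3 + T\<^sup>2)) * (z * (1 + ln z))" by simp
  show "integrable M (\<lambda>\<omega>. (\<Sum>p\<in>?P. ln (real p) * excess k p \<omega>)\<^sup>2)"
    by (rule second_moment_weighted_sum(2)[where v = "\<lambda>p. expectation (\<lambda>\<omega>. (excess k p \<omega>)\<^sup>2)"
          and b = "\<lambda>p q. \<bar>expectation (\<lambda>\<omega>. excess k p \<omega> * excess k q \<omega>)\<bar>"])
       (auto intro: int)
qed simp

lemma borel_Ylcm: "Ylcm U k \<in> borel_measurable M"
proof -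
  have "(\<lambda>\<omega>. Lcm ((\<lambda>j. U j \<omega>) ` {1..k})) \<in> measurable M (count_space UNIV)"
  proof (induction k)
    case (Suc k)
    have "(\<lambda>j. U j \<omega>) ` {1..Suc k} = insert (U (Suc k) \<omega>) ((\<lambda>j. U j \<omega>) ` {1..k})" for \<omega>
      by (simp add: atLeastAtMostSuc_conv)
    then have "(\<lambda>\<omega>. Lcm ((\<lambda>j. U j \<omega>) ` {1..Suc k})) = (\<lambda>\<omega>. lcm (U (Suc k) \<omega>) (Lcm ((\<lambda>j. U j \<omega>) ` {1..k})))"
      by simp
    then show ?case using Suc by (simp add: measurable_compose_countable')
  qed simp
  then have "(\<lambda>\<omega>. ln (real (Lcm ((\<lambda>j. U j \<omega>) ` {1..k})))) \<in> borel_measurable M"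
    by (rule measurable_compose) simp
  then show ?thesis unfolding Ylcm_def .
qed

text \<open>For each prime the indicator of being hit, minus its mean, is \<open>- cmiss\<close>.
  For p > z this is \<open>chits - excess\<close>: the terms \<open>chits\<close> add up to the
  centred sum of g, and what remains is W - V1 - V2, with the higher prime powers in W, the misses
  of small primes in V1 and the excesses of large primes in V2.\<close>

theorem lcm_linear_approximation:
  assumes z: "1 \<le> z" "z \<le> n" and T: "0 \<le> T" "real k \<le> T * real z"
  shows "expectation (\<lambda>\<omega>. \<bar>Ylcm U k \<omega> - cn n (real k) - (\<Sum>j\<in>{1..k}. lprimes z n (U j \<omega>) - avg n (lprimes z n))\<bar>)
      \<le> C_err T * sqrt (z * (1 + ln z))" (is "expectation (\<lambda>\<omega>. \<bar>?R \<omega>\<bar>) \<le> _")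
    and "integrable M (\<lambda>\<omega>. Ylcm U k \<omega> - cn n (real k) - (\<Sum>j\<in>{1..k}. lprimes z n (U j \<omega>) - avg n (lprimes z n)))"
proof -
  define V1 where "V1 \<omega> = (\<Sum>p\<in>primes_in 0 z. ln (real p) * cmiss k p \<omega>)" for \<omega>
  define V2 where "V2 \<omega> = (\<Sum>p\<in>primes_in z n. ln (real p) * excess k p \<omega>)" for \<omega>
  define W where "W \<omega> = (\<Sum>d\<in>{1..n}. mangoldt' d * (1 - miss k d \<omega>))" for \<omega>
  have Wnn: "0 \<le> W \<omega>" for \<omega> unfolding W_def
    using miss_bounds by (intro sum_nonneg mult_nonneg_nonneg mangoldt'_nonneg) auto
  have ic: "integrable M (cmiss k p)" "integrable M (chits k p)" for p
    unfolding cmiss_def chits_def using integrable_miss integrable_hits by auto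
  have int: "integrable M V1" "integrable M V2" "integrable M W"
    unfolding V1_def V2_def W_def using integrable_miss ic by auto
  have ae: "AE \<omega> in M. ?R \<omega> = W \<omega> - V1 \<omega> - V2 \<omega>"
    using AE_Ylcm[of k]
  proof eventually_elim
    case (elim \<omega>)
    have "(\<Sum>p\<in>primes_in 0 n. ln (real p) * (1 - miss k p \<omega>)) - cn n (real k) = - (\<Sum>p\<in>primes_in 0 n. ln (real p) * cmiss k p \<omega>)"
      unfolding cn_eq sum_subtractf[symmetric] sum_negf[symmetric] cmiss_def
      by (intro sum.cong refl) (simp add: algebra_simps)
    also have "(\<Sum>p\<in>primes_in 0 n. ln (real p) * cmiss k p \<omega>) = V1 \<omega> + (\<Sum>p\<in>primes_in z n. ln (real p) * cmiss k p \<omega>)"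
      unfolding V1_def using z by (intro sum_primes_in_split) auto
    finally show ?case
      unfolding sum_lprimes_centered elim W_def[symmetric] V2_def by (simp add: distrib_left sum.distrib)
  qed
  have [measurable]: "(\<lambda>\<omega>. lprimes z n (U j \<omega>)) \<in> borel_measurable M" for j by (rule borel_U)
  have [measurable]: "Ylcm U k \<in> borel_measurable M" by (rule borel_Ylcm)
  have mR: "?R \<in> borel_measurable M" by measurable
  show intR: "integrable M ?R"
    by (rule integrable_cong_AE_imp[OF _ mR, of "\<lambda>\<omega>. W \<omega> - V1 \<omega> - V2 \<omega>"]) (use int ae in auto)
  have "expectation (\<lambda>\<omega>. \<bar>?R \<omega>\<bar>) \<le> expectation (\<lambda>\<omega>. \<bar>V1 \<omega>\<bar> + \<bar>V2 \<omega>\<bar> + W \<omega>)"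
  proof (rule integral_mono_AE)
    show "AE \<omega> in M. \<bar>?R \<omega>\<bar> \<le> \<bar>V1 \<omega>\<bar> + \<bar>V2 \<omega>\<bar> + W \<omega>"
      using ae
    proof eventually_elim
      case (elim \<omega>)
      show ?case unfolding elim using Wnn[of \<omega>] by linarith
    qed
  qed (use int intR in auto)
  also have "\<dots> = expectation (\<lambda>\<omega>. \<bar>V1 \<omega>\<bar>) + expectation (\<lambda>\<omega>. \<bar>V2 \<omega>\<bar>) + expectation W"
    using int by simp
  also have "\<dots> \<le> sqrt ((ln 4 + 2 * T * ln 4 * (1 + ln 4)) * (z * (1 + ln z))) +
      sqrt ((6 * ln 4 * T\<^sup>2 + 4 * (ln 4)\<^sup>2 * (T ^ 3 + T\<^sup>2)) * (z * (1 + ln z))) + (1 + T) * C_pow * sqrt z"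
    unfolding V1_def V2_def W_def using assms
    by (intro add_mono small_primes_fluctuation large_primes_fluctuation expectation_higher_powers_le)
  also have "\<dots> \<le> C_err T * sqrt (z * (1 + ln z))"
  proof -
    define Z where "Z = z * (1 + ln z)"
    have "sqrt z \<le> sqrt Z" by (simp add: Z_def algebra_simps)
    then have "(1 + T) * C_pow * sqrt z \<le> (1 + T) * C_pow * sqrt Z"
      using C_pow_pos T by (intro mult_left_mono) auto
    then show ?thesis
      unfolding C_err_def Z_def[symmetric] distrib_right[of _ _ "sqrt Z"] real_sqrt_mult[of _ Z] by linarith
  qed
  finally show "expectation (\<lambda>\<omega>. \<bar>?R \<omega>\<bar>) \<le> C_err T * sqrt (z * (1 + ln z))" .
qed

end

section \<open>Central limit theorem and finite-dimensional convergence\<close>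

lemma abs_exp_minus_one_le: "0 \<le> u \<Longrightarrow> u \<le> 1 \<Longrightarrow> \<bar>1 - u - exp (- u)\<bar> \<le> u\<^sup>2" for u :: real
proof -
  assume u: "0 \<le> u" "u \<le> 1"
  \<comment> \<open>The product equals 1 + u^3.\<close>
  have "1 \<le> (1 + u) * (1 - u + u\<^sup>2)" using u by (simp add: algebra_simps power2_eq_square)
  also have "\<dots> \<le> exp u * (1 - u + u\<^sup>2)" using u by (intro mult_right_mono) auto
  finally have "exp (- u) \<le> 1 - u + u\<^sup>2" by (simp add: exp_minus field_simps)
  moreover have "1 - u \<le> exp (- u)" using exp_ge_add_one_self[of "- u"] by simp
  ultimately show ?thesis by simp
qed

text \<open>Products of numbers in the unit disc differ by at most the sum of the factorwise
  differences. Each characteristic function is within |t|^3 b / 6 of 1 - u by Taylor's formula, and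
  1 - u is within u^2 of exp (-u).\<close>

lemma (in prob_space) char_sum_triangular_bound:
  fixes X :: "'i \<Rightarrow> 'a \<Rightarrow> real" and t v b u :: real
  assumes indep: "indep_vars (\<lambda>_. borel) X J" and J: "finite J"
    and int: "\<And>j. j \<in> J \<Longrightarrow> integrable M (X j)" "\<And>j. j \<in> J \<Longrightarrow> integrable M (\<lambda>\<omega>. (X j \<omega>)\<^sup>2)"
      "\<And>j. j \<in> J \<Longrightarrow> integrable M (\<lambda>\<omega>. \<bar>X j \<omega>\<bar> ^ 3)"
    and mean: "\<And>j. j \<in> J \<Longrightarrow> expectation (X j) = 0"
    and var: "\<And>j. j \<in> J \<Longrightarrow> expectation (\<lambda>\<omega>. (X j \<omega>)\<^sup>2) = v"
    and third: "\<And>j. j \<in> J \<Longrightarrow> expectation (\<lambda>\<omega>. \<bar>X j \<omega>\<bar> ^ 3) \<le> b"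
    and u: "u = t\<^sup>2 * v / 2" "0 \<le> u" "u \<le> 1"
  shows "cmod (char (distr M borel (\<lambda>\<omega>. \<Sum>j\<in>J. X j \<omega>)) t - complex_of_real (exp (- (card J * u)))) \<le> card J * (\<bar>t\<bar> ^ 3 * b / 6 + u\<^sup>2)"
proof -
  have rv: "random_variable borel (X j)" if "j \<in> J" for j using indep that by (auto simp: indep_vars_def)
  have "char (distr M borel (\<lambda>\<omega>. \<Sum>j\<in>J. X j \<omega>)) t = (\<Prod>j\<in>J. char (distr M borel (X j)) t)"
    by (rule char_distr_sum[OF indep])
  moreover have "complex_of_real (exp (- (card J * u))) = (\<Prod>j\<in>J. complex_of_real (exp (- u)))"
    by (simp add: exp_of_nat_mult[symmetric] flip: of_real_power)
  ultimately have "cmod (char (distr M borel (\<lambda>\<omega>. \<Sum>j\<in>J. X j \<omega>)) t - complex_of_real (exp (- (card J * u))))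
    = cmod ((\<Prod>j\<in>J. char (distr M borel (X j)) t) - (\<Prod>j\<in>J. complex_of_real (exp (- u))))" by simp
  also have "\<dots> \<le> (\<Sum>j\<in>J. cmod (char (distr M borel (X j)) t - complex_of_real (exp (- u))))"
  proof (rule norm_prod_diff)
    fix j assume "j \<in> J"
    then show "cmod (char (distr M borel (X j)) t) \<le> 1"
      by (intro real_distribution.cmod_char_le_1 real_distribution_distr rv)
    show "cmod (complex_of_real (exp (- u))) \<le> 1" using u by simp
  qed
  also have "\<dots> \<le> (\<Sum>j\<in>J. \<bar>t\<bar> ^ 3 * b / 6 + u\<^sup>2)"
  proof (rule sum_mono)
    fix j assume j: "j \<in> J"
    have "cmod (char (distr M borel (X j)) t - (1 - t\<^sup>2 * v / 2)) \<le> (t\<^sup>2 / 6) * expectation (\<lambda>x. min (6 * (X j x)\<^sup>2) (\<bar>t\<bar> * \<bar>X j x\<bar> ^ 3))"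
      by (rule char_approx3') (use j rv int mean var in auto)
    also have "expectation (\<lambda>x. min (6 * (X j x)\<^sup>2) (\<bar>t\<bar> * \<bar>X j x\<bar> ^ 3)) \<le> expectation (\<lambda>x. \<bar>t\<bar> * \<bar>X j x\<bar> ^ 3)"
      using j int by (intro integral_mono integrable_min) auto
    also have "\<dots> \<le> \<bar>t\<bar> * b" using j third by (simp add: mult_left_mono)
    also have "(t\<^sup>2 / 6) * (\<bar>t\<bar> * b) = \<bar>t\<bar> ^ 3 * b / 6" by (simp add: power3_eq_cube power2_eq_square)
    finally have 1: "cmod (char (distr M borel (X j)) t - complex_of_real (1 - u)) \<le> \<bar>t\<bar> ^ 3 * b / 6"
      unfolding u(1) by (simp add: mult_left_mono)
    have "cmod (complex_of_real (1 - u) - complex_of_real (exp (- u))) = \<bar>1 - u - exp (- u)\<bar>"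
      by (metis norm_of_real of_real_diff real_norm_def)
    then have 2: "cmod (complex_of_real (1 - u) - complex_of_real (exp (- u))) \<le> u\<^sup>2" using abs_exp_minus_one_le[OF u(2,3)] by simp
    show "cmod (char (distr M borel (X j)) t - complex_of_real (exp (- u))) \<le> \<bar>t\<bar> ^ 3 * b / 6 + u\<^sup>2"
      using norm_triangle_ineq[of "char (distr M borel (X j)) t - complex_of_real (1 - u)" "complex_of_real (1 - u) - complex_of_real (exp (- u))"] 1 2 by (simp del: of_real_diff)
  qed
  finally show ?thesis by simp
qed

text \<open>Levy's theorem with exp (-K u) as intermediate value, where K is the row length and u =
  t^2 v / (2 s^2). The error K (|t|^3 b / (6 |s|^3) + u^2) vanishes because K u converges and u
  tends to 0. The limit \<nu> is given by its characteristic function, so that the law of a Brownian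
  increment can be supplied directly.\<close>

lemma triangular_central_limit:
  fixes M :: "nat \<Rightarrow> 'a measure" and X :: "nat \<Rightarrow> nat \<Rightarrow> 'a \<Rightarrow> real" and J :: "nat \<Rightarrow> nat set"
  assumes prob: "\<And>n. prob_space (M n)"
    and indep: "\<And>n. prob_space.indep_vars (M n) (\<lambda>_. borel) (X n) (J n)" and J: "\<And>n. finite (J n)"
    and int: "\<And>n j. integrable (M n) (X n j)" "\<And>n j. integrable (M n) (\<lambda>\<omega>. (X n j \<omega>)\<^sup>2)"
      "\<And>n j. integrable (M n) (\<lambda>\<omega>. \<bar>X n j \<omega>\<bar> ^ 3)"
    and mean: "\<And>n j. integral\<^sup>L (M n) (X n j) = 0"
    and var: "\<And>n j. integral\<^sup>L (M n) (\<lambda>\<omega>. (X n j \<omega>)\<^sup>2) = v n"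
    and third: "\<And>n j. integral\<^sup>L (M n) (\<lambda>\<omega>. \<bar>X n j \<omega>\<bar> ^ 3) \<le> b n"
    and lim_var: "(\<lambda>n. card (J n) * (v n / (s n)\<^sup>2)) \<longlonglongrightarrow> \<tau>"
    and lim_negl: "(\<lambda>n. v n / (s n)\<^sup>2) \<longlonglongrightarrow> 0"
    and lim_third: "(\<lambda>n. card (J n) * (b n / \<bar>s n\<bar> ^ 3)) \<longlonglongrightarrow> 0"
    and \<nu>: "real_distribution \<nu>" "\<And>t. char \<nu> t = complex_of_real (exp (- (\<tau> * t\<^sup>2 / 2)))"
  shows "weak_conv_m (\<lambda>n. distr (M n) borel (\<lambda>\<omega>. (\<Sum>j\<in>J n. X n j \<omega>) / s n)) \<nu>"
proof (rule levy_continuity)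
  have rv: "(\<lambda>\<omega>. (\<Sum>j\<in>J n. X n j \<omega>) / s n) \<in> borel_measurable (M n)" for n
    using int(1) by (intro borel_measurable_divide borel_measurable_sum borel_measurable_integrable) auto
  show "real_distribution (distr (M n) borel (\<lambda>\<omega>. (\<Sum>j\<in>J n. X n j \<omega>) / s n))" for n
    by (intro prob_space.real_distribution_distr prob rv)
  show "real_distribution \<nu>" by fact
  fix t :: real
  define u where "u n = t\<^sup>2 * (v n / (s n)\<^sup>2) / 2" for n
  have v0: "0 \<le> v n" for n unfolding var[of n 0, symmetric] by (intro integral_nonneg_AE) auto
  have u0: "0 \<le> u n" for n using v0 by (simp add: u_def)
  have limu: "u \<longlonglongrightarrow> 0" unfolding u_def using tendsto_mult_left[OF lim_negl, of "t\<^sup>2 / 2"] by (simp add: mult_ac)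
  have limKu: "(\<lambda>n. card (J n) * u n) \<longlonglongrightarrow> \<tau> * t\<^sup>2 / 2"
    unfolding u_def using tendsto_mult_left[OF lim_var, of "t\<^sup>2 / 2"] by (simp add: mult_ac)
  have "eventually (\<lambda>n. u n < 1) sequentially" using limu by (rule order_tendstoD) simp
  then have ev: "eventually (\<lambda>n. norm (char (distr (M n) borel (\<lambda>\<omega>. (\<Sum>j\<in>J n. X n j \<omega>) / s n)) t - complex_of_real (exp (- (card (J n) * u n))))
     \<le> card (J n) * (\<bar>t\<bar> ^ 3 * (b n / \<bar>s n\<bar> ^ 3) / 6 + (u n)\<^sup>2)) sequentially"
  proof eventually_elim
    case (elim n)
    interpret prob_space "M n" by (rule prob)
    have *: "(\<lambda>\<omega>. (\<Sum>j\<in>J n. X n j \<omega>) / s n) = (\<lambda>\<omega>. \<Sum>j\<in>J n. X n j \<omega> / s n)"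
      by (simp add: sum_divide_distrib)
    have e2: "(X n j \<omega> / s n)\<^sup>2 = (X n j \<omega>)\<^sup>2 / (s n)\<^sup>2" "\<bar>X n j \<omega> / s n\<bar> ^ 3 = \<bar>X n j \<omega>\<bar> ^ 3 / \<bar>s n\<bar> ^ 3" for j \<omega>
      by (simp_all add: power_divide abs_divide)
    show ?case
      unfolding *
    proof (rule char_sum_triangular_bound[OF _ J])
      show "indep_vars (\<lambda>_. borel) (\<lambda>j \<omega>. X n j \<omega> / s n) (J n)"
        by (rule indep_vars_compose2[OF indep]) simp
      show "expectation (\<lambda>\<omega>. \<bar>X n j \<omega> / s n\<bar> ^ 3) \<le> b n / \<bar>s n\<bar> ^ 3" for j
        unfolding e2 using third[of n j] by (simp add: divide_right_mono)
      show "expectation (\<lambda>\<omega>. (X n j \<omega> / s n)\<^sup>2) = v n / (s n)\<^sup>2" for j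
        unfolding e2 using var[of n j] by simp
      show "integrable (M n) (\<lambda>\<omega>. (X n j \<omega> / s n)\<^sup>2)" "integrable (M n) (\<lambda>\<omega>. \<bar>X n j \<omega> / s n\<bar> ^ 3)"
        "integrable (M n) (\<lambda>\<omega>. X n j \<omega> / s n)" for j
        unfolding e2 using int by auto
      show "expectation (\<lambda>\<omega>. X n j \<omega> / s n) = 0" for j using mean[of n j] by simp
    qed (use elim u0 in \<open>auto simp: u_def\<close>)
  qed
  have "(\<lambda>n. \<bar>t\<bar> ^ 3 / 6 * (card (J n) * (b n / \<bar>s n\<bar> ^ 3)) + (card (J n) * u n) * u n) \<longlonglongrightarrow> \<bar>t\<bar> ^ 3 / 6 * 0 + (\<tau> * t\<^sup>2 / 2) * 0"
    by (intro tendsto_intros lim_third limKu limu)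
  also have "(\<lambda>n. \<bar>t\<bar> ^ 3 / 6 * (card (J n) * (b n / \<bar>s n\<bar> ^ 3)) + (card (J n) * u n) * u n) =
     (\<lambda>n. card (J n) * (\<bar>t\<bar> ^ 3 * (b n / \<bar>s n\<bar> ^ 3) / 6 + (u n)\<^sup>2))"
    by (rule ext) (simp add: distrib_left power2_eq_square mult_ac)
  finally have lim0: "(\<lambda>n. card (J n) * (\<bar>t\<bar> ^ 3 * (b n / \<bar>s n\<bar> ^ 3) / 6 + (u n)\<^sup>2)) \<longlonglongrightarrow> 0" by simp
  have d: "(\<lambda>n. char (distr (M n) borel (\<lambda>\<omega>. (\<Sum>j\<in>J n. X n j \<omega>) / s n)) t - complex_of_real (exp (- (card (J n) * u n)))) \<longlonglongrightarrow> 0"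
    by (rule Lim_null_comparison[OF ev lim0])
  have "(\<lambda>n. complex_of_real (exp (- (card (J n) * u n)))) \<longlonglongrightarrow> complex_of_real (exp (- (\<tau> * t\<^sup>2 / 2)))"
    by (intro tendsto_intros limKu)
  from tendsto_add[OF d this]
  show "(\<lambda>n. char (distr (M n) borel (\<lambda>\<omega>. (\<Sum>j\<in>J n. X n j \<omega>) / s n)) t) \<longlonglongrightarrow> char \<nu> t"
    by (simp add: \<nu>(2))
qed

text \<open>Division by sqrt \<tau> reduces the claim to the standard normal law.\<close>

lemma char_normal_increment:
  assumes "prob_space N" "distributed N lborel X (normal_density 0 (sqrt \<tau>))" "0 < \<tau>"
  shows "real_distribution (distr N borel X)" "char (distr N borel X) t = complex_of_real (exp (- (\<tau> * t\<^sup>2 / 2)))"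
proof -
  interpret prob_space N by fact
  have [measurable]: "X \<in> borel_measurable N" using assms(2) by (auto simp: distributed_def)
  show "real_distribution (distr N borel X)" by (rule real_distribution_distr) simp
  have "distributed N lborel (\<lambda>x. (X x - 0) / sqrt \<tau>) std_normal_density"
    using normal_standard_normal_convert[of "sqrt \<tau>" X 0] assms by simp
  then have "distr N lborel (\<lambda>x. X x / sqrt \<tau>) = std_normal_distribution"
    by (simp add: distributed_def)
  moreover have "distr N lborel (\<lambda>x. X x / sqrt \<tau>) = distr N borel (\<lambda>x. X x / sqrt \<tau>)"
    by (rule distr_cong) auto
  ultimately have std: "distr N borel (\<lambda>x. X x / sqrt \<tau>) = std_normal_distribution" by simp
  have "char (distr N borel X) t = char (distr N borel (\<lambda>x. X x / sqrt \<tau>)) (t * sqrt \<tau>)"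
    using assms(3) by (simp add: char_def integral_distr)
  also have "\<dots> = complex_of_real (exp (- ((t * sqrt \<tau>)\<^sup>2) / 2))" unfolding std by (simp add: char_std_normal_distribution)
  finally show "char (distr N borel X) t = complex_of_real (exp (- (\<tau> * t\<^sup>2 / 2)))"
    using assms(3) by (simp add: power_mult_distrib mult.commute)
qed

section \<open>Joint convergence of independent families\<close>

lemma indep_vars_coordinates:
  assumes "\<And>i. i \<in> I \<Longrightarrow> prob_space (\<Omega> i)" "I \<noteq> {}"
  shows "prob_space.indep_vars (Pi\<^sub>M I \<Omega>) \<Omega> (\<lambda>i x. x i) I"
proof -
  interpret prob_space "Pi\<^sub>M I \<Omega>" by (rule prob_space_PiM) (rule assms)
  have "distr (Pi\<^sub>M I \<Omega>) (Pi\<^sub>M I \<Omega>) (\<lambda>x. \<lambda>i\<in>I. x i) = distr (Pi\<^sub>M I \<Omega>) (Pi\<^sub>M I \<Omega>) (\<lambda>x. x)"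
    by (rule distr_cong) (auto simp: space_PiM)
  moreover have "Pi\<^sub>M I (\<lambda>i. distr (Pi\<^sub>M I \<Omega>) (\<Omega> i) (\<lambda>x. x i)) = Pi\<^sub>M I \<Omega>"
    by (rule PiM_cong) (use assms in \<open>auto simp: distr_PiM_component\<close>)
  ultimately show ?thesis
    by (subst indep_vars_iff_distr_eq_PiM') (use assms in auto)
qed

text \<open>Under independence the marginals determine the joint law, as a product measure.\<close>

lemma indep_vars_distr_cong:
  assumes "prob_space M" "prob_space M'" "I \<noteq> {}"
    and "prob_space.indep_vars M (\<lambda>_. borel) X I" "prob_space.indep_vars M' (\<lambda>_. borel) X' I"
    and "\<And>i. i \<in> I \<Longrightarrow> distr M borel (X i) = distr M' borel (X' i)"
  shows "distr M (Pi\<^sub>M I (\<lambda>_. borel)) (\<lambda>\<omega>. \<lambda>i\<in>I. X i \<omega>) = distr M' (Pi\<^sub>M I (\<lambda>_. borel)) (\<lambda>\<omega>. \<lambda>i\<in>I. X' i \<omega>)"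
proof -
  interpret M: prob_space M by fact
  interpret M': prob_space M' by fact
  have rv: "X i \<in> borel_measurable M" "X' i \<in> borel_measurable M'" if "i \<in> I" for i
    using assms(4,5) that by (auto simp: M.indep_vars_def M'.indep_vars_def)
  have "Pi\<^sub>M I (\<lambda>i. distr M borel (X i)) = Pi\<^sub>M I (\<lambda>i. distr M' borel (X' i))"
    by (rule PiM_cong) (use assms in auto)
  then show ?thesis
    using M.indep_vars_iff_distr_eq_PiM'[of I X "\<lambda>_. borel"] M'.indep_vars_iff_distr_eq_PiM'[of I X' "\<lambda>_. borel"] assms rv by simp
qed

text \<open>Independence lets the one-dimensional Skorokhod couplings be put side by side on a product space.\<close>
lemma joint_convergence_of_independent:
  fixes D :: "nat \<Rightarrow> 'i \<Rightarrow> 'a \<Rightarrow> real" and \<Delta> :: "'i \<Rightarrow> 'b \<Rightarrow> real" and G :: "('i \<Rightarrow> real) \<Rightarrow> real"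
  assumes prob: "\<And>n. prob_space (M n)" "prob_space N" and I: "finite I" "I \<noteq> {}"
    and indD: "\<And>n. prob_space.indep_vars (M n) (\<lambda>_. borel) (D n) I"
    and ind\<Delta>: "prob_space.indep_vars N (\<lambda>_. borel) \<Delta> I"
    and wc: "\<And>i. i \<in> I \<Longrightarrow> weak_conv_m (\<lambda>n. distr (M n) borel (D n i)) (distr N borel (\<Delta> i))"
    and G: "G \<in> borel_measurable (Pi\<^sub>M I (\<lambda>_. borel))" "\<And>x. \<bar>G x\<bar> \<le> C"
    and Gcont: "\<And>x y. (\<And>i. i \<in> I \<Longrightarrow> (\<lambda>n. x n i) \<longlonglongrightarrow> y i) \<Longrightarrow> (\<lambda>n. G (x n)) \<longlonglongrightarrow> G y"
  shows "(\<lambda>n. integral\<^sup>L (M n) (\<lambda>\<omega>. G (\<lambda>i\<in>I. D n i \<omega>))) \<longlonglongrightarrow> integral\<^sup>L N (\<lambda>\<omega>. G (\<lambda>i\<in>I. \<Delta> i \<omega>))"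
proof -
  have rvD: "D n i \<in> borel_measurable (M n)" if "i \<in> I" for n i
    using indD[of n] that by (auto simp: prob_space.indep_vars_def[OF prob(1)])
  have rv\<Delta>: "\<Delta> i \<in> borel_measurable N" if "i \<in> I" for i
    using ind\<Delta> that by (auto simp: prob_space.indep_vars_def[OF prob(2)])
  have "\<exists>\<Omega> Ys Y. prob_space (\<Omega> :: real measure) \<and> (\<forall>n. Ys n \<in> borel_measurable \<Omega>) \<and> (\<forall>n. distr \<Omega> borel (Ys n) = distr (M n) borel (D n i))
      \<and> Y \<in> borel_measurable \<Omega> \<and> distr \<Omega> borel Y = distr N borel (\<Delta> i) \<and> (\<forall>x\<in>space \<Omega>. (\<lambda>n. Ys n x) \<longlonglongrightarrow> Y x)" if "i \<in> I" for i
    using Skorohod[OF _ _ wc[OF that]] prob_space.real_distribution_distr[OF prob(1) rvD[OF that]]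
      prob_space.real_distribution_distr[OF prob(2) rv\<Delta>[OF that]] by simp
  then obtain \<Omega> Ys Y where *: "\<And>i. i \<in> I \<Longrightarrow> prob_space (\<Omega> i :: real measure) \<and> (\<forall>n. Ys i n \<in> borel_measurable (\<Omega> i)) \<and> (\<forall>n. distr (\<Omega> i) borel (Ys i n) = distr (M n) borel (D n i))
      \<and> Y i \<in> borel_measurable (\<Omega> i) \<and> distr (\<Omega> i) borel (Y i) = distr N borel (\<Delta> i) \<and> (\<forall>x\<in>space (\<Omega> i). (\<lambda>n. Ys i n x) \<longlonglongrightarrow> Y i x)"
    by metis
  define P where "P = Pi\<^sub>M I \<Omega>"
  interpret P: prob_space P unfolding P_def by (rule prob_space_PiM) (use * in auto)
  have ind: "P.indep_vars \<Omega> (\<lambda>i x. x i) I" unfolding P_def by (rule indep_vars_coordinates) (use * I in auto)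
  have comp: "distr P borel (\<lambda>x. f (x i)) = distr (\<Omega> i) borel f" if "i \<in> I" "f \<in> borel_measurable (\<Omega> i)" for i and f :: "real \<Rightarrow> real"
  proof -
    have "distr P (\<Omega> i) (\<lambda>x. x i) = \<Omega> i" unfolding P_def by (rule distr_PiM_component) (use that * in auto)
    moreover have "(\<lambda>x. x i) \<in> measurable P (\<Omega> i)" unfolding P_def using that by simp
    ultimately show ?thesis using distr_distr[OF that(2), of "\<lambda>x. x i" P] by (simp add: comp_def)
  qed
  \<comment> \<open>On the product space the copies are independent with the right marginals, so
    they have the joint law of the original family and expectations of G carry over.\<close>
  have tr: "integral\<^sup>L P (\<lambda>x. G (\<lambda>i\<in>I. f i (x i))) = integral\<^sup>L M' (\<lambda>\<omega>. G (\<lambda>i\<in>I. X i \<omega>))"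
    if "prob_space M'" "prob_space.indep_vars M' (\<lambda>_. borel) X I" "\<And>i. i \<in> I \<Longrightarrow> f i \<in> borel_measurable (\<Omega> i)"
      "\<And>i. i \<in> I \<Longrightarrow> distr (\<Omega> i) borel (f i) = distr M' borel (X i)"
    for M' :: "'c measure" and X and f :: "'i \<Rightarrow> real \<Rightarrow> real"
  proof -
    interpret M': prob_space M' by fact
    have "P.indep_vars (\<lambda>_. borel) (\<lambda>i x. f i (x i)) I"
      by (rule P.indep_vars_compose2[OF ind]) (use that in auto)
    then have d: "distr P (Pi\<^sub>M I (\<lambda>_. borel)) (\<lambda>x. \<lambda>i\<in>I. f i (x i)) = distr M' (Pi\<^sub>M I (\<lambda>_. borel)) (\<lambda>\<omega>. \<lambda>i\<in>I. X i \<omega>)"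
      by (intro indep_vars_distr_cong P.prob_space_axioms that I) (use that comp in auto)
    have m1: "(\<lambda>x. \<lambda>i\<in>I. f i (x i)) \<in> measurable P (Pi\<^sub>M I (\<lambda>_. borel))"
      unfolding P_def by (intro measurable_restrict measurable_compose[OF measurable_component_singleton]) (use that in auto)
    have m2: "(\<lambda>\<omega>. \<lambda>i\<in>I. X i \<omega>) \<in> measurable M' (Pi\<^sub>M I (\<lambda>_. borel))"
      by (intro measurable_restrict) (use that(2) in \<open>auto simp: M'.indep_vars_def\<close>)
    show ?thesis
      using integral_distr[OF m1 G(1)] integral_distr[OF m2 G(1)] unfolding d by simp
  qed
  have meas: "(\<lambda>x. G (\<lambda>i\<in>I. f i (x i))) \<in> borel_measurable P" if "\<And>i. i \<in> I \<Longrightarrow> f i \<in> borel_measurable (\<Omega> i)" for f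
    unfolding P_def
    by (rule measurable_compose[OF _ G(1)], intro measurable_restrict measurable_compose[OF measurable_component_singleton]) (use that in auto)
  have "(\<lambda>n. integral\<^sup>L P (\<lambda>x. G (\<lambda>i\<in>I. Ys i n (x i)))) \<longlonglongrightarrow> integral\<^sup>L P (\<lambda>x. G (\<lambda>i\<in>I. Y i (x i)))"
  proof (rule integral_dominated_convergence[where w = "\<lambda>_. C"])
    show "AE x in P. (\<lambda>n. G (\<lambda>i\<in>I. Ys i n (x i))) \<longlonglongrightarrow> G (\<lambda>i\<in>I. Y i (x i))"
      by (rule AE_I2, rule Gcont) (use * in \<open>auto simp: P_def space_PiM PiE_iff\<close>)
  qed (use * G(2) in \<open>auto intro!: meas\<close>)
  also have "integral\<^sup>L P (\<lambda>x. G (\<lambda>i\<in>I. Y i (x i))) = integral\<^sup>L N (\<lambda>\<omega>. G (\<lambda>i\<in>I. \<Delta> i \<omega>))"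
    by (rule tr[OF prob(2) ind\<Delta>]) (use * in auto)
  also have "(\<lambda>n. integral\<^sup>L P (\<lambda>x. G (\<lambda>i\<in>I. Ys i n (x i)))) = (\<lambda>n. integral\<^sup>L (M n) (\<lambda>\<omega>. G (\<lambda>i\<in>I. D n i \<omega>)))"
    by (rule ext, rule tr[OF prob(1) indD]) (use * in auto)
  finally show ?thesis .
qed

section \<open>Slutsky's theorem for random vectors\<close>

lemma tail_expectation_small:
  fixes Z :: "'b \<Rightarrow> 'v::euclidean_space"
  assumes "prob_space N" and [measurable]: "Z \<in> borel_measurable N" and "0 < \<epsilon>"
  shows "\<exists>R\<ge>0. integral\<^sup>L N (\<lambda>\<omega>. min 1 (max 0 (norm (Z \<omega>) - R))) < \<epsilon>"
proof -
  interpret prob_space N by fact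
  have "(\<lambda>R::nat. integral\<^sup>L N (\<lambda>\<omega>. min 1 (max 0 (norm (Z \<omega>) - real R)))) \<longlonglongrightarrow> integral\<^sup>L N (\<lambda>\<omega>. 0)"
  proof (rule integral_dominated_convergence[where w = "\<lambda>_. 1"])
    show "AE \<omega> in N. (\<lambda>R. min 1 (max 0 (norm (Z \<omega>) - real R))) \<longlonglongrightarrow> 0"
    proof (rule AE_I2)
      fix \<omega>
      have "eventually (\<lambda>R::nat. min 1 (max 0 (norm (Z \<omega>) - real R)) = 0) sequentially"
        using eventually_ge_at_top[of "nat \<lceil>norm (Z \<omega>)\<rceil>"] by eventually_elim (auto simp: max_def)
      then show "(\<lambda>R. min 1 (max 0 (norm (Z \<omega>) - real R))) \<longlonglongrightarrow> 0" by (rule tendsto_eventually)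
    qed
  qed auto
  then have "eventually (\<lambda>R::nat. integral\<^sup>L N (\<lambda>\<omega>. min 1 (max 0 (norm (Z \<omega>) - real R))) < \<epsilon>) sequentially"
    using \<open>0 < \<epsilon>\<close> by (intro order_tendstoD) auto
  then obtain R :: nat where "integral\<^sup>L N (\<lambda>\<omega>. min 1 (max 0 (norm (Z \<omega>) - real R))) < \<epsilon>"
    by (auto simp: eventually_sequentially)
  then show ?thesis by (intro exI[of _ "real R"]) auto
qed

text \<open>Tightness of \<open>W n\<close> is read off from the convergence of the expectations of
  the cut-off functions \<open>min 1 (max 0 (norm w - R))\<close>.\<close>
lemma conv_distr_vec_add_negligible:
  fixes W E :: "nat \<Rightarrow> 'a \<Rightarrow> real^'k::finite" and Z :: "'b \<Rightarrow> real^'k"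
  assumes prob: "\<And>n. prob_space (M n)" "prob_space N"
    and meas: "\<And>n. W n \<in> borel_measurable (M n)" "Z \<in> borel_measurable N" "\<And>n. E n \<in> borel_measurable (M n)"
    and intE: "\<And>n. integrable (M n) (\<lambda>\<omega>. norm (E n \<omega>))"
    and E0: "(\<lambda>n. integral\<^sup>L (M n) (\<lambda>\<omega>. norm (E n \<omega>))) \<longlonglongrightarrow> 0"
    and conv: "conv_distr_vec M W N Z"
  shows "conv_distr_vec M (\<lambda>n \<omega>. W n \<omega> + E n \<omega>) N Z"
  unfolding conv_distr_vec_def
proof (intro allI impI)
  fix f :: "real^'k \<Rightarrow> real"
  assume f: "continuous_on UNIV f \<and> bounded (range f)"
  then obtain F where F: "0 < F" "\<And>x. \<bar>f x\<bar> \<le> F" by (auto simp: bounded_pos)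
  have fm [measurable]: "f \<in> borel_measurable borel" using f by (intro borel_measurable_continuous_onI) auto
  note meas [measurable]
  have If: "integrable (M n) (\<lambda>\<omega>. f (Y \<omega>))" if [measurable]: "Y \<in> borel_measurable (M n)" for n Y
  proof -
    interpret prob_space "M n" by (rule prob)
    show ?thesis by (rule integrable_const_bound[where B = F]) (auto simp: F)
  qed
  have "(\<lambda>n. integral\<^sup>L (M n) (\<lambda>\<omega>. f (W n \<omega> + E n \<omega>)) - integral\<^sup>L (M n) (\<lambda>\<omega>. f (W n \<omega>))) \<longlonglongrightarrow> 0"
  proof (rule LIMSEQ_I)
    fix r :: real assume "0 < r"
    \<comment> \<open>The estimates below add up to \<epsilon> + 2 F \<epsilon> + \<epsilon>, which
      is at most (2 + 4 F) \<epsilon>.\<close>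
    define \<epsilon> where "\<epsilon> = r / (2 + 4 * F)"
    have \<epsilon>: "0 < \<epsilon>" using \<open>0 < r\<close> F by (simp add: \<epsilon>_def)
    obtain R where R: "0 \<le> R" "integral\<^sup>L N (\<lambda>\<omega>. min 1 (max 0 (norm (Z \<omega>) - R))) < \<epsilon>"
      using tail_expectation_small[OF prob(2) meas(2) \<epsilon>] by auto
    define h where "h x = min 1 (max 0 (norm x - R))" for x :: "real^'k"
    have h: "0 \<le> h x" "h x \<le> 1" "R + 1 \<le> norm x \<Longrightarrow> h x = 1" for x by (auto simp: h_def)
    have hc: "continuous_on UNIV h" unfolding h_def by (intro continuous_intros)
    have [measurable]: "h \<in> borel_measurable borel" using hc by (rule borel_measurable_continuous_onI)
    have "bounded (range h)" using h by (auto intro!: boundedI[where B = 1] simp: abs_le_iff)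
    then have "(\<lambda>n. integral\<^sup>L (M n) (\<lambda>\<omega>. h (W n \<omega>))) \<longlonglongrightarrow> integral\<^sup>L N (\<lambda>\<omega>. h (Z \<omega>))"
      using conv hc unfolding conv_distr_vec_def by blast
    then have ev1: "eventually (\<lambda>n. integral\<^sup>L (M n) (\<lambda>\<omega>. h (W n \<omega>)) < \<epsilon>) sequentially"
      using R(2) unfolding h_def[symmetric] by (rule order_tendstoD)
    \<comment> \<open>The radius R + 2 holds both x and x + e when norm x < R + 1 and norm e <
      \<delta> \<le> 1.\<close>
    have "uniformly_continuous_on (cball 0 (R + 2)) f"
      using f by (intro compact_uniformly_continuous) (auto intro: continuous_on_subset)
    then obtain \<delta>' where \<delta>': "0 < \<delta>'" "\<And>x y. x \<in> cball 0 (R + 2) \<Longrightarrow> y \<in> cball 0 (R + 2) \<Longrightarrow> dist y x < \<delta>' \<Longrightarrow> dist (f y) (f x) < \<epsilon>"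
      using \<epsilon> unfolding uniformly_continuous_on_def by metis
    define \<delta> where "\<delta> = min \<delta>' 1"
    have \<delta>: "0 < \<delta>" "\<delta> \<le> 1" "\<delta> \<le> \<delta>'" using \<delta>' by (auto simp: \<delta>_def)
    \<comment> \<open>Far from the origin \<open>h x = 1\<close> and the second term pays for the
      trivial bound 2 F; for norm e \<ge> \<delta> the third term does; otherwise uniform continuity
      on the ball gives \<epsilon>.\<close>
    have pt: "\<bar>f (x + e) - f x\<bar> \<le> \<epsilon> + 2 * F * h x + 2 * F / \<delta> * norm e" for x e
    proof -
      have nn: "0 \<le> 2 * F * h x" "0 \<le> 2 * F / \<delta> * norm e" using F h \<delta> by auto
      have le: "\<bar>f (x + e) - f x\<bar> \<le> 2 * F" using F(2)[of "x + e"] F(2)[of x] by linarith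
      consider "R + 1 \<le> norm x" | "\<delta> \<le> norm e" | "norm x < R + 1" "norm e < \<delta>" by linarith
      then show ?thesis
      proof cases
        case 1
        then show ?thesis using le h(3)[of x] nn \<epsilon> by simp
      next
        case 2
        then have "2 * F * 1 \<le> 2 * F * (norm e / \<delta>)" using F \<delta> by (intro mult_left_mono) auto
        then show ?thesis using le nn \<epsilon> by simp
      next
        case 3
        have "norm (x + e) \<le> R + 2" using norm_triangle_ineq[of x e] 3 \<delta> by linarith
        then have "x \<in> cball 0 (R + 2)" "x + e \<in> cball 0 (R + 2)" using 3 by auto
        moreover have "dist (x + e) x < \<delta>'" using 3 \<delta> by (simp add: dist_norm)
        ultimately have "dist (f (x + e)) (f x) < \<epsilon>" by (rule \<delta>'(2))
        then show ?thesis using nn by (simp add: dist_real_def)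
      qed
    qed
    have "(\<lambda>n. 2 * F / \<delta> * integral\<^sup>L (M n) (\<lambda>\<omega>. norm (E n \<omega>))) \<longlonglongrightarrow> 2 * F / \<delta> * 0"
      by (intro tendsto_intros E0)
    then have ev2: "eventually (\<lambda>n. 2 * F / \<delta> * integral\<^sup>L (M n) (\<lambda>\<omega>. norm (E n \<omega>)) < \<epsilon>) sequentially"
      using \<epsilon> by (intro order_tendstoD) auto
    have "eventually (\<lambda>n. norm (integral\<^sup>L (M n) (\<lambda>\<omega>. f (W n \<omega> + E n \<omega>)) - integral\<^sup>L (M n) (\<lambda>\<omega>. f (W n \<omega>)) - 0) < r) sequentially"
      using ev1 ev2
    proof eventually_elim
      case (elim n)
      interpret prob_space "M n" by (rule prob)
      have ih: "integrable (M n) (\<lambda>\<omega>. h (W n \<omega>))"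
        by (rule integrable_const_bound[where B = 1]) (auto simp: h abs_le_iff)
      have "\<bar>expectation (\<lambda>\<omega>. f (W n \<omega> + E n \<omega>)) - expectation (\<lambda>\<omega>. f (W n \<omega>))\<bar> = \<bar>expectation (\<lambda>\<omega>. f (W n \<omega> + E n \<omega>) - f (W n \<omega>))\<bar>"
        by (subst Bochner_Integration.integral_diff) (auto intro!: If)
      also have "\<dots> \<le> expectation (\<lambda>\<omega>. \<bar>f (W n \<omega> + E n \<omega>) - f (W n \<omega>)\<bar>)"
        by (rule integral_abs_bound)
      also have "\<dots> \<le> expectation (\<lambda>\<omega>. \<epsilon> + 2 * F * h (W n \<omega>) + 2 * F / \<delta> * norm (E n \<omega>))"
        by (intro integral_mono pt Bochner_Integration.integrable_add integrable_mult_right ih intE integrable_abs Bochner_Integration.integrable_diff If) auto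
      also have "\<dots> = \<epsilon> + 2 * F * expectation (\<lambda>\<omega>. h (W n \<omega>)) + 2 * F / \<delta> * expectation (\<lambda>\<omega>. norm (E n \<omega>))"
        using ih intE[of n] by (simp add: prob_space)
      also have "\<dots> < \<epsilon> + 2 * F * \<epsilon> + \<epsilon>"
        using elim F by (intro add_less_le_mono add_strict_mono add_strict_left_mono mult_strict_left_mono) auto
      also have "\<dots> \<le> (2 + 4 * F) * \<epsilon>" using F \<epsilon> by (simp add: algebra_simps)
      also have "\<dots> = r" using F by (simp add: \<epsilon>_def)
      finally show ?case by simp
    qed
    then show "\<exists>no. \<forall>n\<ge>no. norm (integral\<^sup>L (M n) (\<lambda>\<omega>. f (W n \<omega> + E n \<omega>)) - integral\<^sup>L (M n) (\<lambda>\<omega>. f (W n \<omega>)) - 0) < r"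
      by (simp add: eventually_sequentially)
  qed
  moreover have "(\<lambda>n. integral\<^sup>L (M n) (\<lambda>\<omega>. f (W n \<omega>))) \<longlonglongrightarrow> integral\<^sup>L N (\<lambda>\<omega>. f (Z \<omega>))"
    using conv f unfolding conv_distr_vec_def by blast
  ultimately have "(\<lambda>n. (integral\<^sup>L (M n) (\<lambda>\<omega>. f (W n \<omega> + E n \<omega>)) - integral\<^sup>L (M n) (\<lambda>\<omega>. f (W n \<omega>))) + integral\<^sup>L (M n) (\<lambda>\<omega>. f (W n \<omega>))) \<longlonglongrightarrow> 0 + integral\<^sup>L N (\<lambda>\<omega>. f (Z \<omega>))"
    by (rule tendsto_add)
  then show "(\<lambda>n. integral\<^sup>L (M n) (\<lambda>\<omega>. f (W n \<omega> + E n \<omega>))) \<longlonglongrightarrow> integral\<^sup>L N (\<lambda>\<omega>. f (Z \<omega>))" by simp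
qed

text \<open>The times are indexed by an unordered finite type and may repeat. Sorting their values
  gives a strictly increasing grid from 0, on which Brownian increments are independent.\<close>

lemma finite_times_enumeration:
  fixes t :: "'k::finite \<Rightarrow> real"
  assumes "\<And>i. 0 \<le> t i"
  obtains ts :: "nat \<Rightarrow> real" and K :: nat and idx :: "'k \<Rightarrow> nat"
  where "0 < K" "ts 0 = 0" "\<And>l. l < K \<Longrightarrow> ts l < ts (Suc l)" "\<And>i. idx i \<le> K" "\<And>i. ts (idx i) = t i"
proof -
  \<comment> \<open>Adding 0 makes the grid start there; adding 1 guarantees a second point, hence K
    > 0, even if all \<open>t i\<close> vanish.\<close>
  define T where "T = insert 0 (insert 1 (range t))"
  have T: "finite T" by (simp add: T_def)
  define xs where "xs = sorted_list_of_set T"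
  have xs: "sorted_wrt (<) xs" "set xs = T" "length xs = card T"
    using T by (auto simp: xs_def)
  have "card {0::real, 1} \<le> card T" by (rule card_mono) (auto simp: T_def)
  then have len: "2 \<le> length xs" using xs by simp
  have lt: "xs ! i < xs ! j" if "i < j" "j < length xs" for i j
    using sorted_wrt_nth_less[OF xs(1)] that by auto
  have "xs ! 0 = 0"
  proof -
    have "0 \<in> set xs" using xs by (simp add: T_def)
    then obtain i where i: "i < length xs" "xs ! i = 0" by (auto simp: in_set_conv_nth)
    have "xs ! 0 \<in> T" using len xs(2) by (metis nth_mem less_le_trans zero_less_numeral)
    then have "0 \<le> xs ! 0" using assms by (auto simp: T_def)
    then show ?thesis using lt[of 0 i] i by (cases "i = 0") auto
  qed
  moreover have "\<exists>l\<le>length xs - 1. xs ! l = t i" for i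
  proof -
    have "t i \<in> set xs" using xs by (simp add: T_def)
    then obtain l where "l < length xs" "xs ! l = t i" by (auto simp: in_set_conv_nth)
    then show ?thesis by (intro exI[of _ l]) auto
  qed
  then obtain idx where "\<And>i. idx i \<le> length xs - 1" "\<And>i. xs ! idx i = t i" by metis
  moreover have "0 < length xs - 1" using len by simp
  moreover have "xs ! l < xs ! Suc l" if "l < length xs - 1" for l using that by (intro lt) auto
  ultimately show ?thesis by (intro that[of "length xs - 1" "\<lambda>l. xs ! l" idx])
qed

text \<open>On both sides of the limit the value at \<open>t i\<close> is the sum of the first
  \<open>idx i\<close> increments along the grid. So it suffices that the block sums, which are
  independent, converge one by one to the Brownian increments.\<close>

lemma partial_sums_conv_Brownian:
  fixes M :: "nat \<Rightarrow> 'a measure" and X :: "nat \<Rightarrow> nat \<Rightarrow> 'a \<Rightarrow> real" and t :: "'k::finite \<Rightarrow> real"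
  assumes prob: "\<And>n. prob_space (M n)" and BM: "standard_BM N B" and t: "\<And>i. 0 \<le> t i"
    and r: "\<And>n. 0 \<le> r n"
    and indep: "\<And>n. prob_space.indep_vars (M n) (\<lambda>_. borel) (X n) UNIV"
    and wc: "\<And>a b \<nu>. 0 \<le> a \<Longrightarrow> a < b \<Longrightarrow> real_distribution \<nu> \<Longrightarrow> (\<And>x. char \<nu> x = complex_of_real (exp (- ((b - a) * x\<^sup>2 / 2)))) \<Longrightarrow>
       weak_conv_m (\<lambda>n. distr (M n) borel (\<lambda>\<omega>. (\<Sum>j\<in>{nat \<lfloor>r n * a\<rfloor><..nat \<lfloor>r n * b\<rfloor>}. X n j \<omega>) / s n)) \<nu>"
  shows "conv_distr_vec M (\<lambda>n \<omega>. \<chi> i. (\<Sum>j\<in>{1..nat \<lfloor>r n * t i\<rfloor>}. X n j \<omega>) / s n) N (\<lambda>\<omega>. \<chi> i. B (t i) \<omega>)"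
proof -
  obtain ts :: "nat \<Rightarrow> real" and K :: nat and idx :: "'k \<Rightarrow> nat" where
    K: "0 < K" and ts0: "ts 0 = 0" and ts: "\<And>l. l < K \<Longrightarrow> ts l < ts (Suc l)" and idx: "\<And>i. idx i \<le> K" "\<And>i. ts (idx i) = t i"
    by (rule finite_times_enumeration[of t, OF t]) (rule that)
  have tsnn: "0 \<le> ts l" if "l \<le> K" for l
    using that
  proof (induction l)
    case (Suc l) then show ?case using ts[of l] by simp
  qed (simp add: ts0)
  interpret N: prob_space N using BM by (simp add: standard_BM_def)
  define kk where "kk n l = nat \<lfloor>r n * ts l\<rfloor>" for n l
  define D where "D n l \<omega> = (\<Sum>j\<in>{kk n l<..kk n (Suc l)}. X n j \<omega>) / s n" for n l \<omega>
  define \<Delta> where "\<Delta> l \<omega> = B (ts (Suc l)) \<omega> - B (ts l) \<omega>" for l \<omega>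
  have kk_mono: "kk n l \<le> kk n (Suc l)" if "l < K" for n l
    unfolding kk_def using r[of n] ts[OF that] by (intro nat_mono floor_mono mult_left_mono) auto
  have kk_mono': "kk n l \<le> kk n l'" if "l \<le> l'" "l' \<le> K" for n l l'
    using that
  proof (induction l' rule: dec_induct)
    case (step l') then show ?case using kk_mono[of l' n] by simp
  qed simp
  have sumD: "(\<Sum>l<L. D n l \<omega>) = (\<Sum>j\<in>{1..kk n L}. X n j \<omega>) / s n" if "L \<le> K" for n L \<omega>
    using that
  proof (induction L)
    case 0
    then show ?case by (simp add: kk_def ts0)
  next
    case (Suc L)
    have "{1..kk n (Suc L)} = {1..kk n L} \<union> {kk n L<..kk n (Suc L)}" using kk_mono[of L n] Suc.prems by auto
    then have "(\<Sum>j\<in>{1..kk n (Suc L)}. X n j \<omega>) = (\<Sum>j\<in>{1..kk n L}. X n j \<omega>) + (\<Sum>j\<in>{kk n L<..kk n (Suc L)}. X n j \<omega>)"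
      by (simp only:) (intro sum.union_disjoint, auto)
    then show ?case using Suc by (simp add: D_def add_divide_distrib)
  qed
  have sum\<Delta>: "(\<Sum>l<L. \<Delta> l \<omega>) = B (ts L) \<omega>" if "\<omega> \<in> space N" for L \<omega>
  proof -
    have "B 0 \<omega> = 0" using BM that by (simp add: standard_BM_def)
    then show ?thesis unfolding \<Delta>_def using sum_lessThan_telescope[of "\<lambda>l. B (ts l) \<omega>" L] by (simp add: ts0)
  qed
  show ?thesis
    unfolding conv_distr_vec_def
  proof (intro allI impI)
    fix f :: "real^'k \<Rightarrow> real"
    assume f: "continuous_on UNIV f \<and> bounded (range f)"
    then obtain F where F: "\<And>x. \<bar>f x\<bar> \<le> F" by (auto simp: bounded_iff)
    \<comment> \<open>The test function f, read as a function of the increments instead of the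
      values.\<close>
    define G where "G x = f (\<chi> i. \<Sum>l<idx i. x l)" for x :: "nat \<Rightarrow> real"
    have "(\<lambda>n. integral\<^sup>L (M n) (\<lambda>\<omega>. G (\<lambda>l\<in>{..<K}. D n l \<omega>))) \<longlonglongrightarrow> integral\<^sup>L N (\<lambda>\<omega>. G (\<lambda>l\<in>{..<K}. \<Delta> l \<omega>))"
    proof (rule joint_convergence_of_independent[where C = F])
      show "prob_space.indep_vars N (\<lambda>_. borel) \<Delta> {..<K}"
        unfolding \<Delta>_def using BM ts ts0 unfolding standard_BM_def by simp
      show "\<bar>G x\<bar> \<le> F" for x unfolding G_def by (rule F)
      show "(\<lambda>n. G (x n)) \<longlonglongrightarrow> G y" if "\<And>l. l \<in> {..<K} \<Longrightarrow> (\<lambda>n. x n l) \<longlonglongrightarrow> y l" for x y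
      proof -
        have "(\<lambda>n. \<chi> i. \<Sum>l<idx i. x n l) \<longlonglongrightarrow> (\<chi> i. \<Sum>l<idx i. y l)"
          by (intro vec_tendstoI) (use idx(1) in \<open>auto intro!: tendsto_sum that intro: less_le_trans\<close>)
        moreover have "isCont f (\<chi> i. \<Sum>l<idx i. y l)" using f by (simp add: continuous_on_eq_continuous_at)
        ultimately show ?thesis unfolding G_def by (rule isCont_tendsto_compose[rotated])
      qed
      show "G \<in> borel_measurable (Pi\<^sub>M {..<K} (\<lambda>_. borel))"
      proof -
        have [measurable]: "f \<in> borel_measurable borel" using f by (intro borel_measurable_continuous_onI) auto
        have "(\<lambda>x. \<Sum>l<idx i. x l) \<in> borel_measurable (Pi\<^sub>M {..<K} (\<lambda>_. borel :: real measure))" for i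
        proof -
          have "(\<lambda>x. x l) \<in> borel_measurable (Pi\<^sub>M {..<K} (\<lambda>_. borel :: real measure))" if "l \<in> {..<idx i}" for l
            by (rule measurable_component_singleton) (use idx(1)[of i] that in auto)
          from borel_measurable_sum[of "{..<idx i}" "\<lambda>l x. x l", OF this] show ?thesis by simp
        qed
        then have "(\<lambda>x. (\<chi> i. \<Sum>l<idx i. x l) :: real^'k) \<in> borel_measurable (Pi\<^sub>M {..<K} (\<lambda>_. borel))"
          by (subst borel_measurable_euclidean_space) (auto simp: Basis_vec_def inner_axis)
        then show ?thesis unfolding G_def by measurable
      qed
      fix n
      interpret prob_space "M n" by (rule prob)
      \<comment> \<open>The blocks between consecutive grid points are disjoint sets of indices, so
        functions of different blocks are independent.\<close>
      have "indep_vars (\<lambda>l. Pi\<^sub>M {kk n l<..kk n (Suc l)} (\<lambda>_. borel)) (\<lambda>l \<omega>. restrict (\<lambda>j. X n j \<omega>) {kk n l<..kk n (Suc l)}) {..<K}"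
      proof (rule indep_vars_restrict[OF indep])
        show "disjoint_family_on (\<lambda>l. {kk n l<..kk n (Suc l)}) {..<K}"
          unfolding disjoint_family_on_def
        proof (intro ballI impI)
          fix l l' assume l: "l \<in> {..<K}" "l' \<in> {..<K}" "l \<noteq> l'"
          then have "kk n (Suc l) \<le> kk n l' \<or> kk n (Suc l') \<le> kk n l"
            by (cases "l < l'") (auto intro!: kk_mono' simp: not_less)
          then show "{kk n l<..kk n (Suc l)} \<inter> {kk n l'<..kk n (Suc l')} = {}" by auto
        qed
      qed auto
      then have "indep_vars (\<lambda>_. borel) (\<lambda>l \<omega>. (\<lambda>x. (\<Sum>j\<in>{kk n l<..kk n (Suc l)}. x j) / s n) (restrict (\<lambda>j. X n j \<omega>) {kk n l<..kk n (Suc l)})) {..<K}"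
        by (rule indep_vars_compose2) (intro borel_measurable_divide borel_measurable_sum measurable_component_singleton borel_measurable_const, auto)
      then show "indep_vars (\<lambda>_. borel) (D n) {..<K}" unfolding D_def by simp
    next
      fix l assume "l \<in> {..<K}"
      then have l: "l < K" by simp
      have "distributed N lborel (\<Delta> l) (normal_density 0 (sqrt (ts (Suc l) - ts l)))"
        unfolding \<Delta>_def using BM tsnn[of l] ts[OF l] l unfolding standard_BM_def by simp
      from char_normal_increment[OF N.prob_space_axioms this] ts[OF l]
      have "real_distribution (distr N borel (\<Delta> l))" "\<And>x. char (distr N borel (\<Delta> l)) x = complex_of_real (exp (- ((ts (Suc l) - ts l) * x\<^sup>2 / 2)))" by auto
      then show "weak_conv_m (\<lambda>n. distr (M n) borel (D n l)) (distr N borel (\<Delta> l))"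
        unfolding D_def kk_def using tsnn[of l] ts[OF l] l by (intro wc) auto
    qed (use K prob N.prob_space_axioms in auto)
    also have "(\<lambda>n. integral\<^sup>L (M n) (\<lambda>\<omega>. G (\<lambda>l\<in>{..<K}. D n l \<omega>))) = (\<lambda>n. integral\<^sup>L (M n) (\<lambda>\<omega>. f (\<chi> i. (\<Sum>j\<in>{1..nat \<lfloor>r n * t i\<rfloor>}. X n j \<omega>) / s n)))"
    proof -
      have "(\<Sum>l<idx i. (\<lambda>l\<in>{..<K}. D n l \<omega>) l) = (\<Sum>j\<in>{1..nat \<lfloor>r n * t i\<rfloor>}. X n j \<omega>) / s n" for n \<omega> i
        using sumD[OF idx(1)[of i], of n \<omega>] idx[of i] unfolding kk_def
        by (subst sum.cong[OF refl, of _ _ "\<lambda>l. D n l \<omega>"]) auto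
      then show ?thesis unfolding G_def by simp
    qed
    also have "integral\<^sup>L N (\<lambda>\<omega>. G (\<lambda>l\<in>{..<K}. \<Delta> l \<omega>)) = integral\<^sup>L N (\<lambda>\<omega>. f (\<chi> i. B (t i) \<omega>))"
    proof (rule Bochner_Integration.integral_cong[OF refl])
      fix \<omega> assume "\<omega> \<in> space N"
      then have "(\<Sum>l<idx i. (\<lambda>l\<in>{..<K}. \<Delta> l \<omega>) l) = B (t i) \<omega>" for i
        using sum\<Delta>[of \<omega> "idx i"] idx[of i] by (subst sum.cong[OF refl, of _ _ "\<lambda>l. \<Delta> l \<omega>"]) auto
      then show "G (\<lambda>l\<in>{..<K}. \<Delta> l \<omega>) = f (\<chi> i. B (t i) \<omega>)" unfolding G_def by simp
    qed
    finally show "(\<lambda>n. integral\<^sup>L (M n) (\<lambda>\<omega>. f (\<chi> i. (\<Sum>j\<in>{1..nat \<lfloor>r n * t i\<rfloor>}. X n j \<omega>) / s n))) \<longlonglongrightarrow> integral\<^sup>L N (\<lambda>\<omega>. f (\<chi> i. B (t i) \<omega>))" .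
  qed
qed

section \<open>Brownian limits of the log-lcm\<close>

lemma floor_ratio_tendsto:
  assumes "filterlim (\<lambda>n. real (m n)) at_top sequentially" "0 \<le> a"
  shows "(\<lambda>n. real (nat \<lfloor>real (m n) * a\<rfloor>) / real (m n)) \<longlonglongrightarrow> a"
proof (rule LIMSEQ_I[where L = a, unfolded real_norm_def], goal_cases)
  case (1 r)
  have "eventually (\<lambda>n. real (m n) > max 1 (1 / r)) sequentially"
    by (rule iffD1[OF filterlim_at_top_dense assms(1), rule_format])
  then obtain n0 where n0: "\<And>n. n0 \<le> n \<Longrightarrow> real (m n) > max 1 (1 / r)" by (auto simp: eventually_sequentially)
  show ?case
  proof (intro exI[of _ n0] allI impI)
    fix n assume "n0 \<le> n"
    then have m: "1 < real (m n)" "1 / r < real (m n)" using n0 by auto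
    have p: "0 \<le> real (m n) * a" using assms by simp
    have "\<bar>real (nat \<lfloor>real (m n) * a\<rfloor>) - real (m n) * a\<bar> \<le> 1" using p by linarith
    then have "\<bar>real (nat \<lfloor>real (m n) * a\<rfloor>) / real (m n) - a\<bar> \<le> 1 / real (m n)"
      using m by (simp add: abs_le_iff field_simps)
    also have "\<dots> < r" using m 1 by (simp add: field_simps)
    finally show "\<bar>real (nat \<lfloor>real (m n) * a\<rfloor>) / real (m n) - a\<bar> < r" .
  qed
qed

definition centered_sum :: "nat \<Rightarrow> (nat \<Rightarrow> 'a \<Rightarrow> nat) \<Rightarrow> (nat \<Rightarrow> real) \<Rightarrow> nat \<Rightarrow> 'a \<Rightarrow> real" where
  "centered_sum n U \<phi> k \<omega> = (\<Sum>j\<in>{1..k}. \<phi> (U j \<omega>) - avg n \<phi>)"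

lemma avg_centered_sq: "1 \<le> n \<Longrightarrow> avg n (\<lambda>u. (\<phi> u - avg n \<phi>)\<^sup>2) = avg n (\<lambda>u. (\<phi> u)\<^sup>2) - (avg n \<phi>)\<^sup>2"
proof -
  assume n: "1 \<le> n"
  have "avg n (\<lambda>u. (\<phi> u - avg n \<phi>)\<^sup>2) = avg n (\<lambda>u. (\<phi> u)\<^sup>2 - 2 * avg n \<phi> * \<phi> u + (avg n \<phi>)\<^sup>2)"
    by (simp only: power2_diff) (simp add: algebra_simps)
  also have "\<dots> = avg n (\<lambda>u. (\<phi> u)\<^sup>2) - (avg n \<phi>)\<^sup>2"
    unfolding avg_add avg_diff avg_cmult avg_const[OF n] by (simp add: power2_eq_square)
  finally show ?thesis .
qed

context uniform_sample
begin

lemma integrable_Ylcm: "integrable M (Ylcm U k)"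
proof (rule integrable_cong_AE_imp[OF _ borel_Ylcm])
  show "integrable M (\<lambda>\<omega>. (\<Sum>p\<in>primes_in 0 n. ln (real p) * (1 - miss k p \<omega>)) + (\<Sum>d\<in>{1..n}. mangoldt' d * (1 - miss k d \<omega>)))"
    using integrable_miss by auto
  show "AE \<omega> in M. (\<Sum>p\<in>primes_in 0 n. ln (real p) * (1 - miss k p \<omega>)) + (\<Sum>d\<in>{1..n}. mangoldt' d * (1 - miss k d \<omega>)) = Ylcm U k \<omega>"
    using AE_Ylcm[of k] by eventually_elim simp
qed

lemma integrable_centered_sum: "integrable M (centered_sum n U \<phi> k)"
  unfolding centered_sum_def using integrable_U[of \<phi>] by auto

text \<open>The second moment is smallest about the mean, so a bound about any c will do. The
  application takes c = ln n, without evaluating the mean.\<close>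

lemma expectation_abs_centered_sum_le:
  assumes "avg n (\<lambda>u. (\<phi> u - c)\<^sup>2) \<le> V"
  shows "expectation (\<lambda>\<omega>. \<bar>centered_sum n U \<phi> k \<omega>\<bar>) \<le> sqrt (k * V)"
proof (rule expectation_abs_le)
  let ?\<psi> = "\<lambda>u. \<phi> u - avg n \<phi>"
  have z: "avg n ?\<psi> = 0" unfolding avg_diff avg_const[OF n] by simp
  show "integrable M (\<lambda>\<omega>. (centered_sum n U \<phi> k \<omega>)\<^sup>2)"
    unfolding centered_sum_def power2_eq_square using integrable_sum_sum[of "{1..k}" ?\<psi> ?\<psi>] by simp
  have "expectation (\<lambda>\<omega>. (centered_sum n U \<phi> k \<omega>)\<^sup>2) = k * avg n (\<lambda>u. (?\<psi> u)\<^sup>2)"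
    unfolding centered_sum_def power2_eq_square using expectation_sum_sum[of "{1..k}" ?\<psi> ?\<psi>] by (simp add: z)
  also have "avg n (\<lambda>u. (?\<psi> u)\<^sup>2) \<le> avg n (\<lambda>u. (\<phi> u - c)\<^sup>2)"
  proof -
    have "avg n (\<lambda>u. (\<phi> u - c)\<^sup>2) = avg n (\<lambda>u. (?\<psi> u)\<^sup>2 + 2 * (avg n \<phi> - c) * ?\<psi> u + (avg n \<phi> - c)\<^sup>2)"
      by (rule arg_cong[where f = "avg n"]) (simp add: fun_eq_iff power2_eq_square algebra_simps)
    also have "\<dots> = avg n (\<lambda>u. (?\<psi> u)\<^sup>2) + (avg n \<phi> - c)\<^sup>2"
      unfolding avg_add avg_cmult z avg_const[OF n] by simp
    finally show ?thesis by simp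
  qed
  then have "k * avg n (\<lambda>u. (?\<psi> u)\<^sup>2) \<le> k * V" using assms by (intro mult_left_mono) auto
  finally show "expectation (\<lambda>\<omega>. (centered_sum n U \<phi> k \<omega>)\<^sup>2) \<le> k * V" .
qed (use integrable_centered_sum in auto)

lemma indep_centered: "indep_vars (\<lambda>_. borel) (\<lambda>j \<omega>. \<phi> (U j \<omega>) - c :: real) UNIV"
  by (rule indep_vars_compose2[OF indep]) simp

text \<open>Below the square root of \<open>n\<close> the primes up to \<open>z\<close> carry the fluctuations: \<open>ln n\<close> minus the sum
  of \<open>ln p\<close> over all primes dividing \<open>u\<close> has bounded second moment.\<close>
lemma lcm_linear_approximation_small:
  assumes z: "1 \<le> z" "z \<le> n" and T: "0 \<le> T" "real k \<le> T * real z"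
  shows "expectation (\<lambda>\<omega>. \<bar>Ylcm U k \<omega> - cn n (real k) - centered_sum n U (\<lambda>u. - lprimes 0 z u) k \<omega>\<bar>)
      \<le> C_err T * sqrt (z * (1 + ln z)) + sqrt (T * z * (64 + 2 * (C_pow + C_pow\<^sup>2)))"
proof -
  let ?V = "64 + 2 * (C_pow + C_pow\<^sup>2)"
  let ?R = "\<lambda>\<omega>. Ylcm U k \<omega> - cn n (real k) - centered_sum n U (lprimes z n) k \<omega>"
  let ?D = "centered_sum n U (lprimes 0 n) k"
  \<comment> \<open>With g = L - f, the centred sums of g and of -f differ by the centred sum
    \<open>?D\<close> of L.\<close>
  have split: "lprimes z n u = lprimes 0 n u + - lprimes 0 z u" for u
    unfolding lprimes_def using sum_primes_in_split[of 0 z n "\<lambda>p. ln (real p) * of_bool (p dvd u)"] z by simp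
  have "centered_sum n U (\<lambda>u. lprimes 0 n u + - lprimes 0 z u) k \<omega> = ?D \<omega> + centered_sum n U (\<lambda>u. - lprimes 0 z u) k \<omega>" for \<omega>
    unfolding centered_sum_def avg_add sum.distrib[symmetric] by (intro sum.cong) auto
  then have "centered_sum n U (lprimes z n) k \<omega> = ?D \<omega> + centered_sum n U (\<lambda>u. - lprimes 0 z u) k \<omega>" for \<omega>
    unfolding split[abs_def, symmetric] by simp
  then have eq: "Ylcm U k \<omega> - cn n (real k) - centered_sum n U (\<lambda>u. - lprimes 0 z u) k \<omega> = ?R \<omega> + ?D \<omega>" for \<omega> by simp
  have int: "integrable M ?R" "integrable M ?D"
    using integrable_Ylcm integrable_centered_sum by auto
  have "expectation (\<lambda>\<omega>. \<bar>?R \<omega> + ?D \<omega>\<bar>) \<le> expectation (\<lambda>\<omega>. \<bar>?R \<omega>\<bar> + \<bar>?D \<omega>\<bar>)"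
    using int by (intro integral_mono) auto
  also have "\<dots> = expectation (\<lambda>\<omega>. \<bar>?R \<omega>\<bar>) + expectation (\<lambda>\<omega>. \<bar>?D \<omega>\<bar>)" using int by simp
  also have "expectation (\<lambda>\<omega>. \<bar>?R \<omega>\<bar>) \<le> C_err T * sqrt (z * (1 + ln z))"
    unfolding centered_sum_def by (rule lcm_linear_approximation[OF assms])
  \<comment> \<open>Here L is compared with ln n, from which it differs by a quantity bounded in
    mean square.\<close>
  also have "expectation (\<lambda>\<omega>. \<bar>?D \<omega>\<bar>) \<le> sqrt (k * ?V)"
    using avg_defect_sq_le[OF n] by (intro expectation_abs_centered_sum_le[where c = "ln n"]) (simp add: power2_commute)
  also have "sqrt (k * ?V) \<le> sqrt (T * z * ?V)"
    using T C_pow_pos by (intro real_sqrt_le_mono mult_right_mono) auto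
  finally show ?thesis unfolding eq by simp
qed

end

text \<open>\<open>var\<close> and \<open>third\<close> are the Lyapunov conditions, stated for
  \<open>m n\<close> summands, and \<open>err\<close> says that Y is the linear statistic of \<phi>
  up to o(s) in L1. The sampling range \<open>N n\<close> is kept apart from the index n, so that
  the sequence of rows can be shifted.\<close>

lemma Brownian_limit_of_linear_statistic:
  fixes M :: "nat \<Rightarrow> 'a measure" and t :: "'k::finite \<Rightarrow> real"
  assumes us: "\<And>n. uniform_sample (M n) (N n) (U n)" and BM: "standard_BM P B" and t: "\<And>i. 0 \<le> t i"
    and m: "filterlim (\<lambda>n. real (m n)) at_top sequentially"
    and var: "(\<lambda>n. real (m n) * ((avg (N n) (\<lambda>u. (\<phi> n u)\<^sup>2) - (avg (N n) (\<phi> n))\<^sup>2) / (s n)\<^sup>2)) \<longlonglongrightarrow> 1"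
    and third: "(\<lambda>n. real (m n) * (avg (N n) (\<lambda>u. \<bar>\<phi> n u - avg (N n) (\<phi> n)\<bar> ^ 3) / \<bar>s n\<bar> ^ 3)) \<longlonglongrightarrow> 0"
    and intY: "\<And>n k. integrable (M n) (Y n k)"
    and err: "\<And>a. 0 \<le> a \<Longrightarrow> (\<lambda>n. integral\<^sup>L (M n) (\<lambda>\<omega>. \<bar>Y n (nat \<lfloor>real (m n) * a\<rfloor>) \<omega> - centered_sum (N n) (U n) (\<phi> n) (nat \<lfloor>real (m n) * a\<rfloor>) \<omega>\<bar>) / \<bar>s n\<bar>) \<longlonglongrightarrow> 0"
  shows "conv_distr_vec M (\<lambda>n \<omega>. \<chi> i. Y n (nat \<lfloor>real (m n) * t i\<rfloor>) \<omega> / s n) P (\<lambda>\<omega>. \<chi> i. B (t i) \<omega>)"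
proof -
  define X where "X n j \<omega> = \<phi> n (U n j \<omega>) - avg (N n) (\<phi> n)" for n j \<omega>
  define v where "v n = avg (N n) (\<lambda>u. (\<phi> n u)\<^sup>2) - (avg (N n) (\<phi> n))\<^sup>2" for n
  define b where "b n = avg (N n) (\<lambda>u. \<bar>\<phi> n u - avg (N n) (\<phi> n)\<bar> ^ 3)" for n
  have N: "1 \<le> N n" for n using us by (simp add: uniform_sample_def uniform_sample_axioms_def)
  have prob: "prob_space (M n)" for n using us by (simp add: uniform_sample_def)
  have probP: "prob_space P" using BM by (simp add: standard_BM_def)
  have int: "integrable (M n) (X n j)" "integrable (M n) (\<lambda>\<omega>. (X n j \<omega>)\<^sup>2)" "integrable (M n) (\<lambda>\<omega>. \<bar>X n j \<omega>\<bar> ^ 3)" for n j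
    unfolding X_def
    using uniform_sample.integrable_U[OF us, of n "\<lambda>u. \<phi> n u - avg (N n) (\<phi> n)"]
      uniform_sample.integrable_U[OF us, of n "\<lambda>u. (\<phi> n u - avg (N n) (\<phi> n))\<^sup>2"]
      uniform_sample.integrable_U[OF us, of n "\<lambda>u. \<bar>\<phi> n u - avg (N n) (\<phi> n)\<bar> ^ 3"] by auto
  have EX: "integral\<^sup>L (M n) (X n j) = 0" "integral\<^sup>L (M n) (\<lambda>\<omega>. (X n j \<omega>)\<^sup>2) = v n" "integral\<^sup>L (M n) (\<lambda>\<omega>. \<bar>X n j \<omega>\<bar> ^ 3) = b n" for n j
    unfolding X_def v_def b_def avg_centered_sq[OF N, symmetric]
    using uniform_sample.expectation_U[OF us, of n "\<lambda>u. \<phi> n u - avg (N n) (\<phi> n)" j]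
      uniform_sample.expectation_U[OF us, of n "\<lambda>u. (\<phi> n u - avg (N n) (\<phi> n))\<^sup>2" j]
      uniform_sample.expectation_U[OF us, of n "\<lambda>u. \<bar>\<phi> n u - avg (N n) (\<phi> n)\<bar> ^ 3" j]
    by (simp_all add: avg_diff avg_const[OF N])
  have indX: "prob_space.indep_vars (M n) (\<lambda>_. borel) (X n) UNIV" for n
    unfolding X_def by (rule uniform_sample.indep_centered[OF us])
  have mpos: "eventually (\<lambda>n. 0 < real (m n)) sequentially"
    by (rule iffD1[OF filterlim_at_top_dense m, rule_format])
  have lim: "conv_distr_vec M (\<lambda>n \<omega>. \<chi> i. (\<Sum>j\<in>{1..nat \<lfloor>real (m n) * t i\<rfloor>}. X n j \<omega>) / s n) P (\<lambda>\<omega>. \<chi> i. B (t i) \<omega>)"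
  proof (rule partial_sums_conv_Brownian[OF prob BM t _ indX])
    fix a c :: real and \<nu>
    assume ac: "0 \<le> a" "a < c" and \<nu>: "real_distribution \<nu>" "\<And>x. char \<nu> x = complex_of_real (exp (- ((c - a) * x\<^sup>2 / 2)))"
    define J where "J n = {nat \<lfloor>real (m n) * a\<rfloor><..nat \<lfloor>real (m n) * c\<rfloor>}" for n
    have "nat \<lfloor>real (m n) * a\<rfloor> \<le> nat \<lfloor>real (m n) * c\<rfloor>" for n
      using ac by (intro nat_mono floor_mono mult_left_mono) auto
    then have cardJ: "real (card (J n)) = real (nat \<lfloor>real (m n) * c\<rfloor>) - real (nat \<lfloor>real (m n) * a\<rfloor>)" for n
      unfolding J_def by (simp add: of_nat_diff)
    have ratio: "(\<lambda>n. real (card (J n)) / real (m n)) \<longlonglongrightarrow> c - a"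
      unfolding cardJ diff_divide_distrib using ac by (intro tendsto_diff floor_ratio_tendsto m) auto
    have "weak_conv_m (\<lambda>n. distr (M n) borel (\<lambda>\<omega>. (\<Sum>j\<in>J n. X n j \<omega>) / s n)) \<nu>"
    proof (rule triangular_central_limit[where v = v and b = b and \<tau> = "c - a"])
      show "prob_space.indep_vars (M n) (\<lambda>_. borel) (X n) (J n)" for n
        using prob_space.indep_vars_subset[OF prob indX] by simp
      \<comment> \<open>The block length divided by \<open>m n\<close> tends to c - a, which
        converts the conditions from \<open>m n\<close> summands to one block.\<close>
      have "(\<lambda>n. real (card (J n)) / real (m n) * (real (m n) * (v n / (s n)\<^sup>2))) \<longlonglongrightarrow> (c - a) * 1"
        by (intro tendsto_mult ratio var[folded v_def])
      moreover have "eventually (\<lambda>n. real (card (J n)) / real (m n) * (real (m n) * (v n / (s n)\<^sup>2)) = card (J n) * (v n / (s n)\<^sup>2)) sequentially"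
        using mpos by eventually_elim simp
      ultimately show "(\<lambda>n. card (J n) * (v n / (s n)\<^sup>2)) \<longlonglongrightarrow> c - a"
        using Lim_transform_eventually by fastforce
      have "(\<lambda>n. real (card (J n)) / real (m n) * (real (m n) * (b n / \<bar>s n\<bar> ^ 3))) \<longlonglongrightarrow> (c - a) * 0"
        by (intro tendsto_mult ratio third[folded b_def])
      moreover have "eventually (\<lambda>n. real (card (J n)) / real (m n) * (real (m n) * (b n / \<bar>s n\<bar> ^ 3)) = card (J n) * (b n / \<bar>s n\<bar> ^ 3)) sequentially"
        using mpos by eventually_elim simp
      ultimately show "(\<lambda>n. card (J n) * (b n / \<bar>s n\<bar> ^ 3)) \<longlonglongrightarrow> 0"
        using Lim_transform_eventually by fastforce
      \<comment> \<open>A single summand is negligible: \<open>m n\<close> of them have a bounded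
        total variance relative to s^2, and \<open>m n\<close> tends to infinity.\<close>
      have "(\<lambda>n. inverse (real (m n)) * (real (m n) * (v n / (s n)\<^sup>2))) \<longlonglongrightarrow> 0 * 1"
        by (intro tendsto_mult tendsto_inverse_0_at_top m var[folded v_def])
      moreover have "eventually (\<lambda>n. inverse (real (m n)) * (real (m n) * (v n / (s n)\<^sup>2)) = v n / (s n)\<^sup>2) sequentially"
        using mpos by eventually_elim simp
      ultimately show "(\<lambda>n. v n / (s n)\<^sup>2) \<longlonglongrightarrow> 0"
        using Lim_transform_eventually by fastforce
    qed (use prob int EX \<nu> in \<open>auto simp: J_def\<close>)
    then show "weak_conv_m (\<lambda>n. distr (M n) borel (\<lambda>\<omega>. (\<Sum>j\<in>{nat \<lfloor>real (m n) * a\<rfloor><..nat \<lfloor>real (m n) * c\<rfloor>}. X n j \<omega>) / s n)) \<nu>"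
      unfolding J_def .
  qed simp
  define Q where "Q n a \<omega> = (Y n (nat \<lfloor>real (m n) * a\<rfloor>) \<omega> - centered_sum (N n) (U n) (\<phi> n) (nat \<lfloor>real (m n) * a\<rfloor>) \<omega>) / s n" for n a \<omega>
  have intQ: "integrable (M n) (Q n a)" for n a
    unfolding Q_def using intY uniform_sample.integrable_centered_sum[OF us] by auto
  let ?W = "\<lambda>n \<omega>. (\<chi> i. (\<Sum>j\<in>{1..nat \<lfloor>real (m n) * t i\<rfloor>}. X n j \<omega>) / s n) :: real^'k"
  let ?E = "\<lambda>n \<omega>. (\<chi> i. Q n (t i) \<omega>) :: real^'k"
  have mvec: "(\<lambda>\<omega>. (\<chi> i. h i \<omega>) :: real^'k) \<in> borel_measurable L" if "\<And>i. h i \<in> borel_measurable L" for h and L :: "'c measure"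
    using that by (subst borel_measurable_euclidean_space) (auto simp: Basis_vec_def inner_axis)
  have mE: "?E n \<in> borel_measurable (M n)" for n
    using intQ by (intro mvec) auto
  \<comment> \<open>The Euclidean norm is at most the sum of the absolute coordinates, so L1 control
    of each coordinate is enough.\<close>
  have nE: "norm (?E n \<omega>) \<le> (\<Sum>i\<in>UNIV. \<bar>Q n (t i) \<omega>\<bar>)" for n \<omega>
    using norm_le_l1_cart[of "?E n \<omega>"] by simp
  have iE: "integrable (M n) (\<lambda>\<omega>. norm (?E n \<omega>))" for n
  proof (rule Bochner_Integration.integrable_bound[where f = "\<lambda>\<omega>. \<Sum>i\<in>UNIV. \<bar>Q n (t i) \<omega>\<bar>"])
    show "integrable (M n) (\<lambda>\<omega>. \<Sum>i\<in>UNIV. \<bar>Q n (t i) \<omega>\<bar>)" using intQ by auto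
    show "(\<lambda>\<omega>. norm (?E n \<omega>)) \<in> borel_measurable (M n)" by (rule measurable_compose[OF mE borel_measurable_norm])
    show "AE \<omega> in M n. norm (norm (?E n \<omega>)) \<le> norm (\<Sum>i\<in>UNIV. \<bar>Q n (t i) \<omega>\<bar>)"
      using nE by (intro AE_I2) (auto intro: order_trans[OF _ abs_ge_self])
  qed
  have "conv_distr_vec M (\<lambda>n \<omega>. ?W n \<omega> + ?E n \<omega>) P (\<lambda>\<omega>. \<chi> i. B (t i) \<omega>)"
  proof (rule conv_distr_vec_add_negligible[OF prob probP _ _ mE iE _ lim])
    show "?W n \<in> borel_measurable (M n)" for n
      using int(1) by (intro mvec borel_measurable_divide borel_measurable_sum) auto
    show "(\<lambda>\<omega>. (\<chi> i. B (t i) \<omega>) :: real^'k) \<in> borel_measurable P"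
      using BM by (intro mvec) (auto simp: standard_BM_def)
    have "(\<lambda>n. \<Sum>i\<in>UNIV. integral\<^sup>L (M n) (\<lambda>\<omega>. \<bar>Q n (t i) \<omega>\<bar>)) \<longlonglongrightarrow> (\<Sum>i\<in>(UNIV::'k set). 0)"
      unfolding Q_def abs_divide using err[OF t] by (intro tendsto_sum) simp
    then have lim0: "(\<lambda>n. \<Sum>i\<in>UNIV. integral\<^sup>L (M n) (\<lambda>\<omega>. \<bar>Q n (t i) \<omega>\<bar>)) \<longlonglongrightarrow> 0" by simp
    show "(\<lambda>n. integral\<^sup>L (M n) (\<lambda>\<omega>. norm (?E n \<omega>))) \<longlonglongrightarrow> 0"
    proof (rule tendsto_sandwich[OF _ _ tendsto_const lim0])
      show "eventually (\<lambda>n. 0 \<le> integral\<^sup>L (M n) (\<lambda>\<omega>. norm (?E n \<omega>))) sequentially"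
        by (intro always_eventually allI integral_nonneg_AE) auto
      have "integral\<^sup>L (M n) (\<lambda>\<omega>. norm (?E n \<omega>)) \<le> integral\<^sup>L (M n) (\<lambda>\<omega>. \<Sum>i\<in>UNIV. \<bar>Q n (t i) \<omega>\<bar>)" for n
        using intQ by (intro integral_mono iE nE) auto
      also have "integral\<^sup>L (M n) (\<lambda>\<omega>. \<Sum>i\<in>UNIV. \<bar>Q n (t i) \<omega>\<bar>) = (\<Sum>i\<in>UNIV. integral\<^sup>L (M n) (\<lambda>\<omega>. \<bar>Q n (t i) \<omega>\<bar>))" for n
        using intQ by (intro Bochner_Integration.integral_sum) auto
      finally show "eventually (\<lambda>n. integral\<^sup>L (M n) (\<lambda>\<omega>. norm (?E n \<omega>)) \<le> (\<Sum>i\<in>UNIV. integral\<^sup>L (M n) (\<lambda>\<omega>. \<bar>Q n (t i) \<omega>\<bar>))) sequentially"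
        by simp
    qed
  qed
  moreover have "?W n \<omega> + ?E n \<omega> = (\<chi> i. Y n (nat \<lfloor>real (m n) * t i\<rfloor>) \<omega> / s n)" for n \<omega>
    by (simp add: vec_eq_iff Q_def X_def centered_sum_def diff_divide_distrib)
  ultimately show ?thesis by simp
qed


lemma tendsto_of_dist_le:
  assumes "eventually (\<lambda>n. \<bar>f n - c\<bar> \<le> g n) sequentially" "g \<longlonglongrightarrow> (0::real)"
  shows "f \<longlonglongrightarrow> c"
  by (rule LIM_zero_cancel, rule Lim_null_comparison[OF _ assms(2)]) (use assms(1) in simp)

text \<open>With s^2 = m (ln m)^2 / 2 the relative error of the variance is O(1 / ln m), the
  Lyapunov ratio O(1 / sqrt m) and the L1 error relative to s is O(1 / sqrt (ln m)). So all
  conditions reduce to limits of functions of m alone.\<close>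

theorem lcm_fdd_limit_small:
  fixes M :: "nat \<Rightarrow> 'a measure" and t :: "'k::finite \<Rightarrow> real"
  assumes us: "\<And>n. uniform_sample (M n) (N n) (U n)" and BM: "standard_BM P B" and t: "\<And>i. 0 \<le> t i"
    and mpos: "\<And>n. 0 < m n" and small: "eventually (\<lambda>n. real (m n) \<le> sqrt (real (N n))) sequentially"
    and m: "filterlim (\<lambda>n. real (m n)) at_top sequentially"
  shows "conv_distr_vec M (\<lambda>n \<omega>. \<chi> i. (Ylcm (U n) (nat \<lfloor>real (m n) * t i\<rfloor>) \<omega> - cn (N n) (real (nat \<lfloor>real (m n) * t i\<rfloor>)))
      / (sqrt (real (m n) / 2) * ln (real (m n)))) P (\<lambda>\<omega>. \<chi> i. B (t i) \<omega>)"
proof (rule Brownian_limit_of_linear_statistic[OF us BM t m, where \<phi> = "\<lambda>n u. - lprimes 0 (m n) u"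
      and Y = "\<lambda>n k \<omega>. Ylcm (U n) k \<omega> - cn (N n) (real k)"])
  have N: "1 \<le> N n" for n using us by (simp add: uniform_sample_def uniform_sample_axioms_def)
  have prob: "prob_space (M n)" for n using us by (simp add: uniform_sample_def)
  let ?s = "\<lambda>n. sqrt (real (m n) / 2) * ln (real (m n))"
  have m3: "eventually (\<lambda>n. 3 < real (m n)) sequentially"
    by (rule iffD1[OF filterlim_at_top_dense m, rule_format])
  have le: "m n \<le> N n" if "real (m n) \<le> sqrt (real (N n))" for n
  proof -
    have "real (m n) * 1 \<le> real (m n) * real (m n)" using mpos[of n] by (intro mult_left_mono) auto
    also have "\<dots> \<le> sqrt (real (N n)) * sqrt (real (N n))" using that by (intro mult_mono) auto
    finally show ?thesis by simp
  qed
  have neg: "avg (N n) (\<lambda>u. - lprimes 0 (m n) u) = - avg (N n) (lprimes 0 (m n))" for n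
    unfolding avg_def by (simp add: sum_negf)
  show "(\<lambda>n. real (m n) * ((avg (N n) (\<lambda>u. (- lprimes 0 (m n) u)\<^sup>2) - (avg (N n) (\<lambda>u. - lprimes 0 (m n) u))\<^sup>2) / (?s n)\<^sup>2)) \<longlonglongrightarrow> 1"
  proof (rule tendsto_of_dist_le)
    show "eventually (\<lambda>n. \<bar>real (m n) * ((avg (N n) (\<lambda>u. (- lprimes 0 (m n) u)\<^sup>2) - (avg (N n) (\<lambda>u. - lprimes 0 (m n) u))\<^sup>2) / (?s n)\<^sup>2) - 1\<bar>
        \<le> (\<lambda>x. 2 * (40 + 2 * C_mer) * ((1 + ln x) / (ln x)\<^sup>2)) (real (m n))) sequentially"
      using m3 small
    proof eventually_elim
      case (elim n)
      define l where "l = ln (real (m n))"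
      define v where "v = avg (N n) (\<lambda>u. (lprimes 0 (m n) u)\<^sup>2) - (avg (N n) (lprimes 0 (m n)))\<^sup>2"
      have l: "0 < l" using elim by (simp add: l_def)
      have "\<bar>v - l\<^sup>2 / 2\<bar> \<le> (40 + 2 * C_mer) * (1 + l)"
        unfolding v_def l_def using elim by (intro variance_small) auto
      then have le: "2 / l\<^sup>2 * \<bar>v - l\<^sup>2 / 2\<bar> \<le> 2 / l\<^sup>2 * ((40 + 2 * C_mer) * (1 + l))" by (intro mult_left_mono) auto
      have abs: "2 / l\<^sup>2 * \<bar>v - l\<^sup>2 / 2\<bar> = \<bar>2 / l\<^sup>2 * (v - l\<^sup>2 / 2)\<bar>" unfolding abs_mult by simp
      \<comment> \<open>Scaling by 2 / l^2 is scaling by m / s^2, as s^2 = m l^2 / 2.\<close>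
      have eq: "2 / l\<^sup>2 * (v - l\<^sup>2 / 2) = real (m n) * (v / (?s n)\<^sup>2) - 1"
        using l elim by (simp add: power_mult_distrib l_def[symmetric] field_simps)
      have "2 / l\<^sup>2 * ((40 + 2 * C_mer) * (1 + l)) = 2 * (40 + 2 * C_mer) * ((1 + l) / l\<^sup>2)" by simp
      with le have "\<bar>real (m n) * (v / (?s n)\<^sup>2) - 1\<bar> \<le> 2 * (40 + 2 * C_mer) * ((1 + l) / l\<^sup>2)"
        unfolding abs eq by (simp only:)
      then show ?case unfolding neg v_def l_def by (simp only: power2_minus)
    qed
    have "((\<lambda>x. 2 * (40 + 2 * C_mer) * ((1 + ln x) / (ln x)\<^sup>2)) \<longlongrightarrow> 0) at_top" by real_asymp
    then show "(\<lambda>n. (\<lambda>x. 2 * (40 + 2 * C_mer) * ((1 + ln x) / (ln x)\<^sup>2)) (real (m n))) \<longlonglongrightarrow> 0"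
      by (rule filterlim_compose) (rule m)
  qed
  show "(\<lambda>n. real (m n) * (avg (N n) (\<lambda>u. \<bar>- lprimes 0 (m n) u - avg (N n) (\<lambda>u. - lprimes 0 (m n) u)\<bar> ^ 3) / \<bar>?s n\<bar> ^ 3)) \<longlonglongrightarrow> 0"
  proof (rule Lim_null_comparison)
    show "eventually (\<lambda>n. norm (real (m n) * (avg (N n) (\<lambda>u. \<bar>- lprimes 0 (m n) u - avg (N n) (\<lambda>u. - lprimes 0 (m n) u)\<bar> ^ 3) / \<bar>?s n\<bar> ^ 3))
        \<le> (\<lambda>x. x * (105 * (1 + ln x) ^ 3 / (sqrt (x / 2) * ln x) ^ 3)) (real (m n))) sequentially"
      using m3 small
    proof eventually_elim
      case (elim n)
      have s: "0 < ?s n" using elim by simp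
      have "avg (N n) (\<lambda>u. \<bar>- lprimes 0 (m n) u - avg (N n) (\<lambda>u. - lprimes 0 (m n) u)\<bar> ^ 3) = avg (N n) (\<lambda>u. \<bar>lprimes 0 (m n) u - avg (N n) (lprimes 0 (m n))\<bar> ^ 3)"
        unfolding neg by (simp add: abs_minus_commute)
      moreover have "\<dots> \<le> 105 * (1 + ln (m n)) ^ 3" using mpos[of n] N by (intro third_moment_small) auto
      moreover have "0 \<le> avg (N n) (\<lambda>u. \<bar>lprimes 0 (m n) u - avg (N n) (lprimes 0 (m n))\<bar> ^ 3)" by (intro avg_nonneg) auto
      ultimately show ?case using s by (auto simp: abs_mult intro!: mult_left_mono divide_right_mono)
    qed
    have "((\<lambda>x::real. x * (105 * (1 + ln x) ^ 3 / (sqrt (x / 2) * ln x) ^ 3)) \<longlongrightarrow> 0) at_top" by real_asymp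
    then show "(\<lambda>n. (\<lambda>x::real. x * (105 * (1 + ln x) ^ 3 / (sqrt (x / 2) * ln x) ^ 3)) (real (m n))) \<longlonglongrightarrow> 0"
      by (rule filterlim_compose) (rule m)
  qed
  show "integrable (M n) (\<lambda>\<omega>. Ylcm (U n) k \<omega> - cn (N n) (real k))" for n k
    using uniform_sample.integrable_Ylcm[OF us] prob_space.finite_measure[OF prob] by (auto intro!: Bochner_Integration.integrable_diff finite_measure.integrable_const)
  fix a :: real assume a: "0 \<le> a"
  show "(\<lambda>n. integral\<^sup>L (M n) (\<lambda>\<omega>. \<bar>Ylcm (U n) (nat \<lfloor>real (m n) * a\<rfloor>) \<omega> - cn (N n) (real (nat \<lfloor>real (m n) * a\<rfloor>))
      - centered_sum (N n) (U n) (\<lambda>u. - lprimes 0 (m n) u) (nat \<lfloor>real (m n) * a\<rfloor>) \<omega>\<bar>) / \<bar>?s n\<bar>) \<longlonglongrightarrow> 0"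
  proof (rule Lim_null_comparison)
    let ?V = "64 + 2 * (C_pow + C_pow\<^sup>2)"
    show "eventually (\<lambda>n. norm (integral\<^sup>L (M n) (\<lambda>\<omega>. \<bar>Ylcm (U n) (nat \<lfloor>real (m n) * a\<rfloor>) \<omega> - cn (N n) (real (nat \<lfloor>real (m n) * a\<rfloor>))
      - centered_sum (N n) (U n) (\<lambda>u. - lprimes 0 (m n) u) (nat \<lfloor>real (m n) * a\<rfloor>) \<omega>\<bar>) / \<bar>?s n\<bar>)
       \<le> (\<lambda>x. (C_err a * sqrt (x * (1 + ln x)) + sqrt (a * x * ?V)) / (sqrt (x / 2) * ln x)) (real (m n))) sequentially"
      using m3 small
    proof eventually_elim
      case (elim n)
      have "real (nat \<lfloor>real (m n) * a\<rfloor>) \<le> a * real (m n)" using a by (simp add: mult.commute)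
      then have "integral\<^sup>L (M n) (\<lambda>\<omega>. \<bar>Ylcm (U n) (nat \<lfloor>real (m n) * a\<rfloor>) \<omega> - cn (N n) (real (nat \<lfloor>real (m n) * a\<rfloor>))
        - centered_sum (N n) (U n) (\<lambda>u. - lprimes 0 (m n) u) (nat \<lfloor>real (m n) * a\<rfloor>) \<omega>\<bar>)
        \<le> C_err a * sqrt (real (m n) * (1 + ln (real (m n)))) + sqrt (a * real (m n) * ?V)"
        using a elim le[of n] by (intro uniform_sample.lcm_linear_approximation_small[OF us]) auto
      moreover have "0 \<le> integral\<^sup>L (M n) (\<lambda>\<omega>. \<bar>Ylcm (U n) (nat \<lfloor>real (m n) * a\<rfloor>) \<omega> - cn (N n) (real (nat \<lfloor>real (m n) * a\<rfloor>))
        - centered_sum (N n) (U n) (\<lambda>u. - lprimes 0 (m n) u) (nat \<lfloor>real (m n) * a\<rfloor>) \<omega>\<bar>)"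
        by (intro integral_nonneg_AE) auto
      moreover have "0 < ?s n" using elim by simp
      ultimately show ?case by (simp add: divide_right_mono)
    qed
    have "((\<lambda>x::real. C_err a * (sqrt (x * (1 + ln x)) / (sqrt (x / 2) * ln x)) + sqrt (a * ?V) * (sqrt x / (sqrt (x / 2) * ln x))) \<longlongrightarrow> C_err a * 0 + sqrt (a * ?V) * 0) at_top"
      by (intro tendsto_add tendsto_mult tendsto_const; real_asymp)
    also have "(\<lambda>x::real. C_err a * (sqrt (x * (1 + ln x)) / (sqrt (x / 2) * ln x)) + sqrt (a * ?V) * (sqrt x / (sqrt (x / 2) * ln x))) =
       (\<lambda>x. (C_err a * sqrt (x * (1 + ln x)) + sqrt (a * x * ?V)) / (sqrt (x / 2) * ln x))"
      by (rule ext) (simp add: add_divide_distrib real_sqrt_mult mult_ac)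
    finally have "((\<lambda>x. (C_err a * sqrt (x * (1 + ln x)) + sqrt (a * x * ?V)) / (sqrt (x / 2) * ln x)) \<longlongrightarrow> 0) at_top" by simp
    then show "(\<lambda>n. (\<lambda>x. (C_err a * sqrt (x * (1 + ln x)) + sqrt (a * x * ?V)) / (sqrt (x / 2) * ln x)) (real (m n))) \<longlonglongrightarrow> 0"
      by (rule filterlim_compose) (rule m)
  qed
qed


section \<open>The range above the square root of n\<close>

lemma lprimes_le_ln: "u \<in> {1..n} \<Longrightarrow> lprimes z n u \<le> ln n"
proof -
  assume u: "u \<in> {1..n}"
  have "lprimes z n u \<le> lprimes 0 n u"
    unfolding lprimes_def by (rule sum_mono2) (auto simp: primes_in_def)
  also have "\<dots> \<le> ln u" using ln_eq_lprimes_lpowers[OF u] lpowers_nonneg[of n u] by linarith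
  also have "\<dots> \<le> ln n" using u by simp
  finally show ?thesis .
qed

text \<open>g and its mean both lie between 0 and ln n, so one factor of the cube is at most ln n
  and the other two give the variance.\<close>

lemma third_moment_large:
  assumes "1 \<le> n"
  shows "avg n (\<lambda>u. \<bar>lprimes z n u - avg n (lprimes z n)\<bar> ^ 3) \<le> ln n * (avg n (\<lambda>u. (lprimes z n u)\<^sup>2) - (avg n (lprimes z n))\<^sup>2)"
proof -
  define \<mu> where "\<mu> = avg n (lprimes z n)"
  have \<mu>: "0 \<le> \<mu>" unfolding \<mu>_def by (intro avg_nonneg lprimes_nonneg)
  have "\<mu> \<le> avg n (\<lambda>_. ln n)" unfolding \<mu>_def by (intro avg_mono lprimes_le_ln)
  then have \<mu>': "\<mu> \<le> ln n" by (simp add: avg_const[OF assms])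
  have "avg n (\<lambda>u. \<bar>lprimes z n u - \<mu>\<bar> ^ 3) \<le> avg n (\<lambda>u. ln n * (lprimes z n u - \<mu>)\<^sup>2)"
  proof (rule avg_mono)
    fix u assume u: "u \<in> {1..n}"
    have "\<bar>lprimes z n u - \<mu>\<bar> \<le> ln n" using lprimes_le_ln[OF u, of z] lprimes_nonneg[of z n u] \<mu> \<mu>' by linarith
    then have "\<bar>lprimes z n u - \<mu>\<bar> * \<bar>lprimes z n u - \<mu>\<bar>\<^sup>2 \<le> ln n * \<bar>lprimes z n u - \<mu>\<bar>\<^sup>2" by (intro mult_right_mono) auto
    then show "\<bar>lprimes z n u - \<mu>\<bar> ^ 3 \<le> ln n * (lprimes z n u - \<mu>)\<^sup>2" by (simp add: power3_eq_cube power2_eq_square mult.assoc)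
  qed
  also have "\<dots> = ln n * (avg n (\<lambda>u. (lprimes z n u)\<^sup>2) - \<mu>\<^sup>2)"
    unfolding avg_cmult \<mu>_def avg_centered_sq[OF assms] ..
  finally show ?thesis unfolding \<mu>_def .
qed

text \<open>Write l = ln m and L = ln N. From m > sqrt N follows L \<le> 2 l, so 3 l - L \<ge> L / 2
  and s^2 \<ge> m (L - l) L / 4. Both m times the variance error O(L) and the squared L1 error O(m
  (1 + l)) are then smaller than s^2 by a factor of order L - l, which tends to infinity because m =
  o(N).\<close>

theorem lcm_fdd_limit_large:
  fixes M :: "nat \<Rightarrow> 'a measure" and t :: "'k::finite \<Rightarrow> real"
  assumes us: "\<And>n. uniform_sample (M n) (N n) (U n)" and BM: "standard_BM P B" and t: "\<And>i. 0 \<le> t i"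
    and mpos: "\<And>n. 0 < m n" and large: "eventually (\<lambda>n. sqrt (real (N n)) < real (m n)) sequentially"
    and ratio: "(\<lambda>n. real (m n) / real (N n)) \<longlonglongrightarrow> 0"
    and Ninf: "filterlim (\<lambda>n. real (N n)) at_top sequentially"
  shows "conv_distr_vec M (\<lambda>n \<omega>. \<chi> i. (Ylcm (U n) (nat \<lfloor>real (m n) * t i\<rfloor>) \<omega> - cn (N n) (real (nat \<lfloor>real (m n) * t i\<rfloor>)))
      / sqrt (real (m n) / 2 * (ln (real (N n)) - ln (real (m n))) * (3 * ln (real (m n)) - ln (real (N n))))) P (\<lambda>\<omega>. \<chi> i. B (t i) \<omega>)"
proof -
  have N: "1 \<le> N n" for n using us by (simp add: uniform_sample_def uniform_sample_axioms_def)
  have prob: "prob_space (M n)" for n using us by (simp add: uniform_sample_def)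
  define l where "l n = ln (real (m n))" for n
  define L where "L n = ln (real (N n))" for n
  define s where "s n = sqrt (real (m n) / 2 * (L n - l n) * (3 * l n - L n))" for n
  define v where "v n = avg (N n) (\<lambda>u. (lprimes (m n) (N n) u)\<^sup>2) - (avg (N n) (lprimes (m n) (N n)))\<^sup>2" for n
  define K where "K = 20 + 10 * C_mer + (3 + 2 * C_mer)\<^sup>2"
  have K: "0 \<le> K" using C_mer_pos by (simp add: K_def)
  \<comment> \<open>m eventually exceeds sqrt N and inherits its divergence.\<close>
  have m: "filterlim (\<lambda>n. real (m n)) at_top sequentially"
    by (rule filterlim_at_top_mono[OF filterlim_compose[OF sqrt_at_top Ninf]])
       (use large in eventually_elim, simp)
  have gap: "filterlim (\<lambda>n. L n - l n) at_top sequentially"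
  proof -
    have "filterlim (\<lambda>n. inverse (real (m n) / real (N n))) at_top sequentially"
      by (rule filterlim_inverse_at_top[OF ratio]) (use mpos N in \<open>auto simp: Suc_le_eq\<close>)
    then have "filterlim (\<lambda>n. ln (inverse (real (m n) / real (N n)))) at_top sequentially"
      by (rule filterlim_compose[OF ln_at_top])
    moreover have "ln (inverse (real (m n) / real (N n))) = L n - l n" for n
      unfolding L_def l_def using mpos[of n] N[of n] by (simp add: ln_div)
    ultimately show ?thesis by simp
  qed
  have ev: "eventually (\<lambda>n. 3 < real (m n)) sequentially" "eventually (\<lambda>n. 3 < real (N n)) sequentially" "eventually (\<lambda>n. 1 < L n - l n) sequentially"
    by (rule iffD1[OF filterlim_at_top_dense m, rule_format] iffD1[OF filterlim_at_top_dense Ninf, rule_format]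
        iffD1[OF filterlim_at_top_dense gap, rule_format])+
  have facts: "eventually (\<lambda>n. 3 < real (m n) \<and> m n \<le> N n \<and> sqrt (real (N n)) < real (m n) \<and> 1 < L n - l n \<and> 1 \<le> L n \<and> L n \<le> 2 * l n \<and> l n \<le> L n
      \<and> real (m n) * ((L n - l n) * L n) / 4 \<le> (s n)\<^sup>2 \<and> (s n)\<^sup>2 = real (m n) * ((L n - l n) * (3 * l n - L n) / 2) \<and> 0 < s n
      \<and> (L n - l n) * L n / 2 \<le> (L n - l n) * (3 * l n - L n)) sequentially"
    using ev large
  proof eventually_elim
    case (elim n)
    have L1: "1 \<le> L n"
    proof -
      have "exp 1 \<le> real (N n)" using exp_le elim by linarith
      then show ?thesis unfolding L_def using N[of n] by (subst ln_ge_iff) auto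
    qed
    have "ln (sqrt (real (N n))) \<le> ln (real (m n))" using elim N[of n] by (intro ln_mono) auto
    then have Ll: "L n \<le> 2 * l n" unfolding L_def l_def using N[of n] by (simp add: ln_sqrt)
    have lL: "l n \<le> L n" using elim by simp
    have mN: "m n \<le> N n"
    proof -
      have "ln (real (m n)) \<le> ln (real (N n))" using lL unfolding l_def L_def .
      then show ?thesis using mpos[of n] N[of n] by simp
    qed
    have Q: "(L n - l n) * (L n / 2) \<le> (L n - l n) * (3 * l n - L n)" using Ll elim by (intro mult_left_mono) auto
    have "0 < (L n - l n) * (L n / 2)" using elim L1 by (intro mult_pos_pos) auto
    then have Q0: "0 < (L n - l n) * (3 * l n - L n)" using Q by linarith
    have arg: "real (m n) / 2 * (L n - l n) * (3 * l n - L n) = real (m n) * ((L n - l n) * (3 * l n - L n) / 2)" by simp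
    have pos: "0 < real (m n) * ((L n - l n) * (3 * l n - L n) / 2)" using Q0 mpos[of n] by simp
    have s2: "(s n)\<^sup>2 = real (m n) * ((L n - l n) * (3 * l n - L n) / 2)" unfolding s_def arg using pos by simp
    have s0: "0 < s n" unfolding s_def arg using pos by (simp only: real_sqrt_gt_0_iff)
    have "real (m n) * ((L n - l n) * (L n / 2) / 2) \<le> (s n)\<^sup>2"
      unfolding s2 by (rule mult_left_mono, rule divide_right_mono[OF Q]) auto
    then have "real (m n) * ((L n - l n) * L n) / 4 \<le> (s n)\<^sup>2" by simp
    moreover have "(L n - l n) * L n / 2 \<le> (L n - l n) * (3 * l n - L n)" using Q by simp
    ultimately show ?case using elim L1 Ll lL mN s2 s0 by blast
  qed
  have var: "(\<lambda>n. real (m n) * (v n / (s n)\<^sup>2)) \<longlonglongrightarrow> 1"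
  proof (rule tendsto_of_dist_le)
    show "eventually (\<lambda>n. \<bar>real (m n) * (v n / (s n)\<^sup>2) - 1\<bar> \<le> 8 * K * inverse (L n - l n)) sequentially"
      using facts
    proof eventually_elim
      case (elim n)
      define Q where "Q = (L n - l n) * (3 * l n - L n)"
      have LQ: "0 < (L n - l n) * L n / 2" using elim by (simp add: mult_pos_pos)
      then have Q: "0 < Q" using elim unfolding Q_def by linarith
      have "\<bar>v n - Q / 2\<bar> \<le> K * (1 + L n)"
        unfolding v_def Q_def L_def l_def K_def using mpos[of n] elim by (intro variance_large) auto
      also have "\<dots> \<le> K * (2 * L n)" using K elim by (intro mult_left_mono) auto
      \<comment> \<open>The lower bound (L - l) L / 2 for Q, together with 1 + L \<le> 2 L, produces
        the constant 8 K.\<close>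
      finally have "2 / Q * \<bar>v n - Q / 2\<bar> \<le> 2 / ((L n - l n) * L n / 2) * (K * (2 * L n))"
        using LQ elim K Q unfolding Q_def[symmetric] by (intro mult_mono divide_left_mono) auto
      also have "\<dots> = 8 * K * inverse (L n - l n)" using elim by (simp add: field_simps)
      finally have le: "\<bar>2 / Q * (v n - Q / 2)\<bar> \<le> 8 * K * inverse (L n - l n)" unfolding abs_mult using Q by simp
      have eq: "2 / Q * (v n - Q / 2) = real (m n) * (v n / (s n)\<^sup>2) - 1"
      proof -
        have s2: "(s n)\<^sup>2 = real (m n) * (Q / 2)" using elim unfolding Q_def by simp
        show ?thesis unfolding s2 using Q mpos[of n] by (simp add: field_simps)
      qed
      show ?case using le unfolding eq .
    qed
    have "(\<lambda>n. 8 * K * inverse (L n - l n)) \<longlonglongrightarrow> 8 * K * 0"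
      by (intro tendsto_mult tendsto_const tendsto_inverse_0_at_top gap)
    then show "(\<lambda>n. 8 * K * inverse (L n - l n)) \<longlonglongrightarrow> 0" by simp
  qed
  have "conv_distr_vec M (\<lambda>n \<omega>. \<chi> i. (Ylcm (U n) (nat \<lfloor>real (m n) * t i\<rfloor>) \<omega> - cn (N n) (real (nat \<lfloor>real (m n) * t i\<rfloor>))) / s n) P (\<lambda>\<omega>. \<chi> i. B (t i) \<omega>)"
  proof (rule Brownian_limit_of_linear_statistic[OF us BM t m, where \<phi> = "\<lambda>n. lprimes (m n) (N n)"
        and Y = "\<lambda>n k \<omega>. Ylcm (U n) k \<omega> - cn (N n) (real k)"])
    show "(\<lambda>n. real (m n) * ((avg (N n) (\<lambda>u. (lprimes (m n) (N n) u)\<^sup>2) - (avg (N n) (lprimes (m n) (N n)))\<^sup>2) / (s n)\<^sup>2)) \<longlonglongrightarrow> 1"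
      using var unfolding v_def .
    show "(\<lambda>n. real (m n) * (avg (N n) (\<lambda>u. \<bar>lprimes (m n) (N n) u - avg (N n) (lprimes (m n) (N n))\<bar> ^ 3) / \<bar>s n\<bar> ^ 3)) \<longlonglongrightarrow> 0"
    proof (rule Lim_null_comparison)
      \<comment> \<open>The Lyapunov ratio is at most L / s times the variance ratio, which tends to
        1. The lower bound for s^2 with L - l > 1 and L \<le> 2 l bounds L / s by a function of m
        alone.\<close>
      show "eventually (\<lambda>n. norm (real (m n) * (avg (N n) (\<lambda>u. \<bar>lprimes (m n) (N n) u - avg (N n) (lprimes (m n) (N n))\<bar> ^ 3) / \<bar>s n\<bar> ^ 3))
          \<le> (\<lambda>x. sqrt (8 * ln x / x)) (real (m n)) * (real (m n) * (v n / (s n)\<^sup>2))) sequentially"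
        using facts
      proof eventually_elim
        case (elim n)
        define b where "b = avg (N n) (\<lambda>u. \<bar>lprimes (m n) (N n) u - avg (N n) (lprimes (m n) (N n))\<bar> ^ 3)"
        have b0: "0 \<le> b" unfolding b_def by (intro avg_nonneg) auto
        have b: "b \<le> L n * v n" unfolding b_def v_def L_def by (rule third_moment_large[OF N])
        have s: "0 < s n" using elim by simp
        have v0: "0 \<le> v n" unfolding v_def avg_centered_sq[OF N, symmetric] by (intro avg_nonneg) auto
        have "(L n / s n)\<^sup>2 \<le> 8 * l n / real (m n)"
        proof -
          have "(L n)\<^sup>2 / (s n)\<^sup>2 \<le> (L n)\<^sup>2 / (real (m n) * ((L n - l n) * L n) / 4)"
            using elim by (intro divide_left_mono) (auto intro!: mult_pos_pos divide_pos_pos)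
          also have "\<dots> = 4 * L n / (real (m n) * (L n - l n))" using elim by (simp add: power2_eq_square field_simps)
          also have "\<dots> \<le> 4 * L n / (real (m n) * 1)"
            using elim by (intro divide_left_mono mult_left_mono) (auto intro!: mult_pos_pos)
          also have "\<dots> \<le> 8 * l n / real (m n)" using elim by (simp add: divide_right_mono)
          finally show ?thesis by (simp add: power_divide)
        qed
        then have Ls: "L n / s n \<le> sqrt (8 * l n / real (m n))" by (rule real_le_rsqrt)
        have "norm (real (m n) * (b / \<bar>s n\<bar> ^ 3)) = real (m n) * (b / (s n) ^ 3)" using b0 s by simp
        also have "\<dots> \<le> real (m n) * (L n * v n / (s n) ^ 3)"
          using b s by (intro mult_left_mono divide_right_mono) auto
        also have "\<dots> = L n / s n * (real (m n) * (v n / (s n)\<^sup>2))" by (simp add: power2_eq_square power3_eq_cube mult_ac)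
        also have "\<dots> \<le> sqrt (8 * l n / real (m n)) * (real (m n) * (v n / (s n)\<^sup>2))"
          using v0 by (intro mult_right_mono Ls) auto
        finally show ?case unfolding b_def l_def .
      qed
      have "((\<lambda>x::real. sqrt (8 * ln x / x)) \<longlongrightarrow> 0) at_top" by real_asymp
      then have "(\<lambda>n. (\<lambda>x. sqrt (8 * ln x / x)) (real (m n))) \<longlonglongrightarrow> 0" by (rule filterlim_compose) (rule m)
      from tendsto_mult[OF this var] show "(\<lambda>n. (\<lambda>x. sqrt (8 * ln x / x)) (real (m n)) * (real (m n) * (v n / (s n)\<^sup>2))) \<longlonglongrightarrow> 0" by simp
    qed
    show "integrable (M n) (\<lambda>\<omega>. Ylcm (U n) k \<omega> - cn (N n) (real k))" for n k
      using uniform_sample.integrable_Ylcm[OF us] prob_space.finite_measure[OF prob] by (auto intro!: Bochner_Integration.integrable_diff finite_measure.integrable_const)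
    fix a :: real assume a: "0 \<le> a"
    define I where "I n = integral\<^sup>L (M n) (\<lambda>\<omega>. \<bar>Ylcm (U n) (nat \<lfloor>real (m n) * a\<rfloor>) \<omega> - cn (N n) (real (nat \<lfloor>real (m n) * a\<rfloor>))
        - centered_sum (N n) (U n) (lprimes (m n) (N n)) (nat \<lfloor>real (m n) * a\<rfloor>) \<omega>\<bar>)" for n
    have "(\<lambda>n. I n / \<bar>s n\<bar>) \<longlonglongrightarrow> 0"
    proof (rule Lim_null_comparison)
      show "eventually (\<lambda>n. norm (I n / \<bar>s n\<bar>) \<le> \<bar>C_err a\<bar> * sqrt (8 * inverse (L n - l n))) sequentially"
        using facts
      proof eventually_elim
        case (elim n)
        have I0: "0 \<le> I n" unfolding I_def by (intro integral_nonneg_AE) auto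
        have "real (nat \<lfloor>real (m n) * a\<rfloor>) \<le> a * real (m n)" using a by (simp add: mult.commute)
        then have "I n \<le> C_err a * sqrt (real (m n) * (1 + ln (real (m n))))"
          unfolding I_def centered_sum_def using a elim mpos[of n]
          by (intro uniform_sample.lcm_linear_approximation[OF us]) auto
        also have "\<dots> \<le> \<bar>C_err a\<bar> * sqrt (real (m n) * (1 + l n))" unfolding l_def by (intro mult_right_mono) auto
        finally have "I n / s n \<le> \<bar>C_err a\<bar> * sqrt (real (m n) * (1 + l n)) / s n" using elim by (intro divide_right_mono) auto
        also have "\<dots> = \<bar>C_err a\<bar> * (sqrt (real (m n) * (1 + l n)) / s n)" by simp
        also have "\<dots> \<le> \<bar>C_err a\<bar> * sqrt (8 * inverse (L n - l n))"
        proof (intro mult_left_mono real_le_rsqrt)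
          have "(sqrt (real (m n) * (1 + l n)) / s n)\<^sup>2 = real (m n) * (1 + l n) / (s n)\<^sup>2"
            using elim by (simp add: power_divide)
          \<comment> \<open>Uses 1 + l \<le> 2 L and s^2 \<ge> m (L - l) L / 4.\<close>
          also have "\<dots> \<le> real (m n) * (2 * L n) / (real (m n) * ((L n - l n) * L n) / 4)"
            using elim by (intro frac_le mult_left_mono) (auto intro!: mult_pos_pos divide_pos_pos)
          also have "\<dots> = 8 * inverse (L n - l n)" using elim by (simp add: field_simps)
          finally show "(sqrt (real (m n) * (1 + l n)) / s n)\<^sup>2 \<le> 8 * inverse (L n - l n)" .
        qed simp
        finally show ?case using I0 elim by simp
      qed
      have "(\<lambda>n. \<bar>C_err a\<bar> * sqrt (8 * inverse (L n - l n))) \<longlonglongrightarrow> \<bar>C_err a\<bar> * sqrt (8 * 0)"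
        by (intro tendsto_mult tendsto_const tendsto_real_sqrt tendsto_inverse_0_at_top gap)
      then show "(\<lambda>n. \<bar>C_err a\<bar> * sqrt (8 * inverse (L n - l n))) \<longlonglongrightarrow> 0" by simp
    qed
    then show "(\<lambda>n. integral\<^sup>L (M n) (\<lambda>\<omega>. \<bar>Ylcm (U n) (nat \<lfloor>real (m n) * a\<rfloor>) \<omega> - cn (N n) (real (nat \<lfloor>real (m n) * a\<rfloor>))
        - centered_sum (N n) (U n) (lprimes (m n) (N n)) (nat \<lfloor>real (m n) * a\<rfloor>) \<omega>\<bar>) / \<bar>s n\<bar>) \<longlonglongrightarrow> 0"
      unfolding I_def .
  qed
  then show ?thesis unfolding s_def L_def l_def .
qed

text \<open>The rows are assumed to be uniform samples only from n = 1 on, since [0] is empty and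
  carries no uniform law. Shifting the index by one drops row 0 without changing the limit.\<close>

lemma conv_distr_vec_Suc:
  "conv_distr_vec (\<lambda>n. M (Suc n)) (\<lambda>n. X (Suc n)) N Z \<Longrightarrow> conv_distr_vec M X N Z"
  unfolding conv_distr_vec_def by (auto intro: LIMSEQ_imp_Suc)

theorem theorem3p6:
  fixes M :: "nat \<Rightarrow> 'a measure"
    and U :: "nat \<Rightarrow> nat \<Rightarrow> 'a \<Rightarrow> nat"
    and m :: "nat \<Rightarrow> nat"
    and N :: "'b measure"
    and B :: "real \<Rightarrow> 'b \<Rightarrow> real"
    and t :: "'k::finite \<Rightarrow> real"
  assumes prob: "\<And>n. n \<ge> 1 \<Longrightarrow> prob_space (M n)"
    and indep: "\<And>n. n \<ge> 1 \<Longrightarrow> prob_space.indep_vars (M n) (\<lambda>_. count_space UNIV) (U n) UNIV"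
    and unif: "\<And>n j. n \<ge> 1 \<Longrightarrow>
                 distr (M n) (count_space UNIV) (U n j) = measure_pmf (pmf_of_set {1..n})"
    and mpos: "\<And>n. m n > 0"
    and BM: "standard_BM N B"
    and tnn: "\<And>i. t i \<ge> 0"
  shows
    "((\<forall>\<^sub>F n in sequentially. real (m n) \<le> sqrt (real n)) \<and> filterlim m at_top sequentially
       \<longrightarrow> fdd_conv M
             (\<lambda>n s \<omega>. (Ylcm (U n) (nat \<lfloor>real (m n) * s\<rfloor>) \<omega> - cn n (real (nat \<lfloor>real (m n) * s\<rfloor>)))
                       / (sqrt (real (m n) / 2) * ln (real (m n))))
             N B t)
   \<and> ((\<forall>\<^sub>F n in sequentially. real (m n) > sqrt (real n)) \<and> (\<lambda>n. real (m n) / real n) \<longlonglongrightarrow> 0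
       \<longrightarrow> fdd_conv M
             (\<lambda>n s \<omega>. (Ylcm (U n) (nat \<lfloor>real (m n) * s\<rfloor>) \<omega> - cn n (real (nat \<lfloor>real (m n) * s\<rfloor>)))
                       / sqrt (real (m n) / 2 * (ln (real n) - ln (real (m n)))
                               * (3 * ln (real (m n)) - ln (real n))))
             N B t)"
proof -
  have us: "uniform_sample (M (Suc n)) (Suc n) (U (Suc n))" for n
    using prob[of "Suc n"] indep[of "Suc n"] unif[of "Suc n"]
    by (simp add: uniform_sample_def uniform_sample_axioms_def)
  show ?thesis
    unfolding fdd_conv_def
  proof (intro conjI impI; rule conv_distr_vec_Suc)
    assume *: "(\<forall>\<^sub>F n in sequentially. real (m n) \<le> sqrt (real n)) \<and> filterlim m at_top sequentially"
    have "filterlim (\<lambda>n. real (m (Suc n))) at_top sequentially"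
      using * by (intro filterlim_compose[OF filterlim_real_sequentially] filterlim_compose[of m, OF _ filterlim_Suc]) auto
    moreover have "eventually (\<lambda>n. real (m (Suc n)) \<le> sqrt (real (Suc n))) sequentially"
      using * by (subst eventually_sequentially_Suc[of "\<lambda>n. real (m n) \<le> sqrt (real n)"]) simp
    ultimately show "conv_distr_vec (\<lambda>n. M (Suc n))
       (\<lambda>n \<omega>. \<chi> i. (Ylcm (U (Suc n)) (nat \<lfloor>real (m (Suc n)) * t i\<rfloor>) \<omega> - cn (Suc n) (real (nat \<lfloor>real (m (Suc n)) * t i\<rfloor>)))
          / (sqrt (real (m (Suc n)) / 2) * ln (real (m (Suc n))))) N (\<lambda>\<omega>. \<chi> i. B (t i) \<omega>)"
      by (intro lcm_fdd_limit_small us BM tnn mpos)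
  next
    assume *: "(\<forall>\<^sub>F n in sequentially. real (m n) > sqrt (real n)) \<and> (\<lambda>n. real (m n) / real n) \<longlonglongrightarrow> 0"
    have "eventually (\<lambda>n. sqrt (real (Suc n)) < real (m (Suc n))) sequentially"
      using * by (subst eventually_sequentially_Suc[of "\<lambda>n. sqrt (real n) < real (m n)"]) simp
    moreover have "(\<lambda>n. real (m (Suc n)) / real (Suc n)) \<longlonglongrightarrow> 0"
      using * LIMSEQ_Suc[of "\<lambda>n. real (m n) / real n" 0] by simp
    moreover have "filterlim (\<lambda>n. real (Suc n)) at_top sequentially"
      by (rule filterlim_compose[OF filterlim_real_sequentially filterlim_Suc])
    ultimately show "conv_distr_vec (\<lambda>n. M (Suc n))
       (\<lambda>n \<omega>. \<chi> i. (Ylcm (U (Suc n)) (nat \<lfloor>real (m (Suc n)) * t i\<rfloor>) \<omega> - cn (Suc n) (real (nat \<lfloor>real (m (Suc n)) * t i\<rfloor>)))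
          / sqrt (real (m (Suc n)) / 2 * (ln (real (Suc n)) - ln (real (m (Suc n)))) * (3 * ln (real (m (Suc n))) - ln (real (Suc n))))) N (\<lambda>\<omega>. \<chi> i. B (t i) \<omega>)"
      by (intro lcm_fdd_limit_large us BM tnn mpos)
  qed
qed

end
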